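(* Let $n,k,w$ be integers with $k<w<kn$. The universal cycle $\mathcal{G}_k(n,w^\uparrow)$ can be ranked in $\mathcal{O}(n^3k^2)$ time using $\mathcal{O}(n^3k)$ space; that is, there is an algorithm that, given any $\mathbf{s}\in\mathbf{S}_k(n,w^\uparrow)$, computes the rank of $\mathbf{s}$ in $\mathcal{G}_k(n,w^\uparrow)$ within these bounds.
   Context: $\mathbf{S}_k(n)$ is the set of length-$n$ strings over $\{\mathtt{1},\ldots,\mathtt{k}\}$; the weight of a string is the sum of its symbols; $\mathbf{S}_k(n,w^\uparrow)$ is the set of strings in $\mathbf{S}_k(n)$ with weight at least $w$. A necklace is a string that is lexicographically smallest among its rotations. $\mathbf{N}_k(n,w^\uparrow)=(\alpha_1,\ldots,\alpha_m)$ lists the necklaces in $\mathbf{S}_k(n,w^\uparrow)$ in lexicographic order. $\mathrm{ap}(\mathbf{s})$ is the shortest string $\mathbf{t}$ with $\mathbf{s}=\mathbf{t}^j$ for some $j\ge1$. $\mathcal{G}_k(n,w^\uparrow)=\mathrm{ap}(\alpha_1)\mathrm{ap}(\alpha_2)\cdots\mathrm{ap}(\alpha_m)$, regarded as a cyclic sequence; it is known to be a universal cycle for $\mathbf{S}_k(n,w^\uparrow)$, i.e., a cyclic sequence of length $|\mathbf{S}_k(n,w^\uparrow)|$ in which every string of $\mathbf{S}_k(n,w^\uparrow)$ occurs exactly once as a (cyclic) substring. The rank of $\mathbf{s}$ is the (1-based) starting index of its occurrence (rank 1 if it is a prefix; rank $|\mathbf{S}_k(n,w^\uparrow)|$ if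 it starts at the last symbol and wraps around). Complexity is in the unit-cost RAM model. *)

theory Defs
  imports "HOL-Library.List_Lexorder" "HOL-Library.Landau_Symbols"
begin

definition strings :: "nat \<Rightarrow> nat \<Rightarrow> nat list set" where
  "strings k n = {s. length s = n \<and> set s \<subseteq> {1..k}}"

definition weight :: "nat list \<Rightarrow> nat" where
  "weight s = sum_list s"

definition strings_ge :: "nat \<Rightarrow> nat \<Rightarrow> nat \<Rightarrow> nat list set" where
  "strings_ge k n w = {s \<in> strings k n. w \<le> weight s}"

text \<open>Here and below, \<open>\<le>\<close> on lists is the lexicographic order of
  \<^theory>\<open>HOL-Library.List_Lexorder\<close>.\<close>

definition necklace :: "nat list \<Rightarrow> bool" where
  "necklace s \<longleftrightarrow> (\<forall>i. s \<le> rotate i s)"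

definition necklaces_ge :: "nat \<Rightarrow> nat \<Rightarrow> nat \<Rightarrow> nat list list" where
  "necklaces_ge k n w = sorted_list_of_set {s \<in> strings_ge k n w. necklace s}"

definition ap :: "'a list \<Rightarrow> 'a list" where
  "ap s = (ARG_MIN length t. \<exists>j\<ge>1. s = concat (replicate j t))"

definition ucycle_ge :: "nat \<Rightarrow> nat \<Rightarrow> nat \<Rightarrow> nat list" where
  "ucycle_ge k n w = concat (map ap (necklaces_ge k n w))"

text \<open>Positions in a cyclic sequence are 1-based. An occurrence may wrap around, even several
  times if the cycle is shorter than the string (this happens for \<open>k = 1\<close>, where the cycle
  has length 1).\<close>

definition occurs_at :: "'a list \<Rightarrow> 'a list \<Rightarrow> nat \<Rightarrow> bool" where
  "occurs_at c s r \<longleftrightarrow>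
     1 \<le> r \<and> r \<le> length c \<and> (\<forall>j<length s. c ! ((r - 1 + j) mod length c) = s ! j)"

definition cyclic_rank :: "'a list \<Rightarrow> 'a list \<Rightarrow> nat" where
  "cyclic_rank c s = (THE r. occurs_at c s r)"

text \<open>The machine has registers indexed by the natural numbers, each holding a natural number of
  arbitrary size. The first argument of an assigning instruction is its target. In
  \<open>Load d a\<close> and \<open>Store d a\<close> the source register, respectively the target register,
  is addressed indirectly. Subtraction is truncated, so that comparisons reduce to tests for zero.
  The machine halts when the program counter leaves the program.\<close>

datatype instr =
    Const nat nat
  | Move nat nat
  | Add nat nat nat
  | Sub nat nat nat
  | Mul nat nat nat
  | Load nat nat
  | Store nat nat
  | Jump nat
  | JumpZero nat nat

type_synonym memory = "nat \<Rightarrow> nat"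
type_synonym config = "nat \<times> memory"

fun exec :: "instr \<Rightarrow> config \<Rightarrow> config" where
  "exec (Const d c) (pc, m) = (Suc pc, m(d := c))"
| "exec (Move d a) (pc, m) = (Suc pc, m(d := m a))"
| "exec (Add d a b) (pc, m) = (Suc pc, m(d := m a + m b))"
| "exec (Sub d a b) (pc, m) = (Suc pc, m(d := m a - m b))"
| "exec (Mul d a b) (pc, m) = (Suc pc, m(d := m a * m b))"
| "exec (Load d a) (pc, m) = (Suc pc, m(d := m (m a)))"
| "exec (Store d a) (pc, m) = (Suc pc, m(m d := m a))"
| "exec (Jump l) (pc, m) = (l, m)"
| "exec (JumpZero a l) (pc, m) = (if m a = 0 then l else Suc pc, m)"

fun accessed :: "instr \<Rightarrow> memory \<Rightarrow> nat set" where
  "accessed (Const d c) m = {d}"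
| "accessed (Move d a) m = {d, a}"
| "accessed (Add d a b) m = {d, a, b}"
| "accessed (Sub d a b) m = {d, a, b}"
| "accessed (Mul d a b) m = {d, a, b}"
| "accessed (Load d a) m = {d, a, m a}"
| "accessed (Store d a) m = {d, a, m d}"
| "accessed (Jump l) m = {}"
| "accessed (JumpZero a l) m = {a}"

definition halted :: "instr list \<Rightarrow> config \<Rightarrow> bool" where
  "halted P c \<longleftrightarrow> length P \<le> fst c"

definition step :: "instr list \<Rightarrow> config \<Rightarrow> config" where
  "step P c = (if halted P c then c else exec (P ! fst c) c)"

definition config_after :: "instr list \<Rightarrow> memory \<Rightarrow> nat \<Rightarrow> config" where
  "config_after P m t = (step P ^^ t) (0, m)"

text \<open>Started with memory \<open>m\<close>, the program halts after at most \<open>T\<close> instructions with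
  result \<open>r\<close> in register 0, and all registers it accesses lie among the first \<open>S\<close>.
  Bounding the addresses, rather than just the number of distinct registers in use, excludes
  savings by sparse use of a large address range.\<close>

definition computes_within :: "instr list \<Rightarrow> memory \<Rightarrow> nat \<Rightarrow> nat \<Rightarrow> nat \<Rightarrow> bool" where
  "computes_within P m T S r \<longleftrightarrow>
     (\<exists>t\<le>T. halted P (config_after P m t) \<and> snd (config_after P m t) 0 = r \<and>
        (\<forall>i<t. let c = config_after P m i in
           \<not> halted P c \<longrightarrow> accessed (P ! fst c) (snd c) \<subseteq> {..<S}))"

definition memory_of :: "nat list \<Rightarrow> memory" where
  "memory_of xs = (\<lambda>i. if i < length xs then xs ! i else 0)"

definition ram_input :: "nat \<Rightarrow> nat \<Rightarrow> nat \<Rightarrow> nat list \<Rightarrow> memory" where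
  "ram_input n k w s = memory_of (n # k # w # s)"

end

theory Submission imports Defs begin

text \<open>
  The number of symbols of the cycle preceding the necklace \<open>\<alpha>\<close> is the number of strings having a
  rotation below \<open>\<alpha>\<close>. Raising the last symbol other than \<open>k\<close> of a necklace \<open>x a k\<^sup>z\<close> yields a necklace of
  larger weight, so the next necklace of the list starts with \<open>x (a + 1)\<close>. Hence
  a rotation \<open>z u\<close> of \<open>\<alpha> = u z\<close> occurs across the boundary behind \<open>ap \<alpha>\<close>, unless \<open>z = k\<^sup>r\<close>, in which case
  it occurs across the boundary before the first necklace with prefix \<open>u\<close>. As every string
  occurs and the cycle has the right length, occurrences are unique.

  It remains to count the strings all of whose rotations are at least a given prefix \<open>u\<close> of a necklace.
  Extending \<open>u\<close> by its least period to a word \<open>v\<close> of length \<open>n\<close> does not change this set. The strings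
  all of whose rotations exceed \<open>v\<close> are exactly those decomposing cyclically into blocks \<open>v\<^sub>1\<dots>v\<^sub>q c\<close> with
  \<open>v\<^bsub>q+1\<^esub> < c\<close>; the boundaries between blocks are unique, being the positions at which no nonempty
  prefix of \<open>v\<close> ends. Block sequences of given length and weight at least \<open>b\<close> are counted by dynamic
  programming, where the truncated subtraction in the weight index realizes ``at least''. The
  remaining strings are the rotations of \<open>v\<close>, if \<open>v\<close> is a necklace, that is, if its least
  period divides \<open>n\<close>.
\<close>

subsection \<open>Structured programs\<close>

text \<open>What is counted are the strings with no rotation below \<open>u\<close>, because these
  arise by freely concatenating blocks that depend only on \<open>v\<close>; the number of strings
  with a rotation below \<open>u\<close> is the difference to
  \<open>card (strings_ge k n w)\<close>. The latter comes from the same program, run with the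
  one-letter pattern 1, which excludes nothing. A table entry sums over the length and the last
  letter of a first block, at cost O(n k). There are (n + 1)(w + 1) entries and w < k n, whence
  O(n^3 k^2) time, while the table takes O(n^2 k) registers. The least rotation is found by
  comparing all n rotations as numbers in base \<open>k + 1\<close>: unbounded registers make each
  comparison one subtraction, and the search takes O(n^2) time. The hypothesis k < w < k n yields n
  >= 2, on which the lemmas about the cycle rest, and k + w >= 3, which keeps the first address
  written by the program off the input. The filter in the theorem is principal, so every additive
  constant must be absorbed by n >= 1 and k >= 1 on the whole range.\<close>

datatype com =
    Block "instr list"
  | Seq com com  (infixr ";;" 60)
  | Cond nat com com
  | While nat com

fun com_size :: "com \<Rightarrow> nat" where
  "com_size (Block is) = length is"
| "com_size (a ;; b) = com_size a + com_size b"
| "com_size (Cond r a b) = com_size a + com_size b + 2"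
| "com_size (While r a) = com_size a + 2"

text \<open>Jumps of the machine are absolute, so \<open>p\<close> carries the address at which the
  code will be placed.\<close>

fun compile :: "nat \<Rightarrow> com \<Rightarrow> instr list" where
  "compile p (Block is) = is"
| "compile p (a ;; b) = compile p a @ compile (p + com_size a) b"
| "compile p (Cond r a b) =
     [JumpZero r (p + com_size a + 2)] @ compile (Suc p) a @ [Jump (p + com_size a + 2 + com_size b)] @
     compile (p + com_size a + 2) b"
| "compile p (While r a) = [JumpZero r (p + com_size a + 2)] @ compile (Suc p) a @ [Jump p]"

lemma length_compile [simp]: "length (compile p c) = com_size c"
  by (induction c arbitrary: p) auto

fun straight :: "instr \<Rightarrow> bool" where
  "straight (Jump l) = False"
| "straight (JumpZero a l) = False"
| "straight _ = True"

fun blk :: "instr list \<Rightarrow> memory \<Rightarrow> memory" where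
  "blk [] m = m"
| "blk (i # is) m = blk is (snd (exec i (0, m)))"

text \<open>Indirect addresses depend on the current memory, so the bound \<open>S\<close> is
  checked along the execution. Straight-line instructions act on memory independently of the program
  counter, which is set to 0.\<close>

fun blk_ok :: "nat \<Rightarrow> instr list \<Rightarrow> memory \<Rightarrow> bool" where
  "blk_ok S [] m \<longleftrightarrow> True"
| "blk_ok S (i # is) m \<longleftrightarrow>
     straight i \<and> (\<forall>a\<in>accessed i m. a < S) \<and> blk_ok S is (snd (exec i (0, m)))"

text \<open>The counts are exact: a test costs one instruction, and the first branch of a
  conditional as well as every round of a loop pay one more for the closing jump.\<close>

inductive runs :: "nat \<Rightarrow> com \<Rightarrow> memory \<Rightarrow> nat \<Rightarrow> memory \<Rightarrow> bool" for S where
  runs_Block: "blk_ok S is m \<Longrightarrow> runs S (Block is) m (length is) (blk is m)"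
| runs_Seq: "runs S a m t m' \<Longrightarrow> runs S b m' t' m'' \<Longrightarrow> runs S (a ;; b) m (t + t') m''"
| runs_Cond_nonzero: "r < S \<Longrightarrow> m r \<noteq> 0 \<Longrightarrow> runs S a m t m' \<Longrightarrow> runs S (Cond r a b) m (t + 2) m'"
| runs_Cond_zero: "r < S \<Longrightarrow> m r = 0 \<Longrightarrow> runs S b m t m' \<Longrightarrow> runs S (Cond r a b) m (t + 1) m'"
| runs_While_zero: "r < S \<Longrightarrow> m r = 0 \<Longrightarrow> runs S (While r a) m 1 m"
| runs_While_nonzero: "r < S \<Longrightarrow> m r \<noteq> 0 \<Longrightarrow> runs S a m t m' \<Longrightarrow> runs S (While r a) m' t' m'' \<Longrightarrow>
     runs S (While r a) m (t + t' + 2) m''"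

section \<open>Simulation of structured programs by the machine\<close>

inductive reach :: "instr list \<Rightarrow> nat \<Rightarrow> config \<Rightarrow> nat \<Rightarrow> config \<Rightarrow> bool" for P S where
  reach_refl: "reach P S c 0 c"
| reach_step: "pc < length P \<Longrightarrow> accessed (P ! pc) m \<subseteq> {..<S} \<Longrightarrow>
     reach P S (exec (P ! pc) (pc, m)) t c \<Longrightarrow> reach P S (pc, m) (Suc t) c"

lemma reach_trans: "reach P S c t c' \<Longrightarrow> reach P S c' t' c'' \<Longrightarrow> reach P S c (t + t') c''"
  by (induction rule: reach.induct) (auto intro: reach.intros)

lemma reach_one:
  "pc < length P \<Longrightarrow> accessed (P ! pc) m \<subseteq> {..<S} \<Longrightarrow> reach P S (pc, m) 1 (exec (P ! pc) (pc, m))"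
  using reach_step[OF _ _ reach_refl, of pc P m S] by simp

lemma exec_straight: "straight i \<Longrightarrow> exec i (pc, m) = (Suc pc, snd (exec i (0, m)))"
  by (cases i) auto

definition code_at :: "instr list \<Rightarrow> nat \<Rightarrow> instr list \<Rightarrow> bool" where
  "code_at P p c \<longleftrightarrow> (\<exists>xs ys. P = xs @ c @ ys \<and> length xs = p)"

lemma code_at_append: "code_at P p (c @ d) \<longleftrightarrow> code_at P p c \<and> code_at P (p + length c) d"
proof
  assume "code_at P p (c @ d)"
  then obtain xs ys where *: "P = xs @ (c @ d) @ ys" "length xs = p"
    by (auto simp: code_at_def)
  then show "code_at P p c \<and> code_at P (p + length c) d"
    unfolding code_at_def
    by (intro conjI exI[of _ xs] exI[of _ "d @ ys"] exI[of _ "xs @ c"] exI[of _ ys]) auto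
next
  assume "code_at P p c \<and> code_at P (p + length c) d"
  then obtain xs ys us vs where *: "P = xs @ c @ ys" "length xs = p"
    "P = us @ d @ vs" "length us = p + length c"
    unfolding code_at_def by blast
  then have "us = xs @ c"
    by (metis append.assoc append_eq_conv_conj length_append)
  with * show "code_at P p (c @ d)"
    unfolding code_at_def by (intro exI[of _ xs] exI[of _ vs]) auto
qed

lemma code_at_Cons:
  "code_at P p (i # c) \<longleftrightarrow> p < length P \<and> P ! p = i \<and> code_at P (Suc p) c"
proof -
  have "code_at P p [i] \<longleftrightarrow> p < length P \<and> P ! p = i"
  proof
    assume "p < length P \<and> P ! p = i"
    then show "code_at P p [i]"
      unfolding code_at_def
      by (intro exI[of _ "take p P"] exI[of _ "drop (Suc p) P"]) (auto simp: id_take_nth_drop[symmetric])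
  qed (auto simp: code_at_def)
  then show ?thesis
    using code_at_append[of P p "[i]" c] by simp
qed

lemma reach_blk:
  "code_at P p is \<Longrightarrow> blk_ok S is m \<Longrightarrow> reach P S (p, m) (length is) (p + length is, blk is m)"
proof (induction "is" arbitrary: p m)
  case Nil
  then show ?case by (auto intro: reach_refl)
next
  case (Cons i "is")
  have "reach P S (Suc p, snd (exec i (0, m))) (length is)
      (Suc p + length is, blk is (snd (exec i (0, m))))"
    using Cons.IH[of "Suc p" "snd (exec i (0, m))"] Cons.prems by (simp add: code_at_Cons)
  then show ?case
    using Cons.prems exec_straight[of i p m] reach_step[of p P m S "length is"]
    by (auto simp: code_at_Cons)
qed

text \<open>Induction on the derivation rather than on the program: the remaining rounds of a loop
  are a derivation for the same loop, placed at the same address \<open>p\<close>, so the second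
  induction hypothesis covers them.\<close>

lemma reach_compile:
  "runs S c m t m' \<Longrightarrow> code_at P p (compile p c) \<Longrightarrow> reach P S (p, m) t (p + com_size c, m')"
proof (induction arbitrary: p rule: runs.induct)
  case (runs_Block "is" m)
  then show ?case by (auto intro: reach_blk)
next
  case (runs_Seq a m t m' b t' m'')
  then have "reach P S (p, m) t (p + com_size a, m')"
    "reach P S (p + com_size a, m') t' (p + com_size a + com_size b, m'')"
    by (auto simp: code_at_append)
  then show ?case
    by (metis com_size.simps(2) reach_trans add.assoc)
next
  case (runs_Cond_nonzero r m a t m' b)
  then have 2: "Suc p + com_size a < length P"
    "P ! (Suc p + com_size a) = Jump (p + com_size a + 2 + com_size b)"
    and 3: "p < length P" "P ! p = JumpZero r (p + com_size a + 2)"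
    and 4: "code_at P (Suc p) (compile (Suc p) a)"
    by (auto simp: code_at_append code_at_Cons)
  note 1 = runs_Cond_nonzero.IH[OF 4]
  have "reach P S (p, m) 1 (Suc p, m)"
    using reach_one[OF 3(1), of m S] 3(2) runs_Cond_nonzero.hyps by simp
  moreover have "reach P S (Suc p + com_size a, m') 1 (p + com_size a + 2 + com_size b, m')"
    using reach_one[OF 2(1), of m' S] 2(2) by simp
  ultimately have "reach P S (p, m) (1 + (t + 1)) (p + com_size a + 2 + com_size b, m')"
    using 1 reach_trans by blast
  then show ?case by (simp add: algebra_simps)
next
  case (runs_Cond_zero r m b t m' a)
  then have 3: "p < length P" "P ! p = JumpZero r (p + com_size a + 2)"
    and 4: "code_at P (p + com_size a + 2) (compile (p + com_size a + 2) b)"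
    by (auto simp: code_at_append code_at_Cons)
  note 1 = runs_Cond_zero.IH[OF 4]
  have "reach P S (p, m) 1 (p + com_size a + 2, m)"
    using reach_one[OF 3(1), of m S] 3(2) runs_Cond_zero.hyps by simp
  then have "reach P S (p, m) (1 + t) (p + com_size a + 2 + com_size b, m')"
    using 1 reach_trans by blast
  then show ?case by (simp add: algebra_simps)
next
  case (runs_While_zero r m a)
  then have 3: "p < length P" "P ! p = JumpZero r (p + com_size a + 2)"
    by (auto simp: code_at_append code_at_Cons)
  show ?case
    using reach_one[OF 3(1), of m S] 3(2) runs_While_zero.hyps by simp
next
  case (runs_While_nonzero r m a t m' t' m'')
  then have 2: "Suc p + com_size a < length P" "P ! (Suc p + com_size a) = Jump p"
    and 3: "p < length P" "P ! p = JumpZero r (p + com_size a + 2)"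
    and 5: "code_at P (Suc p) (compile (Suc p) a)"
    by (auto simp: code_at_append code_at_Cons)
  note 1 = runs_While_nonzero.IH(1)[OF 5]
  have 4: "reach P S (p, m') t' (p + (com_size a + 2), m'')"
    using runs_While_nonzero.IH(2)[OF runs_While_nonzero.prems] by simp
  have "reach P S (p, m) 1 (Suc p, m)"
    using reach_one[OF 3(1), of m S] 3(2) runs_While_nonzero.hyps by simp
  moreover have "reach P S (Suc p + com_size a, m') 1 (p, m')"
    using reach_one[OF 2(1), of m' S] 2(2) by simp
  ultimately have "reach P S (p, m) (1 + (t + (1 + t'))) (p + (com_size a + 2), m'')"
    using 1 4 reach_trans by blast
  then show ?case by (simp add: algebra_simps)
qed

lemma reach_config_after:
  assumes "reach P S c t c'"
  shows "(step P ^^ t) c = c' \<and>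
    (\<forall>i<t. accessed (P ! fst ((step P ^^ i) c)) (snd ((step P ^^ i) c)) \<subseteq> {..<S})"
  using assms
proof (induction rule: reach.induct)
  case (reach_refl c)
  then show ?case by simp
next
  case (reach_step pc m t c)
  have s: "step P (pc, m) = exec (P ! pc) (pc, m)"
    using reach_step by (simp add: step_def halted_def)
  have f: "(step P ^^ Suc i) (pc, m) = (step P ^^ i) (exec (P ! pc) (pc, m))" for i
    by (simp add: funpow_swap1 s)
  show ?case
  proof (intro conjI allI impI)
    show "(step P ^^ Suc t) (pc, m) = c"
      using reach_step.IH f by simp
  next
    fix i assume "i < Suc t"
    then show "accessed (P ! fst ((step P ^^ i) (pc, m))) (snd ((step P ^^ i) (pc, m))) \<subseteq> {..<S}"
      using reach_step f by (cases i) auto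
  qed
qed

lemma computes_within_compile:
  assumes "runs S c m t m'" "t \<le> T"
  shows "computes_within (compile 0 c) m T S (m' 0)"
proof -
  have "code_at (compile 0 c) 0 (compile 0 c)"
    unfolding code_at_def by auto
  from reach_config_after[OF reach_compile[OF assms(1) this]] show ?thesis
    unfolding computes_within_def config_after_def
    using assms(2) by (intro exI[of _ t]) (auto simp: halted_def Let_def)
qed

section \<open>Total correctness with time bounds\<close>

definition wp :: "nat \<Rightarrow> com \<Rightarrow> nat \<Rightarrow> (memory \<Rightarrow> bool) \<Rightarrow> memory \<Rightarrow> bool" where
  "wp S c T Q m \<longleftrightarrow> (\<exists>t m'. t \<le> T \<and> runs S c m t m' \<and> Q m')"

lemma wp_mono: "wp S c T Q m \<Longrightarrow> T \<le> T' \<Longrightarrow> (\<And>m'. Q m' \<Longrightarrow> Q' m') \<Longrightarrow> wp S c T' Q' m"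
  unfolding wp_def by (meson order_trans)

lemma wp_Block: "blk_ok S is m \<Longrightarrow> length is \<le> T \<Longrightarrow> Q (blk is m) \<Longrightarrow> wp S (Block is) T Q m"
  unfolding wp_def using runs_Block by blast

lemma wp_Seq:
  "wp S a T Q' m \<Longrightarrow> (\<And>m'. Q' m' \<Longrightarrow> wp S b T' Q m') \<Longrightarrow> wp S (a ;; b) (T + T') Q m"
  unfolding wp_def by (meson add_mono runs_Seq)

lemma wp_Cond:
  assumes "r < S" "m r \<noteq> 0 \<Longrightarrow> wp S a T Q m" "m r = 0 \<Longrightarrow> wp S b T Q m"
  shows "wp S (Cond r a b) (T + 2) Q m"
proof (cases "m r = 0")
  case True
  then obtain t m' where "t \<le> T" "runs S b m t m'" "Q m'"
    using assms unfolding wp_def by blast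
  then show ?thesis
    unfolding wp_def using runs_Cond_zero[of r S m b t m' a] assms True
    by (intro exI[of _ "t + 1"] exI[of _ m']) auto
next
  case False
  then obtain t m' where "t \<le> T" "runs S a m t m'" "Q m'"
    using assms unfolding wp_def by blast
  then show ?thesis
    unfolding wp_def using runs_Cond_nonzero[of r S m a t m' b] assms False
    by (intro exI[of _ "t + 2"] exI[of _ m']) auto
qed

text \<open>The invariant is indexed by the number of completed rounds, which fixes their total at
  \<open>N - i\<close> and replaces a termination argument. Each round adds the test and the jump
  back, and one failing test ends the loop.\<close>

lemma wp_While_count:
  assumes "r < S" "J i m" "i \<le> N"
    and body: "\<And>i m. i < N \<Longrightarrow> J i m \<Longrightarrow> m r \<noteq> 0 \<and> wp S c T (J (Suc i)) m"
    and stop: "\<And>m. J N m \<Longrightarrow> m r = 0"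
  shows "wp S (While r c) ((N - i) * (T + 2) + 1) (J N) m"
  using assms(2,3)
proof (induction "N - i" arbitrary: i m)
  case 0
  then show ?case
    unfolding wp_def using stop[of m] runs_While_zero[OF assms(1), of m c] by auto
next
  case (Suc d)
  then have i: "i < N" by simp
  with body Suc obtain t m' where t: "m r \<noteq> 0" "t \<le> T" "runs S c m t m'" "J (Suc i) m'"
    unfolding wp_def by metis
  have "d = N - Suc i" using Suc by simp
  from Suc.hyps(1)[OF this] t(4) i obtain t' m''
    where t': "t' \<le> (N - Suc i) * (T + 2) + 1" "runs S (While r c) m' t' m''" "J N m''"
    unfolding wp_def by (metis Suc_leI)
  have "N - i = Suc (N - Suc i)" using i by simp
  then have "t + t' + 2 \<le> (N - i) * (T + 2) + 1"
    using t(2) t'(1) by simp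
  with runs_While_nonzero[OF assms(1) t(1,3) t'(2)] t'(3) show ?case
    unfolding wp_def by blast
qed

text \<open>In all programs below, registers 0, 2, 9 hold \<open>n\<close>, \<open>w\<close>, \<open>k\<close> (register 1 is avoided because
  the simplifier rewrites the index 1 to \<open>Suc 0\<close>), register 4 holds the constant 1, registers 3, 5, 6
  hold the addresses of the doubled input, of the pattern and of the table, and registers 7, 8 hold
  \<open>w + 1\<close>, \<open>n + 1\<close>. The counting program takes the length of the given prefix of the pattern
  in register 22, keeps the least period in register 24 and returns its result in register 45.\<close>

definition for_loop :: "nat \<Rightarrow> nat \<Rightarrow> nat \<Rightarrow> com \<Rightarrow> com" where
  "for_loop i b t c =
     Block [Const i 0, Move t b] ;; While t (c ;; Block [Add i i 4, Sub t b i])"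

text \<open>The loop itself writes the counter \<open>i\<close> and the remaining count
  \<open>t\<close>, hence \<open>J\<close> is required of the memory after these updates. The 4
  instructions per round beside the body are the two updates, the test and the jump; the 3 extra
  ones are the initialization and the last test.\<close>

lemma wp_for_loop:
  assumes regs: "distinct [i, b, t, 4]" "i < S" "b < S" "t < S" "4 < S"
    and init: "m b = N" "m 4 = 1" "J 0 (m(i := 0, t := N))"
    and body: "\<And>j m. j < N \<Longrightarrow> m i = j \<Longrightarrow> m b = N \<Longrightarrow> m 4 = 1 \<Longrightarrow> J j m \<Longrightarrow>
      wp S c T (\<lambda>m'. m' i = j \<and> m' b = N \<and> m' 4 = 1 \<and> J (Suc j) (m'(i := Suc j, t := N - Suc j))) m"
  shows "wp S (for_loop i b t c) (N * (T + 4) + 3)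
    (\<lambda>m'. m' i = N \<and> m' b = N \<and> m' 4 = 1 \<and> J N m') m"
proof -
  let ?I = "\<lambda>j m'. m' i = j \<and> m' b = N \<and> m' 4 = 1 \<and> m' t = N - j \<and> J j m'"
  have "wp S (While t (c ;; Block [Add i i 4, Sub t b i])) ((N - 0) * ((T + 2) + 2) + 1) (?I N)
      (m(i := 0, t := N))"
  proof (rule wp_While_count[where J = ?I])
    show "?I 0 (m(i := 0, t := N))" using init regs by simp
  next
    fix j m assume j: "j < N" "?I j m"
    have "wp S (c ;; Block [Add i i 4, Sub t b i]) (T + 2) (?I (Suc j)) m"
    proof (rule wp_Seq)
      show "wp S c T (\<lambda>m'. m' i = j \<and> m' b = N \<and> m' 4 = 1 \<and>
          J (Suc j) (m'(i := Suc j, t := N - Suc j))) m"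
        using body j by blast
    qed (use regs in \<open>auto intro!: wp_Block\<close>)
    with j show "m t \<noteq> 0 \<and> wp S (c ;; Block [Add i i 4, Sub t b i]) (T + 2) (?I (Suc j)) m"
      by simp
  qed (use regs in auto)
  then have loop: "wp S (While t (c ;; Block [Add i i 4, Sub t b i])) (N * (T + 4) + 1) (?I N)
      (m(i := 0, t := N))"
    by (rule wp_mono) (auto simp: algebra_simps)
  have "wp S (for_loop i b t c) (2 + (N * (T + 4) + 1)) (?I N) m"
    unfolding for_loop_def
  proof (rule wp_Seq[where Q' = "\<lambda>m'. m' = m(i := 0, t := N)"])
    show "wp S (Block [Const i 0, Move t b]) 2 (\<lambda>m'. m' = m(i := 0, t := N)) m"
      using regs init by (auto intro!: wp_Block)
  qed (use loop in simp)
  then show ?thesis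
    by (rule wp_mono) auto
qed

subsection \<open>Words decomposing into blocks\<close>

text \<open>Words are functions on positions here, so that lists, cyclic words and stretches of
  memory share one notion of comparison.\<close>

definition beats :: "(nat \<Rightarrow> nat) \<Rightarrow> (nat \<Rightarrow> nat) \<Rightarrow> nat \<Rightarrow> nat \<Rightarrow> bool" where
  "beats v x i q \<longleftrightarrow> (\<forall>j<q. x (i + j) = v j) \<and> v q < x (i + q)"

text \<open>First-difference form of: every suffix of \<open>v 0 .. v (n - 1)\<close> is
  lexicographically at least the prefix of the same length. Prefixes of necklaces have this
  property.\<close>

definition prenecklace :: "nat \<Rightarrow> (nat \<Rightarrow> nat) \<Rightarrow> bool" where
  "prenecklace n v \<longleftrightarrow> (\<forall>a l. a + l < n \<longrightarrow> (\<forall>j<l. v (a + j) = v j) \<longrightarrow> v l \<le> v (a + l))"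

lemma beats_unique: "beats v x i q \<Longrightarrow> beats v x i q' \<Longrightarrow> q = q'"
  unfolding beats_def by (metis linorder_neqE_nat nat_less_le)

text \<open>Started \<open>d\<close> letters into a match, \<open>x\<close> reads
  \<open>v d, v (d + 1), ..\<close>, which for a prenecklace can first differ from \<open>v\<close>
  only upwards. If no difference occurs before the end of the match, the decisive letter
  \<open>x (i + q)\<close> exceeds \<open>v q\<close> and hence \<open>v (q - d)\<close>.\<close>

lemma beats_inner:
  assumes "prenecklace n v" "q < n" "beats v x i q" "d \<le> q"
  shows "\<exists>q'\<le>q - d. beats v x (i + d) q'"
proof (cases "\<forall>j<q - d. v (d + j) = v j")
  case True
  with assms have "v (q - d) \<le> v (d + (q - d))"
    unfolding prenecklace_def by (metis le_add_diff_inverse)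
  moreover have "x (i + d + j) = v j" if "j < q - d" for j
    using that True assms(3,4) by (auto simp: beats_def add.assoc)
  ultimately have "beats v x (i + d) (q - d)"
    using assms(3,4) by (auto simp: beats_def)
  then show ?thesis by blast
next
  case False
  define j where "j = (LEAST j. j < q - d \<and> v (d + j) \<noteq> v j)"
  have j: "j < q - d" "v (d + j) \<noteq> v j"
    using False LeastI_ex[of "\<lambda>j. j < q - d \<and> v (d + j) \<noteq> v j"] unfolding j_def by auto
  have eq: "v (d + j') = v j'" if "j' < j" for j'
    using not_less_Least[of j' "\<lambda>j. j < q - d \<and> v (d + j) \<noteq> v j"] that j unfolding j_def by auto
  have "v j \<le> v (d + j)"
    using assms(1,2) j eq unfolding prenecklace_def by simp
  moreover have "x (i + d + j') = v (d + j')" if "j' \<le> j" for j'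
    using that j assms(3) by (auto simp: beats_def add.assoc)
  ultimately have "beats v x (i + d) j"
    using j eq by (auto simp: beats_def)
  with j show ?thesis by (intro exI[of _ j]) auto
qed

text \<open>Each position must win before the end of the word, without wrapping around; this makes
  the property closed under concatenation.\<close>

definition dominating :: "(nat \<Rightarrow> nat) \<Rightarrow> nat list \<Rightarrow> bool" where
  "dominating v z \<longleftrightarrow> (\<forall>i<length z. \<exists>q. i + q < length z \<and> beats v ((!) z) i q)"

lemma beats_cong:
  assumes "\<And>j. j \<le> q \<Longrightarrow> x (i + j) = y (i' + j)"
  shows "beats v x i q \<longleftrightarrow> beats v y i' q"
  using assms unfolding beats_def by auto

lemma dominating_Nil [simp]: "dominating v []"
  by (simp add: dominating_def)

lemma dominating_append: "dominating v a \<Longrightarrow> dominating v b \<Longrightarrow> dominating v (a @ b)"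
  unfolding dominating_def
proof (intro allI impI)
  fix i assume a: "\<forall>i<length a. \<exists>q. i + q < length a \<and> beats v ((!) a) i q"
    and b: "\<forall>i<length b. \<exists>q. i + q < length b \<and> beats v ((!) b) i q"
    and i: "i < length (a @ b)"
  show "\<exists>q. i + q < length (a @ b) \<and> beats v ((!) (a @ b)) i q"
  proof (cases "i < length a")
    case True
    with a obtain q where q: "i + q < length a" "beats v ((!) a) i q" by blast
    then have "beats v ((!) (a @ b)) i q"
      by (subst beats_cong[where y = "(!) a" and i' = i]) (auto simp: nth_append)
    with q show ?thesis by (intro exI[of _ q]) auto
  next
    case False
    with b i obtain q where q: "i - length a + q < length b" "beats v ((!) b) (i - length a) q"
      by (metis add_diff_inverse_nat length_append nat_add_left_cancel_less)
    have "beats v ((!) (a @ b)) i q"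
      using q False by (subst beats_cong[where y = "(!) b" and i' = "i - length a"])
        (auto simp: nth_append)
    with q False show ?thesis by (intro exI[of _ q]) auto
  qed
qed

lemma dominating_appendD: "dominating v (a @ b) \<Longrightarrow> dominating v b"
  unfolding dominating_def
proof (intro allI impI)
  fix i assume *: "\<forall>i<length (a @ b). \<exists>q. i + q < length (a @ b) \<and> beats v ((!) (a @ b)) i q"
    and i: "i < length b"
  then obtain q where q: "length a + i + q < length (a @ b)" "beats v ((!) (a @ b)) (length a + i) q"
    by (metis length_append nat_add_left_cancel_less)
  then have "beats v ((!) b) i q"
    by (subst beats_cong[where y = "(!) (a @ b)" and i' = "length a + i"]) (auto simp: nth_append add.assoc)
  with q show "\<exists>q. i + q < length b \<and> beats v ((!) b) i q" by auto
qed

definition block :: "(nat \<Rightarrow> nat) \<Rightarrow> nat \<Rightarrow> nat \<Rightarrow> nat list" where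
  "block v q c = map v [0..<q] @ [c]"

lemma length_block [simp]: "length (block v q c) = Suc q"
  by (simp add: block_def)

lemma beats_block: "v q < c \<Longrightarrow> beats v ((!) (block v q c @ z)) 0 q"
  by (auto simp: beats_def block_def nth_append)

lemma dominating_block:
  assumes "prenecklace n v" "q < n" "v q < c"
  shows "dominating v (block v q c)"
  unfolding dominating_def
proof (intro allI impI)
  fix i assume i: "i < length (block v q c)"
  then obtain q' where "q' \<le> q - i" "beats v ((!) (block v q c)) i q'"
    using beats_inner[OF assms(1,2), of "(!) (block v q c)" 0 i] beats_block[of v q c "[]"] assms(3)
    by auto
  with i show "\<exists>q'. i + q' < length (block v q c) \<and> beats v ((!) (block v q c)) i q'"
    by (intro exI[of _ q']) auto
qed

lemma dominating_Cons_block: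
  assumes "prenecklace n v" "q < n" "v q < c"
  shows "dominating v (block v q c @ z) \<longleftrightarrow> dominating v z"
  using dominating_block[OF assms] dominating_append dominating_appendD by blast

lemma block_decomp:
  assumes "i + q < length z" "beats v ((!) z) i q"
  shows "drop i z = block v q (z ! (i + q)) @ drop (Suc (i + q)) z"
proof (rule nth_equalityI)
  show "length (drop i z) = length (block v q (z ! (i + q)) @ drop (Suc (i + q)) z)"
    using assms(1) by simp
  fix j assume "j < length (drop i z)"
  then show "drop i z ! j = (block v q (z ! (i + q)) @ drop (Suc (i + q)) z) ! j"
    using assms by (cases "j = q") (auto simp: nth_append block_def beats_def not_less nth_Cons')
qed

text \<open>The block length is the length of the match with \<open>v\<close> at position 0, so it
  can be read off the word.\<close>

lemma block_append_inj:
  assumes "block v q c @ z = block v q' c' @ z'" "v q < c" "v q' < c'"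
  shows "q = q' \<and> c = c' \<and> z = z'"
proof -
  have "q = q'"
    using beats_unique[of v "(!) (block v q c @ z)" 0 q q'] beats_block assms by metis
  with assms(1) show ?thesis by (simp add: block_def)
qed

section \<open>Counting sequences of blocks\<close>

definition block_words :: "(nat \<Rightarrow> nat) \<Rightarrow> nat \<Rightarrow> nat \<Rightarrow> nat \<Rightarrow> nat list set" where
  "block_words v k m b = {z \<in> strings_ge k m b. dominating v z}"

lemmas strings_defs = strings_ge_def strings_def weight_def

lemma finite_strings [simp, intro]: "finite (strings k n)"
proof -
  have "strings k n = {s. set s \<subseteq> {1..k} \<and> length s = n}"
    by (auto simp: strings_def)
  then show ?thesis by (simp only: finite_lists_length_eq[of "{1..k}" n] finite_atLeastAtMost)
qed

lemma finite_strings_ge [simp, intro]: "finite (strings_ge k n w)"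
  by (simp add: strings_ge_def)

lemma finite_block_words [simp, intro]: "finite (block_words v k m b)"
  by (simp add: block_words_def)

lemma block_words_0: "block_words v k 0 b = (if b = 0 then {[]} else {})"
  by (auto simp: block_words_def strings_defs)

lemma sum_list_block: "sum_list (block v q c) = sum v {..<q} + c"
  by (simp add: block_def interv_sum_list_conv_sum_set_nat atLeast0LessThan)

definition cnt :: "(nat \<Rightarrow> nat) \<Rightarrow> nat \<Rightarrow> nat \<Rightarrow> nat \<Rightarrow> nat" where
  "cnt v k m b = card (block_words v k m b)"

text \<open>Split off the first block, whose shape is forced by the match at position 0. The
  truncated term \<open>1 - (m + b)\<close> accounts for the empty word: it is 1 only for m = b =
  0.\<close>

lemma cnt_rec:
  assumes pre: "prenecklace n v" and v: "\<And>j. j < n \<Longrightarrow> v j \<in> {1..k}" and "m \<le> n"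
  shows "cnt v k m b = (1 - (m + b)) +
    (\<Sum>l<m. \<Sum>c\<in>{v l<..k}. cnt v k (m - Suc l) (b - (sum v {..<l} + c)))"
proof (cases "m = 0")
  case True
  then show ?thesis by (simp add: cnt_def block_words_0)
next
  case False
  let ?A = "SIGMA l:{..<m}. SIGMA c:{v l<..k}. block_words v k (m - Suc l) (b - (sum v {..<l} + c))"
  have "bij_betw (\<lambda>(l, c, z). block v l c @ z) ?A (block_words v k m b)"
    unfolding bij_betw_def
  proof
    show "inj_on (\<lambda>(l, c, z). block v l c @ z) ?A"
      unfolding inj_on_def by (auto dest: block_append_inj)
    show "(\<lambda>(l, c, z). block v l c @ z) ` ?A = block_words v k m b"
    proof (intro equalityI subsetI)
      fix y assume "y \<in> (\<lambda>(l, c, z). block v l c @ z) ` ?A"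
      then obtain l c z where *: "l < m" "v l < c" "c \<le> k"
        "z \<in> block_words v k (m - Suc l) (b - (sum v {..<l} + c))" "y = block v l c @ z"
        by auto
      have "set (block v l c) \<subseteq> {1..k}"
        using v \<open>m \<le> n\<close> * by (force simp: block_def)
      with * dominating_Cons_block[OF pre, of l c z] \<open>m \<le> n\<close> show "y \<in> block_words v k m b"
        by (auto simp: block_words_def strings_defs sum_list_block)
    next
      fix y assume y: "y \<in> block_words v k m b"
      then have dom: "dominating v y" and len: "length y = m" and set: "set y \<subseteq> {1..k}"
        and b: "b \<le> sum_list y"
        by (auto simp: block_words_def strings_defs)
      from dom len False obtain q where q: "q < m" "beats v ((!) y) 0 q"
        unfolding dominating_def by fastforce
      define c z where "c = y ! q" and "z = drop (Suc q) y"
      have dec: "y = block v q c @ z"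
        using block_decomp[of 0 q y v] q len by (simp add: c_def z_def)
      have "v q < c" using q by (simp add: beats_def c_def)
      moreover have "c \<le> k" using set q len by (auto simp: c_def subset_iff)
      moreover have "z \<in> block_words v k (m - Suc q) (b - (sum v {..<q} + c))"
        using dom dec b set len dominating_appendD[of v "block v q c" z]
        by (auto simp: block_words_def strings_defs sum_list_block)
      ultimately show "y \<in> (\<lambda>(l, c, z). block v l c @ z) ` ?A"
        using q dec by (intro image_eqI[of _ _ "(q, c, z)"]) auto
    qed
  qed
  then have "cnt v k m b = card ?A"
    unfolding cnt_def by (rule bij_betw_same_card[symmetric])
  also have "\<dots> = (\<Sum>l<m. \<Sum>c\<in>{v l<..k}. cnt v k (m - Suc l) (b - (sum v {..<l} + c)))"
    by (simp add: cnt_def)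
  finally show ?thesis using False by simp
qed

subsection \<open>Cyclic words\<close>

definition cyc :: "'a list \<Rightarrow> nat \<Rightarrow> 'a" where
  "cyc y i = y ! (i mod length y)"

lemma cyc_nth: "i < length y \<Longrightarrow> cyc y i = y ! i"
  by (simp add: cyc_def)

lemma cyc_add_length [simp]: "cyc y (i + length y) = cyc y i"
  by (simp add: cyc_def)

lemma cyc_rotate: "y \<noteq> [] \<Longrightarrow> cyc (rotate b y) i = cyc y (b + i)"
  by (simp add: cyc_def nth_rotate mod_add_right_eq)

lemma nth_rotate_cyc: "i < length y \<Longrightarrow> rotate b y ! i = cyc y (b + i)"
  by (simp add: cyc_def nth_rotate)

lemma rotate_back: "rotate (length y - b mod length y) (rotate b y) = y"
proof (cases "y = []")
  case False
  then have "(length y - b mod length y + b) mod length y = 0"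
    by (metis le_add_diff_inverse2 length_greater_0_conv mod_add_right_eq mod_le_divisor mod_self)
  then show ?thesis by (simp add: rotate_rotate)
qed simp

lemma rotate_inj: "rotate b x = rotate b y \<longleftrightarrow> x = y"
  by (metis length_rotate rotate_back)

lemma sum_list_rotate [simp]: "sum_list (rotate b y) = (sum_list y :: nat)"
proof (induction b)
  case (Suc b)
  have "sum_list (rotate1 z) = sum_list z" for z :: "nat list"
    by (cases z) auto
  with Suc show ?case by simp
qed simp

definition cyclically_dominating :: "(nat \<Rightarrow> nat) \<Rightarrow> nat list \<Rightarrow> bool" where
  "cyclically_dominating v y \<longleftrightarrow> (\<forall>i. \<exists>q<length y. beats v (cyc y) i q)"

lemma cyclically_dominating_rotate:
  "y \<noteq> [] \<Longrightarrow> cyclically_dominating v y \<Longrightarrow> cyclically_dominating v (rotate b y)"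
  unfolding cyclically_dominating_def by (auto simp: beats_def cyc_rotate add.assoc[symmetric])

lemma dominating_imp_cyclically:
  assumes "dominating v y" "y \<noteq> []"
  shows "cyclically_dominating v y"
  unfolding cyclically_dominating_def
proof
  fix i
  have "i mod length y < length y" using assms(2) by simp
  with assms(1) obtain q where q: "i mod length y + q < length y" "beats v ((!) y) (i mod length y) q"
    unfolding dominating_def by blast
  have "cyc y (i + j) = y ! (i mod length y + j)" if "j \<le> q" for j
    using that q by (simp add: cyc_def mod_add_left_eq[symmetric, of i j])
  then have "beats v (cyc y) i q"
    using q(2) beats_cong[of q "cyc y" i "(!) y"] by blast
  moreover have "q < length y" using q(1) by linarith
  ultimately show "\<exists>q<length y. beats v (cyc y) i q" by blast
qed

text \<open>A maximal match of \<open>v\<close> ends just before a block boundary.\<close>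

lemma cyclically_dominating_imp_rotate:
  assumes pre: "prenecklace (length y) v" and dom: "cyclically_dominating v y" and ne: "y \<noteq> []"
  shows "\<exists>b. dominating v (rotate b y)"
proof -
  let ?n = "length y"
  define P where "P q \<longleftrightarrow> q < ?n \<and> (\<exists>a. beats v (cyc y) a q)" for q
  have "\<exists>q. P q" using dom unfolding P_def cyclically_dominating_def by blast
  moreover have bd: "\<forall>q. P q \<longrightarrow> q \<le> ?n" by (auto simp: P_def)
  ultimately have "P (Greatest P)" using GreatestI_ex_nat[of P ?n] by blast
  define Q where "Q = Greatest P"
  from \<open>P (Greatest P)\<close> obtain a where a: "beats v (cyc y) a Q" "Q < ?n"
    by (auto simp: P_def Q_def)
  have max: "q \<le> Q" if "beats v (cyc y) a' q" "q < ?n" for a' q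
    using that Greatest_le_nat[of P q ?n] bd unfolding P_def Q_def by blast
  have per: "beats v (cyc y) (a' + ?n) q \<longleftrightarrow> beats v (cyc y) a' q" for a' q
    by (rule beats_cong) (metis add.assoc add.commute cyc_add_length)
  define b where "b = a + Q + 1"
  have "dominating v (rotate b y)"
    unfolding dominating_def
  proof (intro allI impI)
    fix i assume i: "i < length (rotate b y)"
    from dom obtain q where q: "q < ?n" "beats v (cyc y) (b + i) q"
      unfolding cyclically_dominating_def by blast
    have "i + q < ?n"
    proof (rule ccontr)
      assume neg: "\<not> i + q < ?n"
      \<comment> \<open>A win running past the cut is impossible: starting no later than the copy of
        the maximal match at \<open>a + ?n\<close>, it would be longer than \<open>Q\<close>;
        starting \<open>d\<close> letters inside that copy, it would end no later than the copy
        does.\<close>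
      show False
      proof (cases "b + i \<le> a + ?n")
        case True
        then have "Q < q" using neg by (simp add: b_def)
        then show False using max[OF q(2,1)] by simp
      next
        case False
        define d where "d = b + i - (a + ?n)"
        have d: "d \<le> Q" "b + i = a + ?n + d" using False i by (auto simp: d_def b_def)
        then obtain q' where "q' \<le> Q - d" "beats v (cyc y) (b + i) q'"
          using beats_inner[OF pre a(2), of "cyc y" "a + ?n" d] per a(1) by metis
        then have "q \<le> Q - d" using q beats_unique by blast
        then show False using d neg by (simp add: b_def)
      qed
    qed
    moreover have "beats v ((!) (rotate b y)) i q"
      using q \<open>i + q < ?n\<close>
      by (subst beats_cong[where y = "cyc y" and i' = "b + i"]) (auto simp: nth_rotate_cyc add.assoc)
    ultimately show "\<exists>q. i + q < length (rotate b y) \<and> beats v ((!) (rotate b y)) i q"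
      by auto
  qed
  then show ?thesis by blast
qed

text \<open>The position \<open>length x - d\<close> would have to win inside the word, but up to
  its end the word only agrees with \<open>v\<close>.\<close>

lemma dominating_no_border:
  assumes "dominating v x" "0 < d" "d \<le> length x" "\<And>j. j < d \<Longrightarrow> x ! (length x - d + j) = v j"
  shows False
proof -
  have "length x - d < length x" using assms by simp
  then obtain q where q: "length x - d + q < length x" "beats v ((!) x) (length x - d) q"
    using assms(1) unfolding dominating_def by blast
  then have "q < d" using assms(3) by simp
  with q(2) assms(4) show False unfolding beats_def by force
qed

text \<open>If the offsets differed, the word of the smaller offset would be the other one rotated
  by \<open>d\<close> <= \<open>l'\<close>. It would then end with \<open>v 0 .. v (d - 1)\<close>,
  the beginning of the other word's first block, which no dominating word does.\<close>

lemma rotate_block_inj_aux: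
  assumes "rotate i (block v l c @ z) = rotate i' (block v l' c' @ z')" "i \<le> i'" "i' \<le> l'"
    and dom: "dominating v (block v l c @ z)"
    and len: "length (block v l c @ z) = length (block v l' c' @ z')"
  shows "i = i'"
proof (rule ccontr)
  assume "i \<noteq> i'"
  define d where "d = i' - i"
  let ?x = "block v l c @ z" and ?x' = "block v l' c' @ z'"
  have d: "0 < d" "d \<le> l'" "i' = i + d" using assms(2,3) \<open>i \<noteq> i'\<close> by (auto simp: d_def)
  have "rotate i ?x = rotate i (rotate d ?x')"
    using assms(1) d(3) by (simp add: rotate_rotate)
  then have x: "?x = rotate d ?x'"
    by (simp add: rotate_inj)
  then have x: "?x = drop d ?x' @ take d ?x'"
    using d(2) by (simp add: rotate_drop_take)
  have "length ?x = length (drop d ?x') + d"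
    using x d(2) by (metis length_append length_take min.absorb2 length_block trans_le_add1 le_SucI)
  then have "?x ! (length ?x - d + j) = v j" if "j < d" for j
  proof -
    have "length (drop d ?x') = length ?x - d" using len by simp
    then have "?x ! (length ?x - d + j) = take d ?x' ! j"
      by (metis nth_append_length_plus x)
    also have "\<dots> = v j"
      using that d(2) by (simp add: nth_append block_def)
    finally show ?thesis .
  qed
  then show False
    using dominating_no_border[OF dom, of d] d len by auto
qed

text \<open>A cyclic word is opened at the block covering its first letter. That letter may be any
  of the \<open>Suc l\<close> letters of the block, which explains the factor;
  \<open>rotate_block_inj_aux\<close> shows that the offset is determined by the word.\<close>

lemma card_cyclically_dominating:
  assumes pre: "prenecklace n v" and v: "\<And>j. j < n \<Longrightarrow> v j \<in> {1..k}" and n: "0 < n"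
  shows "card {y \<in> strings_ge k n b. cyclically_dominating v y} =
    (\<Sum>l<n. Suc l * (\<Sum>c\<in>{v l<..k}. cnt v k (n - Suc l) (b - (sum v {..<l} + c))))"
proof -
  let ?A = "SIGMA l:{..<n}. {..l} \<times>
    (SIGMA c:{v l<..k}. block_words v k (n - Suc l) (b - (sum v {..<l} + c)))"
  let ?f = "\<lambda>(l, i, c, z). rotate i (block v l c @ z)"
  let ?E = "{y \<in> strings_ge k n b. cyclically_dominating v y}"
  have A: "length (block v l c @ z) = n \<and> dominating v (block v l c @ z) \<and>
      block v l c @ z \<in> strings_ge k n b \<and> i \<le> l \<and> l < n \<and> v l < c"
    if "(l, i, c, z) \<in> ?A" for l i c z
  proof -
    have *: "l < n" "v l < c" "c \<le> k" "i \<le> l"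
      "z \<in> block_words v k (n - Suc l) (b - (sum v {..<l} + c))"
      using that by auto
    have "set (block v l c) \<subseteq> {1..k}"
      using v * by (force simp: block_def)
    with * dominating_Cons_block[OF pre, of l c z] show ?thesis
      by (auto simp: block_words_def strings_defs sum_list_block)
  qed
  have "bij_betw ?f ?A ?E"
    unfolding bij_betw_def
  proof
    show "inj_on ?f ?A"
    proof (rule inj_onI)
      fix p p' assume p: "p \<in> ?A" "p' \<in> ?A" "?f p = ?f p'"
      obtain l i c z l' i' c' z' where p_eq: "p = (l, i, c, z)" "p' = (l', i', c', z')"
        by (metis prod_cases4)
      with p have a: "(l, i, c, z) \<in> ?A" and a': "(l', i', c', z') \<in> ?A"
        and eq: "rotate i (block v l c @ z) = rotate i' (block v l' c' @ z')"
        by auto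
      note A = A[OF a] and A' = A[OF a']
      have "i = i'"
      proof (cases "i \<le> i'")
        case True
        then show ?thesis using rotate_block_inj_aux[OF eq] A A' by auto
      next
        case False
        then show ?thesis using rotate_block_inj_aux[OF eq[symmetric]] A A' by auto
      qed
      with eq have "block v l c @ z = block v l' c' @ z'"
        by (simp add: rotate_inj)
      then show "p = p'"
        unfolding p_eq using block_append_inj A A' \<open>i = i'\<close> by blast
    qed
    show "?f ` ?A = ?E"
    proof (intro equalityI subsetI)
      fix y assume "y \<in> ?f ` ?A"
      then obtain l i c z where *: "(l, i, c, z) \<in> ?A" "y = rotate i (block v l c @ z)" by auto
      note A = A[OF *(1)]
      have "sum_list y = sum_list (block v l c @ z)"
        unfolding *(2) by (rule sum_list_rotate)
      with A have "y \<in> strings_ge k n b"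
        unfolding *(2) by (auto simp: strings_defs)
      moreover have "cyclically_dominating v y"
        using A dominating_imp_cyclically cyclically_dominating_rotate *(2) n by (metis length_0_conv less_numeral_extra(3))
      ultimately show "y \<in> ?E" by blast
    next
      fix y assume y: "y \<in> ?E"
      then have len: "length y = n" and set: "set y \<subseteq> {1..k}" and b: "b \<le> sum_list y"
        by (auto simp: strings_defs)
      obtain e where e: "dominating v (rotate e y)"
        using cyclically_dominating_imp_rotate[of y v] y len pre n by auto
      define x where "x = rotate e y"
      define i where "i = (n - e mod n) mod n"
      have yx: "y = rotate i x"
        using rotate_back[of y e] rotate_conv_mod[of "n - e mod n" x] len by (simp add: x_def i_def)
      have i: "i < n" using n by (simp add: i_def)
      have lenx: "length x = n" using len by (simp add: x_def)
      \<comment> \<open>The block covering position \<open>i\<close> of the dominating word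
        \<open>x\<close>, found by walking from block to block. The blocks before it are remembered
        as \<open>dominating v (take a x)\<close>, since they move to the end once \<open>x\<close>
        is rotated to start with this block.\<close>
      have "\<exists>a q. a \<le> i \<and> i \<le> a + q \<and> a + q < n \<and> beats v ((!) x) a q \<and> dominating v (take a x)"
        using i
      proof (induction i)
        case 0
        obtain q where "0 + q < n" "beats v ((!) x) 0 q"
          using e n lenx unfolding x_def[symmetric] dominating_def by blast
        then show ?case by (intro exI[of _ 0] exI[of _ q]) auto
      next
        case (Suc i)
        then obtain a q where aq: "a \<le> i" "i \<le> a + q" "a + q < n" "beats v ((!) x) a q"
          "dominating v (take a x)" by auto
        show ?case
        proof (cases "Suc i \<le> a + q")
          case True
          with aq show ?thesis by (intro exI[of _ a] exI[of _ q]) auto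
        next
          case False
          with aq have a: "Suc i = a + q + 1" by simp
          obtain q' where q': "Suc i + q' < n" "beats v ((!) x) (Suc i) q'"
            using e Suc.prems lenx unfolding x_def[symmetric] dominating_def by blast
          have "take (Suc i) x = take a x @ take (Suc q) (drop a x)"
            using a by (metis Suc_eq_plus1 add_Suc_right take_add)
          also have "drop a x = block v q (x ! (a + q)) @ drop (Suc (a + q)) x"
            using block_decomp aq lenx by blast
          finally have "take (Suc i) x = take a x @ block v q (x ! (a + q))" by simp
          moreover have "dominating v (block v q (x ! (a + q)))"
            using dominating_block[OF pre, of q] aq by (auto simp: beats_def)
          ultimately have "dominating v (take (Suc i) x)"
            using aq dominating_append by simp
          with q' show ?thesis by (intro exI[of _ "Suc i"] exI[of _ q']) auto
        qed
      qed
      then obtain a q where aq: "a \<le> i" "i \<le> a + q" "a + q < n" "beats v ((!) x) a q"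
        "dominating v (take a x)" by blast
      define c z where "c = x ! (a + q)" and "z = drop (Suc (a + q)) x @ take a x"
      have dec: "drop a x = block v q c @ drop (Suc (a + q)) x"
        unfolding c_def using block_decomp aq lenx by blast
      have "rotate a x = block v q c @ z"
        using aq i lenx dec by (simp add: rotate_drop_take z_def)
      then have "rotate (i - a) (block v q c @ z) = rotate (i - a) (rotate a x)" by simp
      also have "\<dots> = y" using aq yx by (simp add: rotate_rotate)
      finally have y': "rotate (i - a) (block v q c @ z) = y" .
      have domz: "dominating v z"
      proof -
        have "dominating v (drop a x)"
          using e dominating_appendD[of v "take a x" "drop a x"] by (simp add: x_def)
        with dec have "dominating v (drop (Suc (a + q)) x)"
          using dominating_appendD by metis
        then show ?thesis unfolding z_def using aq dominating_append by blast
      qed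
      have "v q < c" using aq by (simp add: beats_def c_def)
      moreover have "set x \<subseteq> {1..k}" using set by (simp add: x_def)
      then have "c \<le> k" "set z \<subseteq> {1..k}"
        using aq lenx by (auto simp: c_def z_def dest!: in_set_takeD in_set_dropD) 
          (metis atLeastAtMost_iff nth_mem subsetD)
      moreover have "sum_list y = sum_list (block v q c @ z)"
        using y' by (metis sum_list_rotate)
      moreover have "length z = n - Suc q"
        using aq lenx i by (simp add: z_def)
      ultimately have "(q, i - a, c, z) \<in> ?A"
        using aq domz b by (auto simp: block_words_def strings_defs sum_list_block)
      with y' show "y \<in> ?f ` ?A" by (intro image_eqI[of _ _ "(q, i - a, c, z)"]) auto
    qed
  qed
  then have "card ?E = card ?A"
    by (rule bij_betw_same_card[symmetric])
  also have "\<dots> = (\<Sum>l<n. Suc l * (\<Sum>c\<in>{v l<..k}. cnt v k (n - Suc l) (b - (sum v {..<l} + c))))"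
    by (simp add: cnt_def card_cartesian_product)
  finally show ?thesis .
qed

subsection \<open>Periods of prenecklaces\<close>

text \<open>The length \<open>m\<close> itself always qualifies as a period, and \<open>p\<close>
  need not divide \<open>m\<close>.\<close>

definition min_period :: "(nat \<Rightarrow> nat) \<Rightarrow> nat \<Rightarrow> nat \<Rightarrow> bool" where
  "min_period v m p \<longleftrightarrow> 1 \<le> p \<and> p \<le> m \<and> (\<forall>i. p \<le> i \<and> i < m \<longrightarrow> v i = v (i - p)) \<and>
     (\<forall>a. 1 \<le> a \<and> a < p \<longrightarrow> (\<exists>i. a \<le> i \<and> i < m \<and> v i \<noteq> v (i - a)))"

text \<open>Lexicographic comparison in first-difference form: the window of \<open>x\<close> of
  length \<open>m\<close> at \<open>i\<close> is at least \<open>v 0 .. v (m - 1)\<close>.\<close>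

definition not_below :: "(nat \<Rightarrow> nat) \<Rightarrow> nat \<Rightarrow> (nat \<Rightarrow> nat) \<Rightarrow> nat \<Rightarrow> bool" where
  "not_below v m x i \<longleftrightarrow> (\<forall>q<m. (\<forall>j<q. x (i + j) = v j) \<longrightarrow> v q \<le> x (i + q))"

lemma not_belowD:
  "not_below v m x i \<Longrightarrow> q < m \<Longrightarrow> (\<And>j. j < q \<Longrightarrow> x (i + j) = v j) \<Longrightarrow> v q \<le> x (i + q)"
  by (simp add: not_below_def)

lemma not_below_mono: "not_below v n x i \<Longrightarrow> m \<le> n \<Longrightarrow> not_below v m x i"
  by (simp add: not_below_def)

lemma prenecklaceD:
  "prenecklace n v \<Longrightarrow> a + l < n \<Longrightarrow> (\<And>j. j < l \<Longrightarrow> v (a + j) = v j) \<Longrightarrow> v l \<le> v (a + l)"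
  by (simp add: prenecklace_def)

lemma min_period_1: "min_period v 1 1"
  by (simp add: min_period_def)

lemma prenecklace_1: "prenecklace 1 v"
  by (auto simp: prenecklace_def)

lemma min_periodD:
  assumes "min_period v m p"
  shows "1 \<le> p" "p \<le> m" "\<And>i. p \<le> i \<Longrightarrow> i < m \<Longrightarrow> v i = v (i - p)"
    and "\<And>a. 1 \<le> a \<Longrightarrow> (\<And>i. a \<le> i \<Longrightarrow> i < m \<Longrightarrow> v i = v (i - a)) \<Longrightarrow> p \<le> a"
  subgoal using assms unfolding min_period_def by blast
  subgoal using assms unfolding min_period_def by blast
  subgoal using assms unfolding min_period_def by blast
  subgoal for a using assms unfolding min_period_def by (rule_tac ccontr) (auto simp: not_le)
  done

text \<open>The border of length \<open>m - a\<close> is a suffix of the border of length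
  \<open>m - p\<close>, and the latter is a prefix of \<open>v\<close>; the prenecklace condition at
  that suffix compares the two continuations. So among the letters with which the periods of
  \<open>v\<close> would continue, the least period proposes the largest.\<close>

lemma period_next_le:
  assumes "prenecklace m v" "min_period v m p"
    and a: "1 \<le> a" "a \<le> m" "\<And>i. a \<le> i \<Longrightarrow> i < m \<Longrightarrow> v i = v (i - a)"
  shows "v (m - a) \<le> v (m - p)"
proof -
  note p = min_periodD[OF assms(2)]
  have "p \<le> a" using p(4) a by blast
  have "v (a - p + i) = v i" if "i < m - a" for i
  proof -
    have "v (a - p + i) = v (a + i)"
      using p(3)[of "a + i"] that \<open>p \<le> a\<close> by simp
    also have "\<dots> = v i" using a(3)[of "a + i"] that by simp
    finally show ?thesis .
  qed
  moreover have "a - p + (m - a) = m - p" "m - p < m"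
    using \<open>p \<le> a\<close> a p(1,2) by auto
  moreover from assms(1) have
    "a - p + (m - a) < m \<longrightarrow> (\<forall>j<m - a. v (a - p + j) = v j) \<longrightarrow> v (m - a) \<le> v (a - p + (m - a))"
    unfolding prenecklace_def by blast
  ultimately show ?thesis by simp
qed

lemma extend_periodic:
  assumes "prenecklace m v" "min_period v m p" "v m = v (m - p)"
  shows "prenecklace (Suc m) v" "min_period v (Suc m) p"
proof -
  note p = min_periodD[OF assms(2)]
  show "prenecklace (Suc m) v"
    unfolding prenecklace_def
  proof (intro allI impI)
    fix a l assume al: "a + l < Suc m" "\<forall>j<l. v (a + j) = v j"
    show "v l \<le> v (a + l)"
    proof (cases "a + l < m")
      case True
      then show ?thesis using assms(1) al unfolding prenecklace_def by blast
    next
      case False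
      then have m: "m = a + l" using al by simp
      show ?thesis
      proof (cases "a = 0")
        case False
        have "v (m - a) \<le> v (m - p)"
        proof (rule period_next_le[OF assms(1,2)])
          fix i assume "a \<le> i" "i < m"
          with al(2) m show "v i = v (i - a)" by (metis le_add_diff_inverse nat_add_left_cancel_less)
        qed (use False m in auto)
        then show ?thesis using m assms(3) by simp
      qed simp
    qed
  qed
  show "min_period v (Suc m) p"
    using assms(2,3) unfolding min_period_def by (auto simp: less_Suc_eq)
qed

text \<open>By the prenecklace property the new letter is larger than \<open>v (m - p)\<close>, the
  largest letter with which any period could continue.\<close>

lemma extend_aperiodic:
  assumes "prenecklace (Suc m) v" "min_period v m p" "v m \<noteq> v (m - p)"
  shows "min_period v (Suc m) (Suc m)"
proof -
  note p = min_periodD[OF assms(2)]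
  have pre: "prenecklace m v"
    using assms(1) unfolding prenecklace_def by simp
  have "\<exists>i. a \<le> i \<and> i < Suc m \<and> v i \<noteq> v (i - a)" if a: "1 \<le> a" "a < Suc m" for a
  proof (rule ccontr)
    assume "\<not> ?thesis"
    then have *: "v i = v (i - a)" if "a \<le> i" "i < Suc m" for i using that by blast
    have "v (m - a) \<le> v (m - p)"
      using period_next_le[OF pre assms(2), of a] * a by simp
    moreover have "v m = v (m - a)" using *[of m] a by simp
    moreover have "p + (m - p) < Suc m \<longrightarrow> (\<forall>j<m - p. v (p + j) = v j) \<longrightarrow> v (m - p) \<le> v (p + (m - p))"
      using assms(1) unfolding prenecklace_def by blast
    then have "v (m - p) \<le> v m" using p(2) p(3)[of "p + _"] by simp
    ultimately show False using assms(3) p(2) by simp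
  qed
  then show ?thesis unfolding min_period_def by auto
qed

text \<open>A match of \<open>m\<close> letters at \<open>i\<close> contains a match of
  \<open>m - p\<close> letters at \<open>i + p\<close>, where the hypothesis already bounds the
  letter in question. This is why prescribing \<open>v (m - p)\<close> as the next letter excludes
  no further word.\<close>

lemma not_below_extend:
  assumes "min_period v m p" "v m = v (m - p)" and nb: "\<And>i. not_below v m x i"
  shows "not_below v (Suc m) x i"
  unfolding not_below_def
proof (intro allI impI)
  fix q assume q: "q < Suc m" "\<forall>j<q. x (i + j) = v j"
  note p = min_periodD[OF assms(1)]
  show "v q \<le> x (i + q)"
  proof (cases "q < m")
    case True
    then show ?thesis using nb q unfolding not_below_def by blast
  next
    case False
    then have qm: "q = m" using q by simp
    have "x (i + p + j) = v j" if "j < m - p" for j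
      using q(2) p(3)[of "p + j"] that qm by (simp add: add.assoc)
    then have "v (m - p) \<le> x (i + p + (m - p))"
      using not_belowD[OF nb[of "i + p"], of "m - p"] p(1,2) by simp
    then show ?thesis using qm assms(2) p(2) by simp
  qed
qed

lemma not_below_iff:
  "not_below v m x i \<longleftrightarrow> (\<exists>q<m. beats v x i q) \<or> (\<forall>j<m. x (i + j) = v j)"
proof
  assume nb: "not_below v m x i"
  show "(\<exists>q<m. beats v x i q) \<or> (\<forall>j<m. x (i + j) = v j)"
  proof (rule disjCI)
    assume "\<not> (\<forall>j<m. x (i + j) = v j)"
    then have ex: "\<exists>q. q < m \<and> x (i + q) \<noteq> v q" by blast
    define q where "q = (LEAST q. q < m \<and> x (i + q) \<noteq> v q)"
    have "q < m" "x (i + q) \<noteq> v q" using LeastI_ex[OF ex] by (auto simp: q_def)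
    moreover have "x (i + j) = v j" if "j < q" for j
      using not_less_Least[of j "\<lambda>q. q < m \<and> x (i + q) \<noteq> v q"] that \<open>q < m\<close> by (auto simp: q_def)
    ultimately show "\<exists>q<m. beats v x i q"
      using nb unfolding not_below_def beats_def
      by (intro exI[of _ q]) (auto simp: order.not_eq_order_implies_strict)
  qed
next
  assume "(\<exists>q<m. beats v x i q) \<or> (\<forall>j<m. x (i + j) = v j)"
  then show "not_below v m x i"
  proof
    assume "\<exists>q<m. beats v x i q"
    then obtain q where q: "beats v x i q" by blast
    have "v q' \<le> x (i + q')" if "\<forall>j<q'. x (i + j) = v j" for q'
      using q that unfolding beats_def by (cases q q' rule: linorder_cases) auto
    then show ?thesis unfolding not_below_def by blast
  qed (simp add: not_below_def)
qed

lemma rotate_fixed_mult: "rotate p x = x \<Longrightarrow> rotate (p * d) x = x"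
  by (induction d) (auto simp: rotate_rotate[symmetric])

lemma rotate_fixed_mod: "rotate p x = x \<Longrightarrow> rotate i x = rotate (i mod p) x"
  by (metis rotate_fixed_mult mod_mult_div_eq rotate_rotate)

lemma rotate_eq_rotateD: "rotate i x = rotate j x \<Longrightarrow> i \<le> j \<Longrightarrow> rotate (j - i) x = x"
  by (metis le_add_diff_inverse rotate_inj rotate_rotate)

lemma cyc_map: "0 < n \<Longrightarrow> cyc (map v [0..<n]) i = v (i mod n)"
  by (simp add: cyc_def)

lemma rotate_fixed_period:
  assumes "rotate g (map v [0..<n]) = map v [0..<n]" "g \<le> i" "i < n"
  shows "v i = v (i - g)"
proof -
  have "v (i - g) = rotate g (map v [0..<n]) ! (i - g)"
    using assms by simp
  also have "\<dots> = v i"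
    using assms(2,3) by (simp add: nth_rotate_cyc cyc_map)
  finally show ?thesis by simp
qed

lemma min_period_rotate_fixed:
  assumes "min_period v n p" "rotate g (map v [0..<n]) = map v [0..<n]" "0 < g"
  shows "p \<le> g"
proof (rule ccontr)
  assume "\<not> p \<le> g"
  then show False
    using min_periodD(4)[OF assms(1), of g] rotate_fixed_period[OF assms(2)] assms(3) by auto
qed

text \<open>If a necklace has a border \<open>b\<close>, then the parts \<open>z\<close>, \<open>z'\<close> in \<open>b z = z' b\<close> satisfy
  \<open>z \<le> z'\<close> and \<open>z' \<le> z\<close>, because \<open>z b\<close> and \<open>b z'\<close> are rotations.\<close>

lemma necklace_min_period_dvd:
  assumes per: "min_period v n p"
    and nb: "\<And>i. not_below v n (cyc (map v [0..<n])) i"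
  shows "p dvd n" "rotate p (map v [0..<n]) = map v [0..<n]"
proof -
  note p = min_periodD[OF per]
  have n: "0 < n" using p by simp
  define b where "b = n - p"
  have bp: "b + p = n" using p(2) by (simp add: b_def)
  have cycv: "cyc (map v [0..<n]) i = v (i mod n)" for i using cyc_map[OF n] .
  have eq: "v j = v (b + j)" if "j < p" for j
    using that
  proof (induction j rule: less_induct)
    case (less j)
    have "v j \<le> v (b + j)"
    proof -
      have "cyc (map v [0..<n]) (b + i) = v i" if "i < j" for i
        using less that bp by (simp add: cycv)
      moreover have "cyc (map v [0..<n]) (b + j) = v (b + j)"
        using less bp by (simp add: cycv)
      moreover have "j < n" using less.prems bp by simp
      ultimately show ?thesis
        using not_belowD[OF nb[of b], of j] by simp
    qed
    moreover have "v (b + j) \<le> v j"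
    proof -
      have "cyc (map v [0..<n]) (p + i) = v i" if "i < b + j" for i
      proof (cases "i < b")
        case True
        then show ?thesis using bp p(3)[of "p + i"] by (simp add: cycv)
      next
        case False
        have "(p + i) mod n = i - b"
        proof -
          have "p + i = n + (i - b)" using False bp by simp
          moreover have "i - b < n" using that less.prems bp by simp
          ultimately show ?thesis by simp
        qed
        moreover have "v (i - b) = v (b + (i - b))"
          using less False that by simp
        ultimately show ?thesis using False by (simp add: cycv)
      qed
      moreover have "cyc (map v [0..<n]) (p + (b + j)) = v j"
      proof -
        have "p + (b + j) = n + j" "j < n" using bp less.prems by auto
        then show ?thesis by (simp only: cycv mod_add_self1 mod_less)
      qed
      moreover have "b + j < n" using bp less.prems by simp
      ultimately show ?thesis
        using not_belowD[OF nb[of p], of "b + j"] by simp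
    qed
    ultimately show ?case by simp
  qed
  show rot: "rotate p (map v [0..<n]) = map v [0..<n]"
  proof (rule nth_equalityI)
    fix j assume j: "j < length (rotate p (map v [0..<n]))"
    then have "rotate p (map v [0..<n]) ! j = v ((p + j) mod n)"
      by (simp add: nth_rotate_cyc cycv)
    also have "\<dots> = v j"
    proof (cases "j < b")
      case True
      then show ?thesis using bp p(3)[of "p + j"] by simp
    next
      case False
      have "p + j = n + (j - b)" "j - b < n" using False bp j by auto
      then have "(p + j) mod n = j - b" by simp
      then show ?thesis using eq[of "j - b"] False j bp by auto
    qed
    finally show "rotate p (map v [0..<n]) ! j = map v [0..<n] ! j" using j by simp
  qed simp
  show "p dvd n"
  proof (rule ccontr)
    assume "\<not> p dvd n"
    \<comment> \<open>The rotations fixing a word are closed under remainders, so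
      \<open>n mod p\<close> would be a period below the least one.\<close>
    then have g: "0 < n mod p" by (simp add: dvd_eq_mod_eq_0)
    have fixed: "rotate (n mod p) (map v [0..<n]) = map v [0..<n]"
      using rotate_fixed_mod[OF rot, of n] rotate_id[of n "map v [0..<n]"] by simp
    have "n mod p < p" using p(1) by simp
    with min_period_rotate_fixed[OF per fixed g] show False
      by simp
  qed
qed

text \<open>Continued with period \<open>p\<close> indefinitely, \<open>v\<close> remains a
  prenecklace. As \<open>p\<close> divides \<open>n\<close>, the continuation is also the cyclic
  word of \<open>v\<close>, so that each rotation is one of its windows.\<close>

lemma prenecklace_dvd_necklace:
  assumes pre: "prenecklace n v" and per: "min_period v n p" and dvd: "p dvd n"
  shows "not_below v n (cyc (map v [0..<n])) i"
proof -
  note p = min_periodD[OF per]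
  have n: "0 < n" using p by simp
  define x where "x j = v (j mod p)" for j
  have vx: "v j = x j" if "j < n" for j
    using that
  proof (induction j rule: less_induct)
    case (less j)
    show ?case
    proof (cases "j < p")
      case False
      then have "v j = v (j - p)" using p(3) less by simp
      also have "\<dots> = x (j - p)" using less False p(1) by simp
      also have "\<dots> = x j" using False by (simp add: x_def le_mod_geq)
      finally show ?thesis .
    qed (simp add: x_def)
  qed
  have "prenecklace (n + d) x \<and> min_period x (n + d) p" for d
  proof (induction d)
    case 0
    have "x l \<le> x (a + l)" if "a + l < n" "\<forall>j<l. x (a + j) = x j" for a l
      using pre that vx[symmetric] unfolding prenecklace_def by simp
    then have "prenecklace n x"
      unfolding prenecklace_def by blast
    moreover have "min_period x n p"
    proof -
      have "v i = v (i - a) \<longleftrightarrow> x i = x (i - a)" if "i < n" for i a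
        using vx[of i] vx[of "i - a"] that by simp
      then show ?thesis using per unfolding min_period_def by meson
    qed
    ultimately show ?case by simp
  next
    case (Suc d)
    have "x (n + d) = x (n + d - p)"
      using p(2) by (simp add: x_def le_mod_geq)
    with Suc show ?case using extend_periodic[of "n + d" x p] by simp
  qed
  then have "prenecklace (n + i) x" by blast
  then have "not_below x n x i"
    unfolding not_below_def using prenecklaceD[of "n + i" x i] by auto
  moreover have "cyc (map v [0..<n]) j = x j" for j
    using n dvd vx[of "j mod n"] by (simp add: cyc_map x_def mod_mod_cancel)
  ultimately show ?thesis
    using vx unfolding not_below_def by simp
qed

lemma rotate_eq_map_iff:
  assumes "length y = n" "0 < n"
  shows "rotate i y = map v [0..<n] \<longleftrightarrow> (\<forall>j<n. cyc y (i + j) = v j)"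
  using assms by (auto simp: list_eq_iff_nth_eq nth_rotate_cyc)

text \<open>A position that never wins although its window is not below \<open>v\<close> carries a
  full match, so a rotation of the string is \<open>v\<close> itself and \<open>v\<close> is a
  necklace. The strings of this kind are the \<open>p\<close> rotations of \<open>v\<close>, all of
  the same weight; the others are cyclically dominating.\<close>

lemma card_not_below:
  assumes pre: "prenecklace n v" and per: "min_period v n p"
    and v: "\<And>j. j < n \<Longrightarrow> v j \<in> {1..k}"
  shows "card {y \<in> strings_ge k n b. \<forall>i. not_below v n (cyc y) i} =
    (\<Sum>l<n. Suc l * (\<Sum>c\<in>{v l<..k}. cnt v k (n - Suc l) (b - (sum v {..<l} + c)))) +
    (if p dvd n \<and> b \<le> sum v {..<n} then p else 0)"
proof -
  note p = min_periodD[OF per]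
  have n: "0 < n" using p by simp
  let ?v = "map v [0..<n]"
  let ?N = "{y \<in> strings_ge k n b. \<forall>i. not_below v n (cyc y) i}"
  let ?D = "{y \<in> strings_ge k n b. cyclically_dominating v y}"
  define R where "R = (if p dvd n \<and> b \<le> sum v {..<n} then (\<lambda>i. rotate i ?v) ` {..<p} else {})"
  have nb_rot: "\<forall>i. not_below v n (cyc (rotate a y)) i"
    if "\<forall>i. not_below v n (cyc y) i" "y \<noteq> []" for a y
    using that by (auto simp: not_below_def cyc_rotate add.assoc[symmetric])
  have "?N = ?D \<union> R"
  proof (intro equalityI subsetI)
    fix y assume y: "y \<in> ?N"
    then have len: "length y = n" by (auto simp: strings_ge_def strings_def)
    show "y \<in> ?D \<union> R"
    proof (cases "cyclically_dominating v y")
      case True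
      with y show ?thesis by simp
    next
      case False
      then obtain i where i: "\<not> (\<exists>q<n. beats v (cyc y) i q)"
        unfolding cyclically_dominating_def len by blast
      have "not_below v n (cyc y) i" using y by blast
      with i have "\<forall>j<n. cyc y (i + j) = v j"
        using not_below_iff[of v n "cyc y" i] by blast
      then have rot: "rotate i y = ?v"
        using rotate_eq_map_iff[OF len n] by blast
      then have "\<forall>i. not_below v n (cyc ?v) i"
        using nb_rot[of y i] y len n by auto
      then have *: "p dvd n" "rotate p ?v = ?v"
        using necklace_min_period_dvd[OF per] by auto
      have "sum_list y = sum_list ?v" using rot by (metis sum_list_rotate)
      then have b: "b \<le> sum v {..<n}"
        using y by (simp add: strings_ge_def weight_def interv_sum_list_conv_sum_set_nat atLeast0LessThan)
      have "y = rotate (n - i mod n) ?v"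
        using rotate_back[of y i] rot len by simp
      also have "\<dots> = rotate ((n - i mod n) mod p) ?v"
        using rotate_fixed_mod[OF *(2)] .
      finally show ?thesis using * b p(1) by (auto simp: R_def)
    qed
  next
    fix y assume y: "y \<in> ?D \<union> R"
    show "y \<in> ?N"
    proof (cases "y \<in> ?D")
      case True
      then have "\<exists>q<n. beats v (cyc y) i q" for i
        unfolding cyclically_dominating_def by (auto simp: strings_ge_def strings_def)
      with True show ?thesis
        using not_below_iff[of v n "cyc y"] by blast
    next
      case False
      with y obtain a where a: "p dvd n" "b \<le> sum v {..<n}" "y = rotate a ?v"
        by (auto simp: R_def split: if_splits)
      have "sum_list y = sum_list ?v" using a by (metis sum_list_rotate)
      then have "y \<in> strings_ge k n b"
        using a v by (auto simp: strings_defs interv_sum_list_conv_sum_set_nat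
            atLeast0LessThan)
      moreover have "\<forall>i. not_below v n (cyc ?v) i"
        using prenecklace_dvd_necklace[OF pre per a(1)] by blast
      then have "\<forall>i. not_below v n (cyc y) i"
        using nb_rot[of ?v a] n a(3) by auto
      ultimately show ?thesis by blast
    qed
  qed
  moreover have "?D \<inter> R = {}"
  proof -
    have False if "y \<in> ?D" "y = rotate a ?v" for y a
    proof -
      from that(1) have dom: "cyclically_dominating v y" by simp
      have len: "length y = n" using that by simp
      have "rotate (n - a mod n) y = ?v"
        using rotate_back[of ?v a] that(2) by simp
      then have eq: "\<forall>j<n. cyc y (n - a mod n + j) = v j"
        using rotate_eq_map_iff[OF len n] by blast
      obtain q where "q < n" "beats v (cyc y) (n - a mod n) q"
        using dom unfolding cyclically_dominating_def len by blast
      with eq show False by (auto simp: beats_def)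
    qed
    then show ?thesis by (auto simp: R_def split: if_splits)
  qed
  moreover have "card R = (if p dvd n \<and> b \<le> sum v {..<n} then p else 0)"
  proof -
    have "inj_on (\<lambda>i. rotate i ?v) {..<p}"
    proof -
      have "i = j" if "i \<le> j" "j < p" "rotate i ?v = rotate j ?v" for i j
        using min_period_rotate_fixed[OF per rotate_eq_rotateD[OF that(3,1)]] that(1,2)
        by (cases "i = j") auto
      then show ?thesis
        unfolding inj_on_def by (metis lessThan_iff nat_le_linear)
    qed
    then show ?thesis by (simp add: R_def card_image)
  qed
  moreover have "finite R" by (simp add: R_def)
  ultimately show ?thesis
    using card_cyclically_dominating[OF pre v n] by (simp add: card_Un_disjoint)
qed

subsection \<open>Lexicographic order\<close>

lemma list_less_iff_nth:
  fixes x y :: "nat list"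
  assumes "length x = length y"
  shows "x < y \<longleftrightarrow> (\<exists>q<length x. (\<forall>j<q. x ! j = y ! j) \<and> x ! q < y ! q)"
  unfolding list_less_def lexord_take_index_conv using assms
  by (auto simp: list_eq_iff_nth_eq)

lemma list_less_takeI:
  fixes x y :: "nat list"
  assumes "length x = length y" "take m x < take m y"
  shows "x < y"
  using assms list_less_iff_nth[of x y] list_less_iff_nth[of "take m x" "take m y"] by fastforce

lemma take_mono_lex:
  fixes x y :: "nat list"
  shows "length x = length y \<Longrightarrow> x \<le> y \<Longrightarrow> take m x \<le> take m y"
  using list_less_takeI[of y x m] by (metis leD leI)

lemma necklace_nth_0_le:
  assumes "necklace y" "i < length y"
  shows "y ! 0 \<le> y ! i"
proof (rule ccontr)
  assume "\<not> y ! 0 \<le> y ! i"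
  moreover have "rotate i y ! 0 = y ! i" using assms(2) by (subst nth_rotate) auto
  ultimately have "rotate i y < y"
    using assms(2) by (subst list_less_iff_nth) (auto intro!: exI[of _ 0])
  with assms(1) show False unfolding necklace_def by (meson leD)
qed

subsection \<open>Aperiodic prefixes\<close>

text \<open>Defined by rotation, so that it counts the distinct rotations of a nonempty
  \<open>y\<close>; in contrast to \<open>min_period\<close>, it then always divides the
  length.\<close>

definition period :: "'a list \<Rightarrow> nat" where
  "period y = (LEAST p. 1 \<le> p \<and> rotate p y = y)"

lemma period:
  assumes "y \<noteq> []"
  shows "1 \<le> period y" "rotate (period y) y = y" "period y \<le> length y" "period y dvd length y"
    and "\<And>p. 1 \<le> p \<Longrightarrow> rotate p y = y \<Longrightarrow> period y \<le> p"
proof -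
  have ex: "1 \<le> length y \<and> rotate (length y) y = y"
    using assms by (simp add: Suc_le_eq)
  then show *: "1 \<le> period y" "rotate (period y) y = y"
    unfolding period_def by (metis (mono_tags, lifting) LeastI)+
  show least: "\<And>p. 1 \<le> p \<Longrightarrow> rotate p y = y \<Longrightarrow> period y \<le> p"
    unfolding period_def by (simp add: Least_le)
  show "period y \<le> length y" using least ex by blast
  show "period y dvd length y"
  proof (rule ccontr)
    assume "\<not> period y dvd length y"
    then have "1 \<le> length y mod period y" by (simp add: dvd_eq_mod_eq_0 Suc_le_eq)
    moreover have "rotate (length y mod period y) y = y"
      using rotate_fixed_mod[OF *(2), of "length y"] ex by simp
    ultimately have "period y \<le> length y mod period y" by (rule least)
    moreover have "length y mod period y < period y" using *(1) by simp
    ultimately show False by simp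
  qed
qed

lemma nth_mod_period:
  assumes "y \<noteq> []" "i < length y"
  shows "y ! i = y ! (i mod period y)"
proof -
  have "y ! (i mod period y) = rotate (period y * (i div period y)) y ! (i mod period y)"
    using rotate_fixed_mult[OF period(2)[OF assms(1)]] by simp
  also have "\<dots> = y ! ((period y * (i div period y) + i mod period y) mod length y)"
    using assms by (intro nth_rotate) (metis le_less_trans mod_less_eq_dividend)
  also have "\<dots> = y ! i" using assms(2) by simp
  finally show ?thesis by simp
qed

lemma nth_add_period:
  assumes "y \<noteq> []" "i < length y" "j < length y" "i mod period y = j mod period y"
  shows "y ! i = y ! j"
  using nth_mod_period[OF assms(1)] assms by metis

lemma commute_imp_power:
  "r @ t = t @ r \<Longrightarrow> length r = d * length t \<Longrightarrow> r = concat (replicate d t)"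
proof (induction d arbitrary: r)
  case (Suc d)
  then have "length t \<le> length r" by simp
  with Suc.prems(1) have "take (length t) r = t"
    by (metis append_eq_append_conv_if append_eq_conv_conj)
  then obtain r' where r': "r = t @ r'" by (metis append_take_drop_id)
  with Suc show ?case by auto
qed simp

lemma rotate_concat_replicate: "rotate (length t) (concat (replicate j t)) = concat (replicate j t)"
proof (cases j)
  case (Suc i)
  have "concat (replicate i t) @ t = t @ concat (replicate i t)"
    by (induction i) auto
  with Suc show ?thesis by (simp add: rotate_append)
qed simp

text \<open>The prefix of length \<open>period y\<close> commutes with the rest of the word, which
  makes \<open>y\<close> a power of it. Conversely, rotating by the length of any root fixes
  \<open>y\<close>, so no root is shorter.\<close>

lemma ap_eq:
  assumes "y \<noteq> []"
  shows "ap y = take (period y) y"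
proof -
  let ?p = "period y" and ?t = "take (period y) y"
  let ?Q = "\<lambda>t. \<exists>j\<ge>1. y = concat (replicate j t)"
  note p = period[OF assms]
  have "rotate ?p y = drop ?p y @ ?t"
  proof (cases "?p = length y")
    case False
    then show ?thesis using p(3) by (simp add: rotate_drop_take)
  qed simp
  with p(2) have comm: "drop ?p y @ ?t = ?t @ drop ?p y" by simp
  have len: "length ?t = ?p" using p(3) by simp
  obtain d where d: "length y = ?p * d" using p(4) by blast
  then have "length (drop ?p y) = (d - 1) * length ?t"
    using len by (simp add: algebra_simps)
  from commute_imp_power[OF comm this] have "y = ?t @ concat (replicate (d - 1) ?t)"
    by (metis append_take_drop_id)
  then have "y = concat (replicate (Suc (d - 1)) ?t)" by simp
  then have Q: "?Q ?t" by (intro exI[of _ "Suc (d - 1)"]) auto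
  define s where "s = ap y"
  have "?Q s" unfolding s_def ap_def using arg_min_natI[of ?Q ?t length] Q by blast
  then obtain j where j: "j \<ge> 1" "y = concat (replicate j s)" by blast
  have "length s \<le> length ?t" unfolding s_def ap_def using arg_min_nat_le[of ?Q ?t length] Q by blast
  moreover have "?p \<le> length s"
    using p(5)[of "length s"] j assms rotate_concat_replicate[of s j] by (cases s) auto
  ultimately have "length s = ?p" using len by simp
  moreover have "take (length s) y = s"
    using j by (cases j) auto
  ultimately show ?thesis by (simp add: s_def)
qed

lemma length_ap: "y \<noteq> [] \<Longrightarrow> length (ap y) = period y"
  using period(3)[of y] by (simp add: ap_eq)

lemma drop_period:
  assumes "y \<noteq> []"
  shows "drop (period y) y = take (length y - period y) y"
    and "drop (length y - period y) y = take (period y) y"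
proof -
  note p = period[OF assms]
  show "drop (period y) y = take (length y - period y) y"
    by (rule nth_equalityI) (use p(3) assms in \<open>auto intro!: nth_add_period\<close>)
  show "drop (length y - period y) y = take (period y) y"
  proof (rule nth_equalityI)
    fix i assume i: "i < length (drop (length y - period y) y)"
    have "period y dvd length y - period y" using p(3,4) by (simp add: dvd_diff_nat)
    then have "(length y - period y + i) mod period y = i mod period y"
      by (auto elim!: dvdE)
    with i p(3) assms show "drop (length y - period y) y ! i = take (period y) y ! i"
      by (auto intro!: nth_add_period)
  qed (use p(3) in auto)
qed

lemma rotate_period_inj:
  assumes "y \<noteq> []"
  shows "inj_on (\<lambda>i. rotate i y) {..<period y}"
proof -
  have "i = j" if "i \<le> j" "j < period y" "rotate i y = rotate j y" for i j
    using period(5)[OF assms, of "j - i"] rotate_eq_rotateD[OF that(3,1)] that(1,2)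
    by (cases "i = j") (simp_all add: Suc_le_eq)
  then show ?thesis
    unfolding inj_on_def by (metis lessThan_iff nat_le_linear)
qed

lemma range_rotate:
  assumes "y \<noteq> []"
  shows "range (\<lambda>i. rotate i y) = (\<lambda>i. rotate i y) ` {..<period y}"
proof -
  have "rotate i y \<in> (\<lambda>i. rotate i y) ` {..<period y}" for i
    using rotate_fixed_mod[OF period(2)[OF assms], of i] period(1)[OF assms]
    by (intro image_eqI[of _ _ "i mod period y"]) auto
  then show ?thesis by blast
qed

lemma card_range_rotate: "y \<noteq> [] \<Longrightarrow> card (range (\<lambda>i. rotate i y)) = length (ap y)"
  by (simp add: range_rotate card_image rotate_period_inj length_ap)

subsection \<open>Occurrences in cyclic sequences\<close>

lemma occurs_at_infix:
  assumes "s \<noteq> []"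
  shows "occurs_at (xs @ s @ ys) s (length xs + 1)"
  unfolding occurs_at_def using assms by (auto simp: nth_append Suc_le_eq)

lemma occurs_at_wrap:
  assumes "c = c1 @ s1" "c = s2 @ c2" "s1 \<noteq> []"
  shows "occurs_at c (s1 @ s2) (length c - length s1 + 1)"
  unfolding occurs_at_def
proof (intro conjI allI impI)
  have c: "length c = length c1 + length s1" "length s2 \<le> length c"
    using arg_cong[OF assms(1), of length] arg_cong[OF assms(2), of length] by auto
  then show "length c - length s1 + 1 \<le> length c" using assms(3) by (simp add: Suc_le_eq)
  fix j assume j: "j < length (s1 @ s2)"
  show "c ! ((length c - length s1 + 1 - 1 + j) mod length c) = (s1 @ s2) ! j"
  proof (cases "j < length s1")
    case True
    then show ?thesis using assms(1) by (simp add: nth_append)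
  next
    case False
    then have "length c - length s1 + 1 - 1 + j = length c + (j - length s1)"
      "j - length s1 < length c" using c j by auto
    then have "(length c - length s1 + 1 - 1 + j) mod length c = j - length s1" by simp
    moreover have "j - length s1 < length s2" using False j by auto
    then have "c ! (j - length s1) = s2 ! (j - length s1)"
      using assms(2) by (simp add: nth_append)
    moreover have "(s1 @ s2) ! j = s2 ! (j - length s1)"
      using False by (simp add: nth_append)
    ultimately show ?thesis by metis
  qed
qed simp

text \<open>Pigeonhole: a start position determines the string of length \<open>n\<close> read
  there, so a choice of one occurrence per string is injective and, by the cardinality, exhausts all
  positions. A further occurrence of \<open>s\<close> starts at the position chosen for some string,
  which can only be \<open>s\<close>.\<close>

lemma cyclic_rankI:
  assumes fin: "finite A" and card: "card A = length c"
    and len: "\<And>s. s \<in> A \<Longrightarrow> length s = n"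
    and ex: "\<And>s. s \<in> A \<Longrightarrow> \<exists>r. occurs_at c s r"
    and s: "s \<in> A" "occurs_at c s r"
  shows "cyclic_rank c s = r"
  unfolding cyclic_rank_def
proof (rule the_equality)
  obtain f where f: "\<And>s. s \<in> A \<Longrightarrow> occurs_at c s (f s)" using ex by metis
  have det: "s = s'" if "s \<in> A" "s' \<in> A" "occurs_at c s r" "occurs_at c s' r" for s s' r
    using that len unfolding occurs_at_def by (metis nth_equalityI)
  have "inj_on f A" by (rule inj_onI) (metis det f)
  moreover have "f ` A \<subseteq> {1..length c}" using f by (auto simp: occurs_at_def)
  ultimately have "f ` A = {1..length c}"
    using card by (metis card_atLeastAtMost card_image card_subset_eq diff_Suc_1 finite_atLeastAtMost)
  moreover have "r \<in> {1..length c}" if "occurs_at c s r" for r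
    using that by (simp add: occurs_at_def)
  ultimately have "f s = r" if "occurs_at c s r" for r
    using that det f s(1) by (metis (no_types, lifting) imageE)
  then show "r' = r" if "occurs_at c s r'" for r'
    using that s(2) by metis
qed (rule s)

subsection \<open>The sequence of necklaces\<close>

text \<open>A rotation starting at or before the raised letter, but not at 0, meets it at an index
  where the raised word is itself unchanged, so the comparison only improves. A rotation starting
  behind it begins with \<open>k\<close>, while the raised word starts with a smaller letter unless
  it is constant.\<close>

lemma necklace_raise:
  assumes neck: "necklace (x @ [a] @ replicate z k)" and a: "a < k"
    and x: "set x \<subseteq> {1..k}"
  shows "necklace (x @ [Suc a] @ replicate z k)"
proof -
  define y y' where "y = x @ [a] @ replicate z k" and "y' = x @ [Suc a] @ replicate z k"
  define n where "n = length x + 1 + z"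
  have len: "length y = n" "length y' = n" by (auto simp: y_def y'_def n_def)
  have n: "0 < n" by (simp add: n_def)
  have y'y: "y' ! j = (if j = length x then Suc a else y ! j)" for j
    by (auto simp: y_def y'_def nth_append)
  have neck: "y \<le> rotate i y" for i using neck by (simp add: y_def necklace_def)
  have "y' \<le> rotate i y'" if i: "i < n" for i
  proof (cases "i = 0 \<or> length x < i")
    case False
    have rot: "rotate i y ! j = y ! (i + j)" "rotate i y' ! j = y' ! (i + j)"
      if "j \<le> length x - i" for j
      using that i False len by (auto simp: nth_rotate n_def)
    have same: "rotate i y' ! j = cyc y (i + j)" "y' ! j = y ! j" if "j < length x - i" for j
      using that i False len rot(2)[of j] by (auto simp: y'y cyc_nth n_def)
    have raised: "rotate i y' ! (length x - i) = Suc a" "cyc y (i + (length x - i)) = a"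
      "y' ! (length x - i) = y ! (length x - i)"
      using False i len rot(2)[of "length x - i"] by (auto simp: y'y cyc_nth n_def y_def)
    have "not_below ((!) y) n (cyc y) i"
      unfolding not_below_def
    proof (intro allI impI, rule ccontr)
      fix q assume "q < n" "\<forall>j<q. cyc y (i + j) = y ! j" "\<not> y ! q \<le> cyc y (i + q)"
      then have "rotate i y < y"
        by (subst list_less_iff_nth) (auto simp: len nth_rotate_cyc intro!: exI[of _ q])
      with neck show False by (meson leD)
    qed
    moreover have "length x - i < n" by (simp add: n_def)
    ultimately consider (less) q where "q < length x - i" "beats ((!) y) (cyc y) i q"
      | (eq) "\<forall>j<length x - i. cyc y (i + j) = y ! j" "y ! (length x - i) \<le> cyc y (i + (length x - i))"
      using not_below_iff[of "(!) y" "length x - i" "cyc y" i] not_below_mono[of "(!) y" n]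
        not_belowD[of "(!) y" n "cyc y" i "length x - i"]
      by (metis less_imp_le)
    then have "\<exists>q\<le>length x - i. (\<forall>j<q. rotate i y' ! j = y' ! j) \<and> y' ! q < rotate i y' ! q"
    proof cases
      case less
      then show ?thesis using same by (intro exI[of _ q]) (auto simp: beats_def)
    next
      case eq
      then show ?thesis using same raised by (intro exI[of _ "length x - i"]) auto
    qed
    then obtain q where "q \<le> length x - i" "\<forall>j<q. rotate i y' ! j = y' ! j" "y' ! q < rotate i y' ! q"
      by blast
    then have "y' < rotate i y'"
      by (subst list_less_iff_nth) (auto simp: len n_def intro!: exI[of _ q])
    then show ?thesis by simp
  next
    case True
    show ?thesis
    proof (cases "i = 0")
      case False
      then have k: "rotate i y' ! 0 = k" using True i len n by (auto simp: nth_rotate y'_def n_def nth_append)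
      show ?thesis
      proof (cases x)
        case Nil
        show ?thesis
        proof (cases "Suc a = k")
          case True
          then have "y' = replicate n k" using Nil by (simp add: y'_def n_def)
          then have "rotate i y' = y'"
            by (metis length_rotate rotate_map map_replicate_const map_replicate_trivial
                replicate_length_same set_rotate in_set_replicate)
          then show ?thesis by simp
        next
          case False
          then have "y' ! 0 < rotate i y' ! 0" using k a Nil by (simp add: y'_def)
          then have "y' < rotate i y'" using n by (subst list_less_iff_nth) (auto simp: len)
          then show ?thesis by simp
        qed
      next
        case (Cons b x')
        have "y ! 0 \<le> y ! length x"
          using necklace_nth_0_le[of y "length x"] neck len by (auto simp: necklace_def n_def)
        then have "y ! 0 < k" using a by (simp add: y_def)
        then have "y' ! 0 < rotate i y' ! 0" using k Cons by (simp add: y'_def y_def)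
        then have "y' < rotate i y'" using n by (subst list_less_iff_nth) (auto simp: len)
        then show ?thesis by simp
      qed
    qed simp
  qed
  then have "y' \<le> rotate i y'" for i
    using rotate_conv_mod[of i y'] n len by (metis mod_less_divisor)
  then show ?thesis by (simp add: necklace_def y'_def)
qed

text \<open>The first difference to the smaller word cannot lie in its tail of letters
  \<open>k\<close>, and before the raised letter it would lift \<open>b\<close> above the larger
  word. At the raised letter only \<open>Suc a\<close> remains.\<close>

lemma between_raise:
  assumes "length b = length x + 1 + z" "set b \<subseteq> {..k}"
    and lt: "x @ [a] @ replicate z k < b" and le: "b \<le> x @ [Suc a] @ replicate z k"
  shows "\<exists>c. b = x @ [Suc a] @ c"
proof -
  let ?y = "x @ [a] @ replicate z k" and ?y' = "x @ [Suc a] @ replicate z k"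
  have "length ?y = length b" using assms(1) by simp
  with lt obtain q where q: "q < length b" "\<forall>j<q. ?y ! j = b ! j" "?y ! q < b ! q"
    using list_less_iff_nth[of ?y b] by auto
  have nle: "\<not> (\<exists>q<length b. (\<forall>j<q. ?y' ! j = b ! j) \<and> ?y' ! q < b ! q)"
    using le list_less_iff_nth[of ?y' b] assms(1) by (auto simp: not_less)
  have "q \<le> length x"
  proof (rule ccontr)
    assume "\<not> q \<le> length x"
    then have "?y ! q = k" using q(1) assms(1) by (auto simp: nth_append nth_Cons')
    moreover have "b ! q \<le> k" using assms(2) q(1) by (auto simp: subset_iff)
    ultimately show False using q(3) by simp
  qed
  moreover have "\<not> q < length x"
  proof
    assume qx: "q < length x"
    then have "\<forall>j<q. ?y' ! j = b ! j" using q(2) by (auto simp: nth_append)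
    moreover have "?y' ! q < b ! q" using q(3) qx by (auto simp: nth_append)
    ultimately show False using nle q(1) by blast
  qed
  ultimately have qx: "q = length x" by simp
  have "take q b = x"
    using q qx by (intro nth_equalityI) (auto simp: nth_append)
  moreover have "b ! q = Suc a"
  proof -
    have "\<forall>j<q. ?y' ! j = b ! j" using q(2) qx by (auto simp: nth_append)
    then have "\<not> ?y' ! q < b ! q" using nle q(1) by blast
    then have "b ! q \<le> Suc a" using qx by simp
    then show ?thesis using q(3) qx by simp
  qed
  ultimately have "b = x @ [Suc a] @ drop (Suc q) b"
    using id_take_nth_drop[OF q(1)] by simp
  then show ?thesis by blast
qed

lemma split_last_below:
  fixes y :: "nat list"
  assumes "set y \<subseteq> {..k}" "y \<noteq> replicate (length y) k"
  shows "\<exists>x a z. y = x @ [a] @ replicate z k \<and> a < k"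
proof -
  have "\<exists>c\<in>set y. c \<noteq> k" using assms(2) by (metis replicate_length_same)
  then obtain x a zs where *: "y = x @ a # zs" "a \<noteq> k" "\<forall>c\<in>set zs. c = k"
    using split_list_last_prop[of y "\<lambda>c. c \<noteq> k"] by blast
  then have "zs = replicate (length zs) k" "a < k"
    using assms(1) by (auto simp: replicate_length_same[symmetric])
  with * show ?thesis by (metis append_Cons append_Nil)
qed

section \<open>Overlaps between consecutive necklaces\<close>

locale necklace_cycle =
  fixes n k w :: nat
  assumes n: "2 \<le> n" and k: "1 \<le> k" and w: "w < k * n"
begin

abbreviation "A \<equiv> necklaces_ge k n w"
abbreviation "cat ys \<equiv> concat (map ap ys)"

lemma strings_geD:
  assumes "y \<in> strings_ge k n w"
  shows "length y = n" "set y \<subseteq> {1..k}" "set y \<subseteq> {..k}" "w \<le> sum_list y" "y \<noteq> []"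
  using assms n by (auto simp: strings_defs)

lemma rotate_strings_ge [simp]: "rotate i y \<in> strings_ge k n w \<longleftrightarrow> y \<in> strings_ge k n w"
  by (simp add: strings_defs)

lemma set_A: "set A = {y \<in> strings_ge k n w. necklace y}"
  by (simp add: necklaces_ge_def)

lemma sorted_A: "sorted_wrt (<) A"
  by (simp add: necklaces_ge_def)

lemma in_A: "y \<in> set A \<Longrightarrow> y \<in> strings_ge k n w" "y \<in> set A \<Longrightarrow> necklace y"
  by (auto simp: set_A)

lemma max_in_A: "replicate n k \<in> set A"
proof -
  have "rotate i (replicate n k) = replicate n k" for i
    by (metis in_set_replicate length_replicate length_rotate replicate_length_same set_rotate)
  then show ?thesis
    using k w by (auto simp: set_A strings_defs necklace_def sum_list_replicate mult.commute)
qed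

lemma le_max: "length y = n \<Longrightarrow> set y \<subseteq> {..k} \<Longrightarrow> y \<le> replicate n k"
proof (rule ccontr)
  assume y: "length y = n" "set y \<subseteq> {..k}" and "\<not> y \<le> replicate n k"
  then have "replicate n k < y" by simp
  then obtain q where "q < n" "replicate n k ! q < y ! q"
    using list_less_iff_nth[of "replicate n k" y] y by auto
  then have "k < y ! q" by simp
  moreover have "y ! q \<in> set y" using \<open>q < n\<close> y by simp
  ultimately show False using y(2) by auto
qed

lemma last_A:
  assumes "A = pre @ [y]"
  shows "y = replicate n k"
proof -
  have "replicate n k \<le> y"
    using max_in_A sorted_A assms by (auto simp: sorted_wrt_append)
  moreover have "y \<in> set A" using assms by simp
  then have "y \<le> replicate n k" using le_max strings_geD[OF in_A(1)] by blast
  ultimately show ?thesis by simp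
qed

lemma first_lt_max:
  assumes "y \<in> set A" "y ! 0 = k"
  shows "y = replicate n k"
proof -
  note y = strings_geD[OF in_A(1)[OF assms(1)]]
  have "y ! i = k" if "i < n" for i
  proof -
    have "k \<le> y ! i" using necklace_nth_0_le[OF in_A(2)[OF assms(1)], of i] assms(2) that y(1) by simp
    moreover have "y ! i \<in> set y" using that y(1) by simp
    ultimately show ?thesis using y(3) by (meson atMost_iff le_antisym subsetD)
  qed
  then show ?thesis using y(1) by (intro nth_equalityI) auto
qed

lemma next_A:
  assumes "A = pre @ y # b # post"
  shows "\<exists>x a z c. y = x @ [a] @ replicate z k \<and> a < k \<and> b = x @ [Suc a] @ c"
proof -
  have mem: "y \<in> set A" "b \<in> set A" using assms by auto
  note y = strings_geD[OF in_A(1)[OF mem(1)]] and b = strings_geD[OF in_A(1)[OF mem(2)]]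
  have "y < b" using sorted_A assms by (simp add: sorted_wrt_append)
  then have "y \<noteq> replicate (length y) k" using le_max[OF b(1,3)] y(1) by auto
  from split_last_below[OF y(3) this] obtain x a z where xa: "y = x @ [a] @ replicate z k" "a < k"
    by blast
  let ?y' = "x @ [Suc a] @ replicate z k"
  have "necklace ?y'"
    using necklace_raise[of x a z k] in_A(2)[OF mem(1)] xa y(2) by auto
  moreover have "?y' \<in> strings_ge k n w"
    using y xa by (auto simp: strings_defs)
  ultimately have "?y' \<in> set A" by (simp add: set_A)
  moreover have "y < ?y'"
    unfolding xa(1) by (subst list_less_iff_nth) (auto intro!: exI[of _ "length x"] simp: nth_append)
  moreover have "c < y" if "c \<in> set pre" for c
    using that sorted_A assms by (simp add: sorted_wrt_append)
  ultimately have "?y' \<in> set (b # post)"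
    using assms by (auto dest: less_asym)
  then have "b \<le> ?y'"
    using sorted_A assms by (auto simp: sorted_wrt_append)
  moreover have "length b = length x + 1 + z" using b(1) y(1) xa(1) by simp
  ultimately have "\<exists>c. b = x @ [Suc a] @ c"
    using between_raise[of b x z k a] b(3) \<open>y < b\<close> xa(1) by blast
  with xa show ?thesis by blast
qed

text \<open>\<open>length x\<close> is the last position of a letter other than \<open>k\<close>,
  and \<open>n - period y + j\<close> is the position of the letter \<open>j\<close> of the root in
  its last copy. This measures how far \<open>y\<close> agrees with its successor.\<close>

lemma last_below_position:
  assumes y: "y = x @ [a] @ replicate z k" "length y = n" and j: "j < period y" "y ! j \<noteq> k"
  shows "n - period y + j \<le> length x"
proof (rule ccontr)
  assume neg: "\<not> n - period y + j \<le> length x"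
  have ne: "y \<noteq> []" using y by simp
  note p = period[OF ne]
  have lt: "n - period y + j < n" using j p(3) y(2) by simp
  have "period y dvd n - period y" using p(3,4) y(2) by (simp add: dvd_diff_nat)
  then have "(n - period y + j) mod period y = j mod period y"
    by (auto elim!: dvdE)
  then have "y ! (n - period y + j) = y ! j"
    using nth_add_period[OF ne, of "n - period y + j" j] lt j p(3) y(2) by simp
  moreover have "y ! (n - period y + j) = k"
    using neg lt y by (auto simp: nth_append nth_Cons')
  ultimately show False using j(2) by simp
qed

text \<open>A successor \<open>replicate n k\<close> would, as \<open>x\<close> is nonempty, force
  \<open>y\<close> to start with \<open>k\<close>; but a necklace of the list starting with
  \<open>k\<close> is constant.\<close>

lemma next_A_not_last:
  assumes A: "A = pre @ y # b # post" and y: "y = x @ [a] @ replicate z k" "a < k"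
    and b: "b = x @ [Suc a] @ c" and x: "x \<noteq> []"
  shows "post \<noteq> []"
proof
  assume "post = []"
  then have "b = replicate n k" using last_A[of "pre @ [y]" b] A by simp
  then have y0: "y ! 0 = k" using y(1) b x n by (cases x; cases n) auto
  have "y \<in> set A" using A by simp
  from first_lt_max[OF this y0] have "a \<in> set (replicate n k)" using y(1) by (metis append_Cons in_set_conv_decomp)
  then show False using y(2) by simp
qed

text \<open>The root of \<open>y\<close> is followed by the next necklace \<open>b\<close>, which
  shares the first \<open>n - period y\<close> letters with \<open>y\<close>: these are the missing
  copies of the root. For the last necklace nothing follows the root, hence \<open>post\<close> must
  be nonempty.\<close>

lemma cat_prefix:
  "A = pre @ y # post \<Longrightarrow> post \<noteq> [] \<Longrightarrow> \<exists>r. cat (y # post) = y @ r"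
proof (induction post arbitrary: pre y)
  case (Cons b post)
  have mem: "y \<in> set A" "b \<in> set A" using Cons.prems by auto
  note y = strings_geD[OF in_A(1)[OF mem(1)]] and b = strings_geD[OF in_A(1)[OF mem(2)]]
  note p = period[OF y(5)]
  show ?case
  proof (cases "period y = n")
    case True
    then show ?thesis using y by (simp add: ap_eq)
  next
    case False
    then have pn: "period y < n" using p(3) y(1) by simp
    obtain x a z c where xa: "y = x @ [a] @ replicate z k" "a < k" "b = x @ [Suc a] @ c"
      using next_A[OF Cons.prems(1)] by blast
    have "\<exists>j<period y. y ! j \<noteq> k"
    proof (intro exI conjI)
      show "length x mod period y < period y" using p(1) by simp
      have "y ! (length x mod period y) = y ! length x"
        using nth_mod_period[OF y(5), of "length x"] xa(1) by simp
      then show "y ! (length x mod period y) \<noteq> k" using xa by simp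
    qed
    then obtain j where "j < period y" "y ! j \<noteq> k" by blast
    from last_below_position[OF xa(1) y(1) this] have x: "n - period y \<le> length x" by simp
    then have xne: "x \<noteq> []" using pn by auto
    have "post \<noteq> []" by (rule next_A_not_last[OF Cons.prems(1) xa xne])
    then obtain r where r: "cat (b # post) = b @ r"
      using Cons.IH[of "pre @ [y]" b] Cons.prems(1) by auto
    have "take (n - period y) b = take (n - period y) y"
      using xa x by simp
    then have "b = drop (period y) y @ drop (n - period y) b"
      using drop_period(1)[OF y(5)] y(1) by (metis append_take_drop_id)
    then have "cat (y # b # post) = take (period y) y @ drop (period y) y @ drop (n - period y) b @ r"
      using r y(5) by (simp add: ap_eq)
    then show ?thesis by (metis append.assoc append_take_drop_id)
  qed
qed simp

text \<open>A letter other than \<open>k\<close> at or behind offset \<open>i\<close> of the root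
  makes the successor agree with \<open>y\<close> in the first \<open>n - period y + i\<close>
  letters. They supply the missing copies of the root and its first \<open>i\<close> letters, which
  completes the rotation.\<close>

lemma occurs_within:
  assumes A: "A = pre @ y # post" and j: "i \<le> j" "j < period y" "y ! j \<noteq> k"
  shows "occurs_at (cat A) (rotate i y) (length (cat pre) + i + 1)"
proof -
  have mem: "y \<in> set A" using A by auto
  note y = strings_geD[OF in_A(1)[OF mem]]
  note p = period[OF y(5)]
  have "post \<noteq> []"
  proof
    assume "post = []"
    then have "y = replicate n k" using last_A A by simp
    with j p(3) y(1) show False by simp
  qed
  then obtain b post' where post: "post = b # post'" by (cases post) auto
  show ?thesis
  proof (cases "i = 0")
    case True
    obtain r where "cat (y # post) = y @ r" using cat_prefix[OF A \<open>post \<noteq> []\<close>] by blast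
    then have "cat A = cat pre @ y @ r" using A by simp
    with True show ?thesis using occurs_at_infix[of y "cat pre" r] y(5) by simp
  next
    case False
    obtain x a z c where xa: "y = x @ [a] @ replicate z k" "a < k" "b = x @ [Suc a] @ c"
      using next_A A post by blast
    have x: "n - period y + i \<le> length x"
      using last_below_position[OF xa(1) y(1) j(2,3)] j(1) by simp
    then have xne: "x \<noteq> []" using False by auto
    have "post' \<noteq> []" by (rule next_A_not_last[OF A[unfolded post] xa xne])
    then obtain r where r: "cat (b # post') = b @ r"
      using cat_prefix[of "pre @ [y]" b post'] A post by auto
    have ip: "i < period y" using j by simp
    have "take (n - period y + i) b = take (n - period y + i) y"
      using xa x by simp
    also have "\<dots> = take (n - period y) y @ take i (drop (n - period y) y)"
      by (rule take_add)
    also have "\<dots> = drop (period y) y @ take i y"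
      using drop_period[OF y(5)] y(1) ip by simp
    finally have "b = drop (period y) y @ take i y @ drop (n - period y + i) b"
      by (metis append.assoc append_take_drop_id)
    then have "cat (y # post) =
        take (period y) y @ drop (period y) y @ take i y @ drop (n - period y + i) b @ r"
      using r y(5) post by (simp add: ap_eq)
    also have "\<dots> = y @ take i y @ drop (n - period y + i) b @ r"
      by (metis append.assoc append_take_drop_id)
    also have "\<dots> = take i y @ rotate i y @ drop (n - period y + i) b @ r"
    proof -
      have "i < n" using ip p(3) y(1) by simp
      then have "rotate i y = drop i y @ take i y" using y(1) by (simp add: rotate_drop_take)
      then show ?thesis by (metis append.assoc append_take_drop_id)
    qed
    finally have "cat A = (cat pre @ take i y) @ rotate i y @ drop (n - period y + i) b @ r"
      using A by simp
    moreover have "length (cat pre @ take i y) = length (cat pre) + i"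
      using ip p(3) y(1) by simp
    ultimately show ?thesis
      using occurs_at_infix[of "rotate i y" "cat pre @ take i y"] y(5) by simp
  qed
qed

end

context necklace_cycle
begin

text \<open>Every copy of the root contains a letter other than \<open>k\<close>, so the final run
  of \<open>k\<close> fits into the last copy.\<close>

lemma ap_ends:
  assumes y: "y = x @ [a] @ replicate z k" "a < k" "length y = n"
  shows "\<exists>v. ap y = v @ replicate z k"
proof -
  have ne: "y \<noteq> []" using y by simp
  note p = period[OF ne]
  let ?j = "length x mod period y"
  have "?j < period y" using p(1) by simp
  moreover have "y ! ?j = y ! length x"
    using nth_mod_period[OF ne, of "length x"] y(1) by simp
  then have "y ! ?j \<noteq> k" using y by simp
  ultimately have "n - period y + ?j \<le> length x" using last_below_position y by blast
  then have *: "n - period y \<le> length (x @ [a])" by simp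
  have "ap y = drop (n - period y) y"
    using drop_period(2)[OF ne] y(3) by (simp add: ap_eq[OF ne])
  also have "\<dots> = drop (n - period y) (x @ [a]) @ replicate z k"
    using * y(1) by (metis append.assoc drop_append diff_is_0_eq drop0)
  finally show ?thesis by blast
qed

section \<open>Rotation classes and the lengths of initial segments of the cycle\<close>

lemma min_rotation:
  assumes "y \<in> strings_ge k n w"
  shows "\<exists>i. rotate i y \<in> set A \<and> (\<forall>j. rotate i y \<le> rotate j y)"
proof -
  let ?R = "range (\<lambda>i. rotate i y)"
  have fin: "finite ?R" using range_rotate[of y] strings_geD[OF assms] by simp
  have "Min ?R \<in> ?R" using Min_in[OF fin] by blast
  then obtain i where i: "Min ?R = rotate i y" by blast
  have le: "rotate i y \<le> rotate j y" for j
    unfolding i[symmetric] using Min_le[OF fin] by blast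
  then have "necklace (rotate i y)" by (simp add: necklace_def rotate_rotate)
  with le assms show ?thesis by (intro exI[of _ i]) (simp add: set_A)
qed

lemma rotation_unique:
  assumes "y \<in> set A" "z \<in> set A" "rotate i y = rotate j z"
  shows "y = z"
proof -
  have le: "y \<le> z" if "y \<in> set A" "z \<in> set A" "rotate i y = rotate j z" for i j y z
  proof -
    have "z = rotate (length z - j mod length z) (rotate j z)" by (simp only: rotate_back)
    also have "\<dots> = rotate (length z - j mod length z + i) y" using that(3) by (metis rotate_rotate)
    finally show ?thesis using in_A(2)[OF that(1)] unfolding necklace_def by metis
  qed
  show ?thesis using le[OF assms] le[OF assms(2,1) assms(3)[symmetric]] by simp
qed

text \<open>Each rotation class contains exactly one necklace, and the length of its root is the
  size of the class. A rotation-invariant \<open>Q\<close> selects whole classes.\<close>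

lemma length_cat_filter:
  assumes Q: "\<And>y i. y \<in> strings_ge k n w \<Longrightarrow> Q (rotate i y) \<longleftrightarrow> Q y"
  shows "length (cat (filter Q A)) = card {y \<in> strings_ge k n w. Q y}"
proof -
  let ?r = "\<lambda>y. range (\<lambda>i. rotate i y)"
  have ne: "y \<noteq> []" if "y \<in> set A" for y using strings_geD[OF in_A(1)[OF that]] by simp
  have "distinct A" by (simp add: necklaces_ge_def)
  then have "length (cat (filter Q A)) = (\<Sum>y\<in>set (filter Q A). length (ap y))"
    by (simp add: length_concat o_def sum_list_distinct_conv_sum_set)
  also have "\<dots> = (\<Sum>y\<in>set (filter Q A). card (?r y))"
    using ne by (intro sum.cong) (auto simp: card_range_rotate)
  also have "\<dots> = card (\<Union>y\<in>set (filter Q A). ?r y)"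
  proof (rule card_UN_disjoint[symmetric])
    show "\<forall>y\<in>set (filter Q A). finite (?r y)"
    proof
      fix y assume "y \<in> set (filter Q A)"
      then show "finite (?r y)" using ne[of y] range_rotate[of y] by simp
    qed
    show "\<forall>y\<in>set (filter Q A). \<forall>z\<in>set (filter Q A). y \<noteq> z \<longrightarrow> ?r y \<inter> ?r z = {}"
      using rotation_unique by fastforce
  qed simp
  also have "(\<Union>y\<in>set (filter Q A). ?r y) = {y \<in> strings_ge k n w. Q y}"
  proof (intro equalityI subsetI)
    fix y assume "y \<in> {y \<in> strings_ge k n w. Q y}"
    then have y: "y \<in> strings_ge k n w" "Q y" by auto
    obtain i where i: "rotate i y \<in> set A" using min_rotation[OF y(1)] by blast
    have "y = rotate (length y - i mod length y) (rotate i y)" by (simp only: rotate_back)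
    then show "y \<in> (\<Union>y\<in>set (filter Q A). ?r y)"
      using i Q y by (intro UN_I[of "rotate i y"]) auto
  qed (use Q in_A in auto)
  finally show ?thesis .
qed

lemma length_cat_A: "length (cat A) = card (strings_ge k n w)"
  using length_cat_filter[of "\<lambda>_. True"] by simp

text \<open>Only prefixes are compared, so \<open>u\<close> may be shorter than \<open>n\<close>; it
  then marks the boundary before the first necklace whose prefix is at least
  \<open>u\<close>.\<close>

definition below :: "nat list \<Rightarrow> nat" where
  "below u = card {y \<in> strings_ge k n w. \<exists>i. take (length u) (rotate i y) < u}"

lemma length_cat_below:
  assumes "length u \<le> n"
  shows "length (cat (filter (\<lambda>y. take (length u) y < u) A)) = below u"
proof -
  let ?Q = "\<lambda>y. \<exists>i. take (length u) (rotate i y) < u"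
  have "filter (\<lambda>y. take (length u) y < u) A = filter ?Q A"
  proof (rule filter_cong[OF refl])
    fix y assume y: "y \<in> set A"
    have "take (length u) y \<le> take (length u) (rotate i y)" for i
      using in_A(2)[OF y] by (intro take_mono_lex) (auto simp: necklace_def)
    then show "(take (length u) y < u) = ?Q y"
      by (metis le_less_trans rotate0 id_apply)
  qed
  moreover have "?Q (rotate j y) \<longleftrightarrow> ?Q y" for j y
  proof
    assume "?Q y"
    then obtain i where "take (length u) (rotate i y) < u" by blast
    then have "take (length u) (rotate (i + (length y - j mod length y)) (rotate j y)) < u"
      by (metis rotate_back rotate_rotate)
    then show "?Q (rotate j y)" by blast
  qed (auto simp: rotate_rotate)
  ultimately show ?thesis
    using length_cat_filter[of ?Q] by (simp add: below_def)
qed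

lemma A_split:
  assumes "length u \<le> n"
  shows "A = filter (\<lambda>y. take (length u) y < u) A @ filter (\<lambda>y. \<not> take (length u) y < u) A"
proof -
  have "ys = filter (\<lambda>y. take (length u) y < u) ys @ filter (\<lambda>y. \<not> take (length u) y < u) ys"
    if "sorted_wrt (<) ys" "\<And>y. y \<in> set ys \<Longrightarrow> length y = n" for ys
    using that
  proof (induction ys)
    case (Cons y ys)
    show ?case
    proof (cases "take (length u) y < u")
      case False
      have "\<not> take (length u) z < u" if "z \<in> set ys" for z
      proof -
        have "take (length u) y \<le> take (length u) z"
          using Cons.prems that by (intro take_mono_lex) auto
        with False show ?thesis by auto
      qed
      then have "filter (\<lambda>y. take (length u) y < u) ys = []"
        "filter (\<lambda>y. \<not> take (length u) y < u) ys = ys"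
        by (auto simp: filter_empty_conv)
      with False show ?thesis by simp
    qed (use Cons in auto)
  qed simp
  then show ?thesis using sorted_A strings_geD(1) in_A(1) by blast
qed

lemma max_period: "period (replicate n k) = 1"
proof -
  have "rotate 1 (replicate n k) = replicate n k" by simp
  then show ?thesis
    using period(1,5)[of "replicate n k"] n by (metis One_nat_def le_antisym order.refl
        replicate_empty not_numeral_le_zero)
qed

text \<open>The last root is the single letter \<open>k\<close>, so the other letters
  \<open>k\<close> must come from the necklace before it. One exists, as the string with one letter
  \<open>k - 1\<close> and otherwise \<open>k\<close> has weight k n - 1 >= w. Its part
  \<open>x\<close> is empty, since otherwise it would start with \<open>k\<close>; hence its root
  ends with \<open>n - 1\<close> letters \<open>k\<close>.\<close>

lemma cat_A_ends:
  assumes "2 \<le> k"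
  shows "\<exists>v. cat A = v @ replicate n k"
proof -
  have "A \<noteq> []" using max_in_A by auto
  then obtain pre where pre: "A = pre @ [replicate n k]"
    using last_A by (metis append_butlast_last_id)
  let ?y = "(k - 1) # replicate (n - 1) k"
  have "k * n = (k - 1) + (n - 1) * k + 1"
    using assms n by (cases k; cases n) (auto simp: algebra_simps)
  then have "?y \<in> strings_ge k n w"
    using assms n w by (auto simp: strings_defs sum_list_replicate)
  then obtain i where i: "rotate i ?y \<in> set A" using min_rotation by blast
  have "k - 1 \<in> set (rotate i ?y)" by simp
  then have "rotate i ?y \<noteq> replicate n k" using assms by (metis in_set_replicate diff_less less_not_refl2
        less_le_trans zero_less_numeral zero_less_one)
  then have "pre \<noteq> []" using i pre by auto
  then obtain pre' d where d: "pre = pre' @ [d]" by (metis append_butlast_last_id)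
  with pre have "A = pre' @ d # replicate n k # []" by simp
  from next_A[OF this] obtain x a z c where xa:
    "d = x @ [a] @ replicate z k" "a < k" "replicate n k = x @ [Suc a] @ c"
    by blast
  have dA: "d \<in> set A" using d pre by simp
  have "x = []"
  proof (rule ccontr)
    assume ne: "x \<noteq> []"
    have "replicate n k ! 0 = k" using n by simp
    then have "d ! 0 = k" using xa(1,3) ne by (cases x) auto
    have "a \<in> set d" using xa(1) by simp
    with first_lt_max[OF dA \<open>d ! 0 = k\<close>] have "a \<in> set (replicate n k)" by simp
    then show False using xa(2) by simp
  qed
  have len: "length d = n" using strings_geD[OF in_A(1)[OF dA]] by simp
  then have "z = n - 1" using xa(1) \<open>x = []\<close> by simp
  then obtain v where "ap d = v @ replicate (n - 1) k"
    using ap_ends[OF xa(1,2) len] by blast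
  moreover have "ap (replicate n k) = [k]"
    using n max_period by (cases n) (auto simp: ap_eq)
  moreover have "replicate (n - 1) k @ [k] = replicate n k"
    using n by (cases n) (auto simp: replicate_append_same)
  ultimately have "cat A = (cat pre' @ v) @ replicate n k"
    using pre d by simp
  then show ?thesis by blast
qed

text \<open>If \<open>k = 1\<close>, the cycle has length 1 and \<open>r = n\<close>; the truncated subtraction then yields the
  correct position 1.\<close>

lemma occurs_across:
  assumes s: "replicate r k @ u \<in> strings_ge k n w" and r: "1 \<le> r"
    and neck: "necklace (u @ replicate r k)" and u: "u = [] \<or> u ! 0 \<noteq> k"
  shows "occurs_at (cat A) (replicate r k @ u)
    ((if below u = 0 then card (strings_ge k n w) - r else below u - r) + 1)"
proof -
  let ?P = "\<lambda>y. take (length u) y < u"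
  define pre post where "pre = filter ?P A" and "post = filter (\<lambda>y. \<not> ?P y) A"
  note s' = strings_geD[OF s]
  have lenu: "length u \<le> n" "n = r + length u" using s'(1) by auto
  have split: "A = pre @ post" unfolding pre_def post_def using A_split[OF lenu(1)] .
  have L: "below u = length (cat pre)" unfolding pre_def using length_cat_below[OF lenu(1)] by simp
  have y0: "u @ replicate r k \<in> set A"
  proof -
    have "u @ replicate r k = rotate r (replicate r k @ u)"
      using rotate_append[of "replicate r k" u] by simp
    then show ?thesis using s neck by (simp add: set_A)
  qed
  show ?thesis
  proof (cases "k = 1")
    case True
    have one: "strings_ge k n w = {replicate n 1}"
    proof -
      have "y = replicate n 1" if "y \<in> strings_ge k n w" for y
        using strings_geD[OF that] True by (metis atLeastAtMost_singleton replicate_length_same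
            singletonD subsetD)
      note all_one = this
      have "replicate n 1 \<in> strings_ge k n w" using s all_one[OF s] by simp
      with all_one show ?thesis by blast
    qed
    have "length (cat A) = 1" using length_cat_A one by simp
    moreover have "set A \<subseteq> {replicate n 1}" using one in_A(1) by auto
    ultimately have cA: "cat A = [1]"
    proof -
      have "set (cat A) \<subseteq> {1}"
        using \<open>set A \<subseteq> {replicate n 1}\<close> strings_geD(5) in_A(1)
        by (auto simp: ap_eq dest!: in_set_takeD)
      then show ?thesis using \<open>length (cat A) = 1\<close> by (cases "cat A") auto
    qed
    have su: "replicate r k @ u = replicate n 1" using s one by simp
    have ub: "u = []"
    proof (rule ccontr)
      assume "u \<noteq> []"
      then have "u ! 0 \<in> set (replicate r k @ u)" by simp
      then have "u ! 0 = 1" using su by simp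
      then show False using u \<open>u \<noteq> []\<close> True by simp
    qed
    then have "below u = 0" by (simp add: below_def)
    then show ?thesis
      unfolding su using one r by (simp add: cA occurs_at_def)
  next
    case False
    then have k2: "2 \<le> k" using k by simp
    obtain v where v: "cat A = v @ replicate n k" using cat_A_ends[OF k2] by blast
    then have v': "cat A = (v @ replicate (length u) k) @ replicate r k"
      using lenu(2) by (simp add: replicate_add[symmetric] add.commute)
    show ?thesis
    proof (cases "u = []")
      case True
      then have "below u = 0" by (simp add: below_def)
      then show ?thesis
        using occurs_at_wrap[OF v', of "[]" "cat A"] r True length_cat_A by simp
    next
      case une: False
      then have u0: "u ! 0 \<noteq> k" using u by simp
      have "u @ replicate r k \<in> set post" using y0 by (simp add: post_def)
      then obtain y post' where post: "post = y # post'" by (cases post) auto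
      have ym: "y \<in> set post" using post by simp
      have yA: "y \<in> set A" using ym split by simp
      have "take (length u) y = u"
      proof -
        have "u \<le> take (length u) y" using ym by (simp add: post_def not_less)
        moreover have "y \<le> u @ replicate r k"
          using \<open>u @ replicate r k \<in> set post\<close> sorted_A split post by (auto simp: sorted_wrt_append)
        then have "take (length u) y \<le> take (length u) (u @ replicate r k)"
          using strings_geD(1)[OF in_A(1)[OF yA]] lenu by (intro take_mono_lex) auto
        ultimately show ?thesis by simp
      qed
      then obtain y' where y': "y = u @ y'" by (metis append_take_drop_id)
      have "post' \<noteq> []"
      proof
        assume "post' = []"
        then have "y = replicate n k" using last_A split post by simp
        then have "y ! 0 = k" using n by simp
        then show False using u0 y' une by (simp add: nth_append)
      qed
      then obtain t where t: "cat post = u @ t"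
        using cat_prefix[of pre y post'] split post y' by auto
      show ?thesis
      proof (cases "pre = []")
        case True
        then have "cat A = u @ t" using t split by simp
        from occurs_at_wrap[OF v' this] r show ?thesis
          using L True length_cat_A by simp
      next
        case False
        then obtain pre' d where d: "pre = pre' @ [d]" by (metis append_butlast_last_id)
        then have "A = pre' @ d # y # post'" using split post by simp
        from next_A[OF this] obtain x a z c where xa:
          "d = x @ [a] @ replicate z k" "a < k" "y = x @ [Suc a] @ c" by blast
        have "d \<in> set pre" using d by simp
        then have dP: "?P d" and dA: "d \<in> set A"
          unfolding pre_def by auto
        have len: "length d = n" using strings_geD(1)[OF in_A(1)[OF dA]] .
        \<comment> \<open>Otherwise \<open>d\<close> would start with \<open>u\<close> like its
          successor \<open>y\<close>, and would not lie in \<open>pre\<close>. Thus only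
          \<open>k\<close> stands in the last \<open>r\<close> places of \<open>d\<close>.\<close>
        have "length x < length u"
        proof (rule ccontr)
          assume "\<not> length x < length u"
          then have "take (length u) d = take (length u) y" using xa by simp
          then show False using dP \<open>take (length u) y = u\<close> by simp
        qed
        then have "r \<le> z" using len xa(1) lenu(2) by simp
        obtain v where "ap d = v @ replicate z k"
          using ap_ends[OF xa(1,2) len] by blast
        then have "ap d = (v @ replicate (z - r) k) @ replicate r k"
          using \<open>r \<le> z\<close> by (simp flip: replicate_add)
        then have c: "cat A = (cat pre' @ v @ replicate (z - r) k) @ (replicate r k @ u) @ t"
          and lenL: "below u = length (cat pre' @ v @ replicate (z - r) k) + r"
          using split d t L by auto
        have "replicate r k @ u \<noteq> []" using r by simp
        from occurs_at_infix[OF this, of "cat pre' @ v @ replicate (z - r) k" t] show ?thesis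
          unfolding c using lenL r by simp
      qed
    qed
  qed
qed

section \<open>An occurrence of every string, and its rank\<close>

lemma occurs_within_below:
  assumes "y \<in> set A" "i \<le> j" "j < period y" "y ! j \<noteq> k"
  shows "occurs_at (cat A) (rotate i y) (below y + i + 1)"
proof -
  let ?P = "\<lambda>z. take (length y) z < y"
  have len: "length z = length y" if "z \<in> set A" for z
    using that strings_geD(1) in_A(1) assms(1) by metis
  have leny: "length y \<le> n" using strings_geD(1)[OF in_A(1)[OF assms(1)]] by simp
  have split: "A = filter ?P A @ filter (\<lambda>z. \<not> ?P z) A" using A_split[OF leny] .
  have "y \<in> set (filter (\<lambda>z. \<not> ?P z) A)" using assms(1) by simp
  then obtain y' post where post: "filter (\<lambda>z. \<not> ?P z) A = y' # post"
    by (cases "filter (\<lambda>z. \<not> ?P z) A") auto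
  have "y' \<in> set (filter (\<lambda>z. \<not> ?P z) A)" using post by simp
  then have "y \<le> y'" using len by auto
  moreover have "y' \<le> y"
  proof -
    have "y \<in> set (y' # post)" using assms(1) post by (metis \<open>y \<in> set (filter (\<lambda>z. \<not> ?P z) A)\<close>)
    moreover have "sorted_wrt (<) (y' # post)"
      using sorted_A post by (metis sorted_wrt_filter)
    ultimately show ?thesis by auto
  qed
  ultimately have "A = filter ?P A @ y # post" using split post by simp
  from occurs_within[OF this assms(2-4)] show ?thesis
    using length_cat_below[OF leny] by simp
qed

text \<open>If the root had only letters \<open>k\<close> from offset \<open>i\<close> on,
  \<open>s\<close> would start with \<open>r = period y - i\<close> letters \<open>k\<close>,
  followed by the first letter of \<open>y\<close>. That letter is \<open>k\<close> only for
  constant \<open>y\<close>; otherwise \<open>R = r\<close>. In both cases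
  \<open>rotate R s = y\<close>, against the last hypothesis.\<close>

lemma rotation_cases:
  assumes s: "s \<in> strings_ge k n w" and R: "R \<le> n" "\<And>j. j < R \<Longrightarrow> s ! j = k" "R = n \<or> s ! R \<noteq> k"
    and y: "y \<in> set A" "s = rotate i y" "i < period y"
    and not: "\<not> (1 \<le> R \<and> rotate R s = y)"
  shows "\<exists>j. i \<le> j \<and> j < period y \<and> y ! j \<noteq> k"
proof (rule ccontr)
  assume "\<not> ?thesis"
  then have run: "y ! j = k" if "i \<le> j" "j < period y" for j using that by blast
  note y' = strings_geD[OF in_A(1)[OF y(1)]]
  note p = period[OF y'(5)]
  have i: "i < n" using y(3) p(3) y'(1) by simp
  define r where "r = period y - i"
  have r: "1 \<le> r" "r \<le> n" using y(3) p(3) y'(1) by (auto simp: r_def)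
  have rot: "rotate r s = y"
    using y(2,3) p(2) by (simp add: r_def rotate_rotate)
  have sj: "s ! j = y ! ((i + j) mod n)" if "j < n" for j
    using y(2) that y'(1) by (simp add: nth_rotate)
  have sr: "s ! j = k" if "j < r" for j
    using sj[of j] run[of "i + j"] that y(3) p(3) y'(1) i by (simp add: r_def)
  show False
  proof (cases "R = r")
    case True
    then show ?thesis using not r rot by simp
  next
    case False
    show ?thesis
    proof (cases "R < r")
      case True
      then show ?thesis using R(3) sr r by auto
    next
      case rR: False
      then have "r < n" "s ! r = k" using False R by auto
      have "y ! 0 = k"
      proof (cases "period y = n")
        case True
        then have "(i + r) mod n = 0" using y(3) by (simp add: r_def)
        then show ?thesis using sj[OF \<open>r < n\<close>] \<open>s ! r = k\<close> by simp
      next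
        case False
        then have "period y < n" using p(3) y'(1) by simp
        then have "s ! r = y ! period y" using sj[OF \<open>r < n\<close>] y(3) by (simp add: r_def)
        moreover have "y ! period y = y ! 0"
          using nth_add_period[OF y'(5), of "period y" 0] \<open>period y < n\<close> y'(1) n by simp
        ultimately show ?thesis using \<open>s ! r = k\<close> by simp
      qed
      then have ymax: "y = replicate n k" using first_lt_max y(1) by blast
      then have "rotate j y = y" for j
        by (metis in_set_replicate length_rotate replicate_length_same set_rotate length_replicate)
      then have "s = y" "rotate R s = y" using y(2) by auto
      then show ?thesis using not \<open>\<not> R < r\<close> r by simp
    qed
  qed
qed

lemma occurs_run:
  assumes s: "s \<in> strings_ge k n w" and R: "R \<le> n" "\<And>j. j < R \<Longrightarrow> s ! j = k" "R = n \<or> s ! R \<noteq> k"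
    and neck: "1 \<le> R" "rotate R s \<in> set A"
  shows "occurs_at (cat A) s
    ((if below (drop R s) = 0 then card (strings_ge k n w) - R else below (drop R s) - R) + 1)"
proof -
  have len: "length s = n" using strings_geD[OF s] by simp
  have "take R s = replicate R k" using R(1,2) len by (intro nth_equalityI) auto
  then have sR: "s = replicate R k @ drop R s" by (metis append_take_drop_id)
  have "rotate R s = drop R s @ replicate R k"
    by (subst sR) (metis length_replicate rotate_append)
  then have "necklace (drop R s @ replicate R k)" using neck(2) in_A(2) by simp
  moreover have "drop R s = [] \<or> drop R s ! 0 \<noteq> k" using R(1,3) len by auto
  ultimately show ?thesis
    using occurs_across[of R "drop R s"] s sR neck(1) by simp
qed

lemma run_length:
  assumes "s \<in> strings_ge k n w"
  shows "\<exists>R\<le>n. (\<forall>j<R. s ! j = k) \<and> (R = n \<or> s ! R \<noteq> k)"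
proof (cases "\<exists>j<n. s ! j \<noteq> k")
  case True
  define R where "R = (LEAST j. j < n \<and> s ! j \<noteq> k)"
  have "R < n \<and> s ! R \<noteq> k" using LeastI_ex[OF True] by (simp add: R_def)
  moreover have "s ! j = k" if "j < R" for j
    using not_less_Least[of j "\<lambda>j. j < n \<and> s ! j \<noteq> k"] that calculation unfolding R_def by auto
  ultimately show ?thesis by (intro exI[of _ R]) auto
qed auto

lemma occurs:
  assumes s: "s \<in> strings_ge k n w"
  shows "\<exists>r. occurs_at (cat A) s r"
proof -
  obtain R where R: "R \<le> n" "\<And>j. j < R \<Longrightarrow> s ! j = k" "R = n \<or> s ! R \<noteq> k"
    using run_length[OF s] by blast
  obtain i where i: "rotate i s \<in> set A" using min_rotation[OF s] by blast
  show ?thesis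
  proof (cases "1 \<le> R \<and> rotate R s = rotate i s")
    case True
    then show ?thesis using occurs_run[OF s R] i by auto
  next
    case False
    have ne: "rotate i s \<noteq> []" using strings_geD[OF s] by simp
    let ?d = "(length s - i mod length s) mod period (rotate i s)"
    have "s = rotate (length s - i mod length s) (rotate i s)" by (simp only: rotate_back)
    then have "s = rotate ?d (rotate i s)" using rotate_fixed_mod[OF period(2)[OF ne]] by metis
    moreover have "?d < period (rotate i s)" using period(1)[OF ne] by simp
    ultimately show ?thesis
      using rotation_cases[OF s R i] False occurs_within_below[OF i] by metis
  qed
qed

lemma cyclic_rank_eq:
  assumes "s \<in> strings_ge k n w" "occurs_at (cat A) s r"
  shows "cyclic_rank (ucycle_ge k n w) s = r"
  unfolding ucycle_ge_def
  using assms occurs strings_geD(1) length_cat_A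
  by (intro cyclic_rankI[of "strings_ge k n w" _ n]) auto

lemma rank_run:
  assumes "s \<in> strings_ge k n w" "R \<le> n" "\<And>j. j < R \<Longrightarrow> s ! j = k" "R = n \<or> s ! R \<noteq> k"
    and "1 \<le> R" "rotate R s \<in> set A"
  shows "cyclic_rank (ucycle_ge k n w) s =
    (if below (drop R s) = 0 then card (strings_ge k n w) - R else below (drop R s) - R) + 1"
  using cyclic_rank_eq[OF assms(1) occurs_run[OF assms]] .

lemma rank_no_run:
  assumes s: "s \<in> strings_ge k n w" and R: "R \<le> n" "\<And>j. j < R \<Longrightarrow> s ! j = k" "R = n \<or> s ! R \<noteq> k"
    and J: "1 \<le> J" "J \<le> n" "rotate J s \<in> set A"
      "\<And>j. J < j \<Longrightarrow> j \<le> n \<Longrightarrow> rotate j s \<noteq> rotate J s"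
    and not: "\<not> (1 \<le> R \<and> rotate R s = rotate J s)"
  shows "cyclic_rank (ucycle_ge k n w) s = below (rotate J s) + (n - J) + 1"
proof -
  have len: "length s = n" "s \<noteq> []" using strings_geD[OF s] by auto
  let ?y = "rotate J s"
  have y: "?y \<noteq> []" using len by simp
  note p = period[OF y]
  have s_eq: "s = rotate (n - J) ?y"
    using J(1,2) len by (simp add: rotate_rotate)
  have "n - J < period ?y"
  proof (rule ccontr)
    assume "\<not> n - J < period ?y"
    then have "J + period ?y \<le> n" using J by simp
    moreover have "rotate (J + period ?y) s = ?y"
      using p(2) by (simp add: rotate_rotate add.commute)
    ultimately show False using J(4)[of "J + period ?y"] p(1) by simp
  qed
  from rotation_cases[OF s R J(3) s_eq this not] obtain j where
    "n - J \<le> j" "j < period ?y" "?y ! j \<noteq> k" by blast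
  from occurs_within_below[OF J(3) this] s_eq have "occurs_at (cat A) s (below ?y + (n - J) + 1)"
    by simp
  then show ?thesis using cyclic_rank_eq[OF s] by blast
qed

lemma below_eq:
  assumes "m \<le> n" "u = map v [0..<m]"
  shows "below u = card (strings_ge k n w) -
    card {y \<in> strings_ge k n w. \<forall>i. not_below v m (cyc y) i}"
proof -
  have "take m (rotate i y) < u \<longleftrightarrow> \<not> not_below v m (cyc y) i" if "y \<in> strings_ge k n w" for i y
  proof -
    have len: "length y = n" using strings_geD[OF that] by simp
    have "take m (rotate i y) < u \<longleftrightarrow>
        (\<exists>q<m. (\<forall>j<q. cyc y (i + j) = v j) \<and> cyc y (i + q) < v q)"
      using assms len by (subst list_less_iff_nth) (auto simp: nth_rotate_cyc)
    then show ?thesis by (auto simp: not_below_def not_le)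
  qed
  moreover have "length u = m" using assms(2) by simp
  ultimately have "{y \<in> strings_ge k n w. \<exists>i. take (length u) (rotate i y) < u} =
      strings_ge k n w - {y \<in> strings_ge k n w. \<forall>i. not_below v m (cyc y) i}"
    by auto
  then show ?thesis unfolding below_def by (simp add: card_Diff_subset)
qed

end

subsection \<open>The counting program\<close>

definition frame :: "nat set \<Rightarrow> memory \<Rightarrow> memory \<Rightarrow> bool" where
  "frame X m m' \<longleftrightarrow> (\<forall>a. a \<notin> X \<longrightarrow> m' a = m a)"

lemma frameD: "frame X m m' \<Longrightarrow> a \<notin> X \<Longrightarrow> m' a = m a"
  by (simp add: frame_def)

lemma frame_refl [simp]: "frame X m m"
  by (simp add: frame_def)

lemma frame_trans: "frame X m m' \<Longrightarrow> frame Y m' m'' \<Longrightarrow> X \<union> Y \<subseteq> Z \<Longrightarrow> frame Z m m''"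
  unfolding frame_def by (metis UnCI subset_iff)

lemma frame_upd [simp]: "d \<in> X \<Longrightarrow> frame X m (m'(d := x)) \<longleftrightarrow> frame X m m'"
  by (auto simp: frame_def)

lemma frame_mono: "frame X m m' \<Longrightarrow> X \<subseteq> Y \<Longrightarrow> frame Y m m'"
  by (auto simp: frame_def)

lemma wp_Block_Seq:
  "length is = a \<Longrightarrow> blk_ok S is m \<Longrightarrow> wp S c T Q (blk is m) \<Longrightarrow> wp S (Block is ;; c) (a + T) Q m"
  by (rule wp_Seq[where Q' = "\<lambda>m'. m' = blk is m"]) (auto intro: wp_Block)

text \<open>Sums a table row over the last letters of a block: register 50 holds the weight of
  \<open>v 0 .. v l\<close>, register 51 the number of letters above \<open>v l\<close>, register 52
  the address of the row. All weight demands that are already met read column 0.\<close>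

definition inner_prog :: com where
  "inner_prog = Block [Const 53 0] ;; for_loop 54 51 55 (Block
     [Add 56 50 54, Add 56 56 4, Sub 56 42 56, Add 56 56 52, Load 56 56, Add 53 53 56])"

lemma wp_inner:
  assumes "m 4 = 1" "m 42 = b" "m 50 = y" "m 51 = N" "m 52 = row" "60 \<le> row" "row + b < S"
  shows "wp S inner_prog (10 * N + 4)
    (\<lambda>m'. frame {53..56} m m' \<and> m' 53 = (\<Sum>c<N. m (row + (b - (y + c + 1))))) m"
proof -
  let ?b = "[Add 56 50 54, Add 56 56 4, Sub 56 42 56, Add 56 56 52, Load 56 56, Add 53 53 56]"
  let ?J = "\<lambda>j m'. frame {53..56} m m' \<and> m' 53 = (\<Sum>c<j. m (row + (b - (y + c + 1))))"
  have "wp S (for_loop 54 51 55 (Block ?b))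
     (N * (6 + 4) + 3) (\<lambda>m'. m' 54 = N \<and> m' 51 = N \<and> m' 4 = 1 \<and> ?J N m') (m(53 := 0))"
  proof (rule wp_for_loop[where J = ?J])
    fix j m' assume j: "j < N" "m' 54 = j" "m' 51 = N" "m' 4 = 1" "?J j m'"
    have f: "m' a = m a" if "a \<notin> {53..56}" for a using j(5) that by (auto dest: frameD)
    have r: "m' 42 = b" "m' 50 = y" "m' 52 = row" using assms by (simp_all add: f)
    have "b - Suc (y + j) + row \<notin> {53..56}" using assms(6) by auto
    then have ld: "m' (b - Suc (y + j) + row) = m (row + (b - Suc (y + j)))"
      by (simp add: f add.commute)
    show "wp S (Block ?b)
        6 (\<lambda>m'. m' 54 = j \<and> m' 51 = N \<and> m' 4 = 1 \<and> ?J (Suc j) (m'(54 := Suc j, 55 := N - Suc j))) m'"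
    proof (rule wp_Block)
      show "blk_ok S ?b m'"
        using assms j r by auto
    qed (use j r ld assms(6) in auto)
  next
    show "?J 0 ((m(53 := 0))(54 := 0, 55 := N))" by simp
  qed (use assms in auto)
  note loop = this
  have "wp S inner_prog (1 + (N * (6 + 4) + 3))
      (\<lambda>m'. m' 54 = N \<and> m' 51 = N \<and> m' 4 = 1 \<and> ?J N m') m"
    unfolding inner_prog_def by (rule wp_Block_Seq) (use assms loop in auto)
  then show ?thesis by (rule wp_mono) auto
qed

text \<open>The contribution of the blocks of length \<open>l + 1\<close> to the table entry for length \<open>M\<close> and
  weight \<open>b\<close>.\<close>

definition entry :: "memory \<Rightarrow> nat \<Rightarrow> nat \<Rightarrow> nat \<Rightarrow> nat \<Rightarrow> nat \<Rightarrow> nat \<Rightarrow> nat \<Rightarrow> nat" where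
  "entry m va ta w1 k M b l = (\<Sum>c<k - m (va + l). m (ta + (M - 1 - l) * w1 +
     (b - ((\<Sum>i<Suc l. m (va + i)) + c + 1))))"

text \<open>Register 44 accumulates the table entry and register 45 the same terms with factors
  \<open>l + 1\<close>, so the count of cyclic words is available together with the last entry.
  Register 46 carries the weight of \<open>v 0 .. v (l - 1)\<close>.\<close>

definition row_prog :: com where
  "row_prog = for_loop 47 40 48 (Block
     [Add 49 5 47, Load 49 49, Add 50 46 49, Sub 51 9 49, Sub 52 40 4, Sub 52 52 47, Mul 52 52 7,
      Add 52 52 6] ;; inner_prog ;; Block
     [Add 44 44 53, Add 57 47 4, Mul 57 57 53, Add 45 45 57, Move 46 50])"

lemma wp_row:
  assumes regs: "m 4 = 1" "m 5 = va" "m 6 = ta" "m 7 = w1" "m 9 = k" "m 40 = M" "m 42 = b"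
    "m 44 = a0" "m 45 = 0" "m 46 = 0"
    and addr: "60 \<le> va" "va + M \<le> ta" "b < w1" "ta + M * w1 < S"
  shows "wp S row_prog (M * (10 * k + 21) + 3)
    (\<lambda>m'. frame {44..57} m m' \<and> m' 44 = a0 + (\<Sum>l<M. entry m va ta w1 k M b l) \<and>
       m' 45 = (\<Sum>l<M. Suc l * entry m va ta w1 k M b l)) m"
proof -
  let ?E = "entry m va ta w1 k M b"
  let ?J = "\<lambda>j m'. frame {44..57} m m' \<and> m' 44 = a0 + (\<Sum>l<j. ?E l) \<and>
       m' 45 = (\<Sum>l<j. Suc l * ?E l) \<and> m' 46 = (\<Sum>i<j. m (va + i))"
  have "wp S row_prog (M * ((10 * k + 17) + 4) + 3)
      (\<lambda>m'. m' 47 = M \<and> m' 40 = M \<and> m' 4 = 1 \<and> ?J M m') m"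
    unfolding row_prog_def
  proof (rule wp_for_loop[where J = ?J])
    fix j m' assume j: "j < M" "m' 47 = j" "m' 40 = M" "m' 4 = 1" "?J j m'"
    have f: "m' a = m a" if "a \<notin> {44..57}" for a using j(5) that by (auto dest: frameD)
    have r: "m' 5 = va" "m' 6 = ta" "m' 7 = w1" "m' 9 = k" "m' 42 = b" using regs by (simp_all add: f)
    have ld: "m' (va + j) = m (va + j)" using addr(1) by (intro f) auto
    let ?b1 = "[Add 49 5 47, Load 49 49, Add 50 46 49, Sub 51 9 49, Sub 52 40 4, Sub 52 52 47,
      Mul 52 52 7, Add 52 52 6]"
    let ?b2 = "[Add 44 44 53, Add 57 47 4, Mul 57 57 53, Add 45 45 57, Move 46 50]"
    let ?row = "(M - 1 - j) * w1 + ta"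
    let ?y = "\<Sum>i<Suc j. m (va + i)"
    let ?Q = "\<lambda>m'. m' 47 = j \<and> m' 40 = M \<and> m' 4 = 1 \<and>
        ?J (Suc j) (m'(47 := Suc j, 48 := M - Suc j))"
    define m1 where "m1 = blk ?b1 m'"
    have m1: "m1 4 = 1" "m1 42 = b" "m1 50 = ?y" "m1 51 = k - m (va + j)" "m1 52 = ?row"
      "m1 40 = M" "m1 47 = j" "m1 44 = m' 44" "m1 45 = m' 45"
      using j r ld addr(1) by (auto simp: m1_def)
    have fr1: "frame {49..52} m' m1"
      unfolding m1_def by auto
    have ok1: "blk_ok S ?b1 m'"
      using j r addr by auto
    have "(M - 1 - j + 1) * w1 \<le> M * w1" using j(1) by (intro mult_le_mono1) simp
    then have bound: "?row + b < S" using addr by (simp add: algebra_simps)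
    have row60: "60 \<le> ?row" using addr by simp
    have inner: "wp S inner_prog (10 * k + 4)
        (\<lambda>m2. frame {53..56} m1 m2 \<and> m2 53 = ?E j) m1"
    proof (rule wp_mono[OF wp_inner[OF m1(1-5) row60 bound]])
      fix m2 assume m2: "frame {53..56} m1 m2 \<and>
        m2 53 = (\<Sum>c<k - m (va + j). m1 (?row + (b - (?y + c + 1))))"
      have eq: "m1 (?row + x) = m (?row + x)" for x
      proof -
        have "m1 (?row + x) = m' (?row + x)" using fr1 row60 by (intro frameD[of "{49..52}"]) auto
        then show ?thesis using row60 by (simp add: f)
      qed
      have "(\<Sum>c<k - m (va + j). m1 (?row + (b - (?y + c + 1)))) = ?E j"
        by (simp only: eq) (simp add: entry_def add.commute)
      with m2 show "frame {53..56} m1 m2 \<and> m2 53 = ?E j" by simp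
    qed simp
    have rest: "wp S (Block ?b2) 5 ?Q m2"
      if m2: "frame {53..56} m1 m2 \<and> m2 53 = ?E j" for m2
    proof -
      have g: "m2 a = m1 a" if "a \<notin> {53..56}" for a using m2 that by (auto dest: frameD)
      have r2: "m2 4 = 1" "m2 50 = ?y" "m2 40 = M" "m2 47 = j" "m2 44 = m' 44" "m2 45 = m' 45" "m2 53 = ?E j"
        using m1 m2 by (simp_all add: g)
      have fr: "frame {44..57} m m2"
      proof (rule frame_trans)
        show "frame {44..57} m m1" using j(5) fr1 by (auto intro: frame_trans)
        show "frame {53..56} m1 m2" using m2 by simp
      qed auto
      show ?thesis
      proof (rule wp_Block)
        show "blk_ok S ?b2 m2" using addr by auto
        show "blk ?b2 m2 47 = j \<and> blk ?b2 m2 40 = M \<and> blk ?b2 m2 4 = 1 \<and>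
          ?J (Suc j) ((blk ?b2 m2)(47 := Suc j, 48 := M - Suc j))"
          using r2 fr j(5) by auto
      qed simp
    qed
    have "wp S (Block ?b1 ;; inner_prog ;; Block ?b2) (8 + ((10 * k + 4) + 5)) ?Q m'"
    proof (rule wp_Block_Seq[OF _ ok1])
      show "wp S (inner_prog ;; Block ?b2) ((10 * k + 4) + 5) ?Q (blk ?b1 m')"
        using wp_Seq[OF inner rest] unfolding m1_def .
    qed simp
    then show "wp S (Block ?b1 ;; inner_prog ;; Block ?b2) (10 * k + 17) ?Q m'"
      by (rule wp_mono) auto
  qed (use regs addr in auto)
  then show ?thesis by (rule wp_mono) (auto simp: algebra_simps)
qed

text \<open>Row by row, since an entry refers only to rows of smaller length.
  \<open>Sub 44 4 44\<close> produces the term \<open>1 - (M + b)\<close> of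
  \<open>cnt_rec\<close>.\<close>

definition table_prog :: com where
  "table_prog = for_loop 40 8 41 (for_loop 42 7 43 (Block
     [Add 44 40 42, Sub 44 4 44, Const 45 0, Const 46 0] ;; row_prog ;; Block
     [Mul 57 40 7, Add 57 57 42, Add 57 57 6, Store 57 44]))"

text \<open>The sum in \<open>card_cyclically_dominating\<close>, stated for all \<open>M\<close>
  and \<open>b\<close> because register 45 is recomputed at every table entry.\<close>

definition weighted :: "(nat \<Rightarrow> nat) \<Rightarrow> nat \<Rightarrow> nat \<Rightarrow> nat \<Rightarrow> nat" where
  "weighted v k M b =
     (\<Sum>l<M. Suc l * (\<Sum>c\<in>{v l<..k}. cnt v k (M - Suc l) (b - (sum v {..<l} + c))))"

definition filled :: "(nat \<Rightarrow> nat) \<Rightarrow> nat \<Rightarrow> nat \<Rightarrow> nat \<Rightarrow> nat \<Rightarrow> nat \<Rightarrow> memory \<Rightarrow> bool" where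
  "filled v k w ta M b m \<longleftrightarrow>
     (\<forall>i j. j \<le> w \<and> (i < M \<or> i = M \<and> j < b) \<longrightarrow> m (ta + (i * (w + 1) + j)) = cnt v k i j)"

lemma filledD:
  "filled v k w ta M b m \<Longrightarrow> j \<le> w \<Longrightarrow> i < M \<Longrightarrow> m (ta + (i * (w + 1) + j)) = cnt v k i j"
  by (simp add: filled_def)

lemma filled_cong:
  "filled v k w ta M b m \<Longrightarrow> (\<And>a. ta \<le> a \<Longrightarrow> m' a = m a) \<Longrightarrow> filled v k w ta M b m'"
  by (simp add: filled_def)

lemma filled_Suc_0: "filled v k w ta M (w + 1) m \<longleftrightarrow> filled v k w ta (Suc M) 0 m"
proof -
  have "j \<le> w \<and> (i < M \<or> i = M \<and> j < w + 1) \<longleftrightarrow> j \<le> w \<and> (i < Suc M \<or> i = Suc M \<and> j < 0)"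
    for i j by auto
  then show ?thesis unfolding filled_def by (simp only:)
qed

lemma index_inj:
  fixes i j M b d :: nat
  assumes "i * d + j = M * d + b" "j < d" "b < d"
  shows "i = M \<and> j = b"
proof -
  have "(i * d + j) div d = i" "(M * d + b) div d = M"
    using assms(2,3) by simp_all
  with assms(1) show ?thesis by simp
qed

lemma entry_eq:
  assumes "filled v k w ta M b m" "l < M" "b \<le> w" "\<And>i. i \<le> l \<Longrightarrow> m (va + i) = v i"
  shows "entry m va ta (w + 1) k M b l =
    (\<Sum>c\<in>{v l<..k}. cnt v k (M - Suc l) (b - (sum v {..<l} + c)))"
proof -
  have "(\<Sum>i<Suc l. m (va + i)) = sum v {..<l} + v l" using assms(4) by simp
  then have "entry m va ta (w + 1) k M b l =
      (\<Sum>c<k - v l. m (ta + ((M - Suc l) * (w + 1) + (b - (sum v {..<l} + v l + c + 1)))))"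
    using assms(4) by (simp add: entry_def add.assoc)
  also have "\<dots> = (\<Sum>c<k - v l. cnt v k (M - Suc l) (b - (sum v {..<l} + v l + c + 1)))"
    using assms(2,3) by (intro sum.cong refl filledD[OF assms(1)]) auto
  \<comment> \<open>The index \<open>c\<close> of the machine stands for the letter
    \<open>v l + c + 1\<close>.\<close>
  also have "\<dots> = (\<Sum>c\<in>{v l<..k}. cnt v k (M - Suc l) (b - (sum v {..<l} + c)))"
    by (rule sum.reindex_bij_witness[where i = "\<lambda>c. c - v l - 1" and j = "\<lambda>c. v l + c + 1"])
      (auto simp: add.assoc)
  finally show ?thesis .
qed

lemma wp_table:
  fixes m :: memory and va :: nat
  defines "v \<equiv> \<lambda>i. m (va + i)"
  assumes regs: "m 4 = 1" "m 5 = va" "m 6 = ta" "m 7 = w + 1" "m 8 = n + 1" "m 9 = k"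
    and pre: "prenecklace n v" and v: "\<And>j. j < n \<Longrightarrow> v j \<in> {1..k}"
    and addr: "60 \<le> va" "va + n \<le> ta" "ta + (n + 1) * (w + 1) \<le> S"
  shows "wp S table_prog ((n + 1) * ((w + 1) * (n * (10 * k + 21) + 15) + 7) + 3)
    (\<lambda>m'. frame ({40..57} \<union> {ta..}) m m' \<and> m' 45 = weighted v k n w) m"
proof -
  \<comment> \<open>Register 45 belongs to the entry computed last, which here is that of row
    \<open>M - 1\<close> and column \<open>w\<close>.\<close>
  let ?J = "\<lambda>M m'. frame ({40..57} \<union> {ta..}) m m' \<and> filled v k w ta M 0 m' \<and>
    (0 < M \<longrightarrow> m' 45 = weighted v k (M - 1) w)"
  have "wp S table_prog ((n + 1) * (((w + 1) * ((n * (10 * k + 21) + 11) + 4) + 3) + 4) + 3)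
    (\<lambda>m'. m' 40 = n + 1 \<and> m' 8 = n + 1 \<and> m' 4 = 1 \<and> ?J (n + 1) m') m"
    unfolding table_prog_def
  proof (rule wp_for_loop[where J = ?J])
    fix M m1 assume M: "M < n + 1" "m1 40 = M" "m1 8 = n + 1" "m1 4 = 1" "?J M m1"
    have f: "m1 a = m a" if "a \<notin> {40..57}" "a < ta" for a
      using M(5) that by (auto dest: frameD)
    have r: "m1 5 = va" "m1 6 = ta" "m1 7 = w + 1" "m1 9 = k"
      using regs addr by (simp_all add: f)
    have v1: "m1 (va + i) = v i" if "i < n" for i
      using that addr by (simp add: f v_def)
    let ?K = "\<lambda>b m'. frame ({42..57} \<union> {ta..}) m1 m' \<and> filled v k w ta M b m' \<and>
      (0 < b \<longrightarrow> m' 45 = weighted v k M (b - 1))"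
    let ?b1 = "[Add 44 40 42, Sub 44 4 44, Const 45 0, Const 46 0]"
    let ?b2 = "[Mul 57 40 7, Add 57 57 42, Add 57 57 6, Store 57 44]"
    have "wp S (for_loop 42 7 43 (Block ?b1 ;; row_prog ;; Block ?b2))
      ((w + 1) * ((n * (10 * k + 21) + 11) + 4) + 3)
      (\<lambda>m'. m' 42 = w + 1 \<and> m' 7 = w + 1 \<and> m' 4 = 1 \<and> ?K (w + 1) m') m1"
    proof (rule wp_for_loop[where J = ?K])
      fix b m2 assume b: "b < w + 1" "m2 42 = b" "m2 7 = w + 1" "m2 4 = 1" "?K b m2"
      have g: "m2 a = m1 a" if "a \<notin> {42..57}" "a < ta" for a
        using b(5) that by (auto dest: frameD)
      have r2: "m2 5 = va" "m2 6 = ta" "m2 9 = k" "m2 40 = M"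
        using M(2) r addr by (simp_all add: g)
      let ?Q = "\<lambda>m'. m' 42 = b \<and> m' 7 = w + 1 \<and> m' 4 = 1 \<and>
          ?K (Suc b) (m'(42 := Suc b, 43 := w + 1 - Suc b))"
      define m3 where "m3 = blk ?b1 m2"
      have m3: "m3 4 = 1" "m3 5 = va" "m3 6 = ta" "m3 7 = w + 1" "m3 9 = k" "m3 40 = M" "m3 42 = b"
        "m3 44 = 1 - (M + b)" "m3 45 = 0" "m3 46 = 0"
        using b r2 by (simp_all add: m3_def)
      have h: "m3 a = m2 a" if "a \<notin> {44..46}" for a
        using that by (auto simp: m3_def)
      have filled3: "filled v k w ta M b m3"
        using b(5) addr by (auto intro!: filled_cong[of v k w ta M b m2] h)
      have v3: "m3 (va + i) = v i" if "i < n" for i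
        using that addr by (simp add: h g v1)
      have e: "entry m3 va ta (w + 1) k M b l =
          (\<Sum>c\<in>{v l<..k}. cnt v k (M - Suc l) (b - (sum v {..<l} + c)))" if "l < M" for l
        using that M(1) b(1) by (intro entry_eq[OF filled3] v3) auto
      have len: "ta + M * (w + 1) + w < S"
      proof -
        have "(M + 1) * (w + 1) \<le> (n + 1) * (w + 1)" using M(1) by (intro mult_le_mono1) simp
        then show ?thesis using addr(3) by (simp add: algebra_simps)
      qed
      have row: "wp S row_prog (n * (10 * k + 21) + 3)
        (\<lambda>m'. frame {44..57} m3 m' \<and> m' 44 = cnt v k M b \<and> m' 45 = weighted v k M b) m3"
      proof (rule wp_mono[OF wp_row[OF m3]])
        show "60 \<le> va" "va + M \<le> ta" "b < w + 1" "ta + M * (w + 1) < S"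
          using addr M(1) b(1) len by auto
        show "M * (10 * k + 21) + 3 \<le> n * (10 * k + 21) + 3"
          using M(1) by (intro add_mono mult_le_mono1) auto
      next
        fix m' assume m': "frame {44..57} m3 m' \<and>
          m' 44 = 1 - (M + b) + (\<Sum>l<M. entry m3 va ta (w + 1) k M b l) \<and>
          m' 45 = (\<Sum>l<M. Suc l * entry m3 va ta (w + 1) k M b l)"
        have "M \<le> n" using M(1) by simp
        have "(\<Sum>l<M. entry m3 va ta (w + 1) k M b l) =
            (\<Sum>l<M. \<Sum>c\<in>{v l<..k}. cnt v k (M - Suc l) (b - (sum v {..<l} + c)))"
          by (rule sum.cong[OF refl e]) simp
        moreover have "(\<Sum>l<M. Suc l * entry m3 va ta (w + 1) k M b l) = weighted v k M b"
          unfolding weighted_def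
          by (rule sum.cong[OF refl], subst e) simp_all
        ultimately show "frame {44..57} m3 m' \<and> m' 44 = cnt v k M b \<and> m' 45 = weighted v k M b"
          using m' cnt_rec[OF pre v \<open>M \<le> n\<close>, of b] by simp
      qed
      have rest: "wp S (Block ?b2) 4 ?Q m4"
        if m4: "frame {44..57} m3 m4 \<and> m4 44 = cnt v k M b \<and> m4 45 = weighted v k M b" for m4
      proof -
        have i: "m4 a = m3 a" if "a \<notin> {44..57}" for a using m4 that by (auto dest: frameD)
        have r4: "m4 40 = M" "m4 7 = w + 1" "m4 42 = b" "m4 6 = ta" "m4 4 = 1"
          using m3 by (simp_all add: i)
        have fr: "frame ({42..57} \<union> {ta..}) m1 m4"
        proof (rule frame_trans[OF _ conjunct1[OF m4]])
          show "frame ({42..57} \<union> {ta..}) m1 m3"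
            using b(5) by (simp add: m3_def)
        qed auto
        have fill: "filled v k w ta M b m4"
          using filled3 addr by (auto intro!: filled_cong[of v k w ta M b m3] i)
        let ?p = "M * (w + 1) + b"
        define m5 where "m5 = blk ?b2 m4"
        have m5: "m5 = m4(57 := ?p + ta, ta + ?p := cnt v k M b)"
          using r4 m4 by (simp add: m5_def add.commute)
        have "filled v k w ta M (Suc b) m5"
          unfolding filled_def
        proof (intro allI impI)
          fix i j assume ij: "j \<le> w \<and> (i < M \<or> i = M \<and> j < Suc b)"
          show "m5 (ta + (i * (w + 1) + j)) = cnt v k i j"
          proof (cases "i = M \<and> j = b")
            case False
            then have "i * (w + 1) + j \<noteq> ?p" using index_inj[of i "w + 1" j M b] ij b(1) by auto
            moreover have "m4 (ta + (i * (w + 1) + j)) = cnt v k i j"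
              using fill ij False unfolding filled_def by auto
            moreover have "ta + (i * (w + 1) + j) \<noteq> 57" using addr by simp
            ultimately show ?thesis by (simp add: m5 del: add_Suc_right mult_Suc_right)
          qed (simp add: m5)
        qed
        then have fill5: "filled v k w ta M (Suc b) (m5(42 := Suc b, 43 := w + 1 - Suc b))"
          using addr by (auto intro: filled_cong)
        have fr5: "frame ({42..57} \<union> {ta..}) m1 m5" using fr by (simp add: m5)
        show ?thesis
        proof (rule wp_Block)
          show "blk_ok S ?b2 m4" using r4 addr len b(1) by auto
          have ne: "ta + ?p \<notin> {4, 7, 42, 45}" using addr by simp
          have "m5 45 = weighted v k M b" "m5 4 = 1" "m5 7 = w + 1" "m5 42 = b"
            using ne m4 r4 unfolding m5 by auto
          then show "blk ?b2 m4 42 = b \<and> blk ?b2 m4 7 = w + 1 \<and> blk ?b2 m4 4 = 1 \<and>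
              ?K (Suc b) ((blk ?b2 m4)(42 := Suc b, 43 := w + 1 - Suc b))"
            unfolding m5_def[symmetric] using fill5 fr5 by simp
        qed simp
      qed
      have "wp S (Block ?b1 ;; row_prog ;; Block ?b2) (4 + ((n * (10 * k + 21) + 3) + 4))
          ?Q m2"
      proof (rule wp_Block_Seq)
        show "wp S (row_prog ;; Block ?b2) ((n * (10 * k + 21) + 3) + 4)
          ?Q (blk ?b1 m2)"
          using wp_Seq[OF row rest] unfolding m3_def .
      qed (use addr in auto)
      then show "wp S (Block ?b1 ;; row_prog ;; Block ?b2) (n * (10 * k + 21) + 11)
          ?Q m2"
        by (rule wp_mono) auto
    next
      show "?K 0 (m1(42 := 0, 43 := w + 1))"
        using M(5) addr by (auto intro: filled_cong)
    qed (use M r addr in auto)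
    then show "wp S (for_loop 42 7 43 (Block ?b1 ;; row_prog ;; Block ?b2))
      ((w + 1) * ((n * (10 * k + 21) + 11) + 4) + 3)
      (\<lambda>m'. m' 40 = M \<and> m' 8 = n + 1 \<and> m' 4 = 1 \<and>
        ?J (Suc M) (m'(40 := Suc M, 41 := n + 1 - Suc M))) m1"
    proof (rule wp_mono)
      fix m' assume m': "m' 42 = w + 1 \<and> m' 7 = w + 1 \<and> m' 4 = 1 \<and> ?K (w + 1) m'"
      have g: "m' a = m1 a" if "a \<notin> {42..57}" "a < ta" for a
        using m' that by (auto dest: frameD)
      have "frame ({40..57} \<union> {ta..}) m m'"
        using m' M(5) by (auto intro: frame_trans)
      moreover have "m' 40 = M" "m' 8 = n + 1" using M addr by (simp_all add: g)
      moreover have "filled v k w ta (Suc M) 0 m'" using m' filled_Suc_0 by blast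
      then have "filled v k w ta (Suc M) 0 (m'(40 := Suc M, 41 := n + 1 - Suc M))"
        using addr by (auto intro: filled_cong)
      ultimately show "m' 40 = M \<and> m' 8 = n + 1 \<and> m' 4 = 1 \<and>
        ?J (Suc M) (m'(40 := Suc M, 41 := n + 1 - Suc M))"
        using m' by simp
    qed simp
  next
    show "?J 0 (m(40 := 0, 41 := n + 1))" by (simp add: filled_def)
  qed (use regs addr in auto)
  then show ?thesis by (rule wp_mono) (auto simp: algebra_simps)
qed

section \<open>Extending the given prefix by its least period\<close>

lemma prenecklace_cong:
  assumes "\<And>i. i < m \<Longrightarrow> v i = u i"
  shows "prenecklace m v \<longleftrightarrow> prenecklace m u"
  unfolding prenecklace_def
  by (intro all_cong1 imp_cong refl) (simp_all add: assms)

lemma not_below_cong: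
  assumes "\<And>i. i < m \<Longrightarrow> v i = u i"
  shows "not_below v m x i \<longleftrightarrow> not_below u m x i"
  unfolding not_below_def
  by (intro all_cong1 imp_cong refl) (simp_all add: assms)

lemma min_period_cong:
  assumes "\<And>i. i < m \<Longrightarrow> v i = u i"
  shows "min_period v m p \<longleftrightarrow> min_period u m p"
proof -
  have "v i = v (i - a) \<longleftrightarrow> u i = u (i - a)" if "i < m" for i a
    using assms[of i] assms[of "i - a"] that by simp
  then show ?thesis unfolding min_period_def by meson
qed

lemma prenecklace_mono: "prenecklace n v \<Longrightarrow> m \<le> n \<Longrightarrow> prenecklace m v"
  by (simp add: prenecklace_def)

text \<open>Letters of the given prefix are only inspected: one that continues the period keeps it,
  any other makes the whole word its own period. Behind the prefix, letters are written so as to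
  continue the period. The first letter always counts as given, so an empty prefix has to be
  supplied as one letter. Registers 32 and 33 form an absolute difference, as one truncated
  subtraction cannot test equality.\<close>

definition extend_prog :: com where
  "extend_prog = Block [Const 24 1, Sub 25 0 4] ;; for_loop 26 25 27
     (Block [Add 28 5 26, Add 28 28 4, Sub 29 28 24, Load 29 29, Add 30 26 4, Sub 30 22 30] ;;
      Cond 30
        (Block [Load 31 28, Sub 32 31 29, Sub 33 29 31, Add 32 32 33] ;;
         Cond 32 (Block [Add 24 26 4, Add 24 24 4]) (Block []))
        (Block [Store 28 29]))"

text \<open>As \<open>v\<close> starts with \<open>u\<close>, the converse of the implication
  between the \<open>not_below\<close> conditions is immediate once c >= L. The last clause keeps
  the new letters among those of \<open>u\<close>, hence between 1 and \<open>k\<close>.\<close>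

definition extension :: "(nat \<Rightarrow> nat) \<Rightarrow> nat \<Rightarrow> (nat \<Rightarrow> nat) \<Rightarrow> nat \<Rightarrow> nat \<Rightarrow> bool" where
  "extension u L v c p \<longleftrightarrow> (\<forall>i<L. v i = u i) \<and> prenecklace c v \<and> min_period v c p \<and>
     (\<forall>x. (\<forall>i. not_below u L x i) \<longrightarrow> (\<forall>i. not_below v c x i)) \<and> (\<forall>i<c. v i \<in> u ` {..<L})"

lemma extension_1: "1 \<le> L \<Longrightarrow> extension u L u 1 1"
  unfolding extension_def
  using prenecklace_1 min_period_1 not_below_mono by fastforce

lemma extension_given:
  assumes ext: "extension u L v c p" and c: "c < L" and u: "prenecklace L u"
  shows "extension u L v (Suc c) (if v c = v (c - p) then p else Suc c)"
proof -
  have vu: "v i = u i" if "i < L" for i using ext that by (simp add: extension_def)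
  have pre: "prenecklace (Suc c) v"
    using prenecklace_mono[OF u, of "Suc c"] prenecklace_cong[of "Suc c" v u] vu c by simp
  have "min_period v (Suc c) (if v c = v (c - p) then p else Suc c)"
    using extend_periodic(2)[of c v p] extend_aperiodic[OF pre, of p] ext
    by (simp add: extension_def)
  moreover have "not_below v (Suc c) x i" if "\<forall>i. not_below u L x i" for x i
    using not_below_mono[of u L x i "Suc c"] not_below_cong[of "Suc c" v u x i] vu c that by simp
  moreover have "v i \<in> u ` {..<L}" if "i < Suc c" for i
    using vu[of i] that c by auto
  ultimately show ?thesis using pre vu by (simp add: extension_def)
qed

lemma extension_new:
  assumes ext: "extension u L v c p" and c: "L \<le> c"
    and v': "\<And>i. i < c \<Longrightarrow> v' i = v i" "v' c = v (c - p)"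
  shows "extension u L v' (Suc c) p"
proof -
  have p: "1 \<le> p" "p \<le> c" using ext by (auto simp: extension_def min_period_def)
  have pre: "prenecklace c v'" and per: "min_period v' c p"
    using ext prenecklace_cong[of c v' v] min_period_cong[of c v' v] v'(1)
    by (auto simp: extension_def)
  have eq: "v' c = v' (c - p)" using v' p by simp
  note e = extend_periodic[OF pre per eq]
  have "not_below v' (Suc c) x i" if "\<forall>i. not_below u L x i" for x i
  proof (rule not_below_extend[OF per eq])
    show "not_below v' c x i" for i
      using ext that not_below_cong[of c v' v x i] v'(1) by (simp add: extension_def)
  qed
  moreover have "v' i \<in> u ` {..<L}" if "i < Suc c" for i
  proof (cases "i < c")
    case True
    then show ?thesis using ext v'(1) by (simp add: extension_def)
  next
    case False
    then have "v' i = v (c - p)" using that v'(2) by (simp add: less_Suc_eq)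
    then show ?thesis using ext p by (simp add: extension_def)
  qed
  moreover have "v' i = u i" if "i < L" for i
    using ext v'(1)[of i] that c by (simp add: extension_def)
  ultimately show ?thesis using e by (simp add: extension_def)
qed

lemma wp_extend:
  fixes m :: memory and va :: nat
  defines "u \<equiv> \<lambda>i. m (va + i)"
  assumes regs: "m 0 = n" "m 4 = 1" "m 5 = va"
    and L: "L = max 1 (m 22)" "L \<le> n" and u: "prenecklace L u"
    and addr: "60 \<le> va" "va + n \<le> S" "60 \<le> S"
  shows "wp S extend_prog (20 * n + 5)
    (\<lambda>m'. frame ({24..33} \<union> {va..<va + n}) m m' \<and> extension u L (\<lambda>i. m' (va + i)) n (m' 24)) m"
proof -
  let ?J = "\<lambda>j m'. frame ({24..33} \<union> {va..<va + n}) m m' \<and>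
    extension u L (\<lambda>i. m' (va + i)) (Suc j) (m' 24)"
  let ?b1 = "[Add 28 5 26, Add 28 28 4, Sub 29 28 24, Load 29 29, Add 30 26 4, Sub 30 22 30]"
  let ?b2 = "[Load 31 28, Sub 32 31 29, Sub 33 29 31, Add 32 32 33]"
  let ?c = "Block ?b1 ;; Cond 30 (Block ?b2 ;; Cond 32 (Block [Add 24 26 4, Add 24 24 4]) (Block []))
    (Block [Store 28 29])"
  have n: "1 \<le> n" using L by simp
  define m0 where "m0 = m(24 := 1, 25 := n - 1)"
  have loop: "wp S (for_loop 26 25 27 ?c) ((n - 1) * (16 + 4) + 3)
    (\<lambda>m'. m' 26 = n - 1 \<and> m' 25 = n - 1 \<and> m' 4 = 1 \<and> ?J (n - 1) m') m0"
  proof (rule wp_for_loop[where J = ?J])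
    fix j m1 assume j: "j < n - 1" "m1 26 = j" "m1 25 = n - 1" "m1 4 = 1" "?J j m1"
    have f: "m1 a = m a" if "a \<notin> {24..33}" "a < va" for a
      using j(5) that by (auto dest: frameD)
    have r: "m1 5 = va" "m1 22 = m 22" using regs addr by (simp_all add: f)
    define v p where "v = (\<lambda>i. m1 (va + i))" and "p = m1 24"
    have ext: "extension u L v (Suc j) p" using j(5) by (simp add: v_def p_def)
    then have p: "1 \<le> p" "p \<le> Suc j" by (auto simp: extension_def min_period_def)
    define m2 where "m2 = blk ?b1 m1"
    define a where "a = va + (Suc j - p)"
    have a: "Suc (va + j) - p = a" "a \<noteq> 28" "a \<noteq> 29" "m1 a = v (Suc j - p)"
      using p addr by (auto simp: a_def v_def)
    have m2: "m2 = m1(28 := va + j + 1, 29 := v (Suc j - p), 30 := m 22 - Suc j)"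
      using j(2-4) r p_def[symmetric] a by (simp add: m2_def)
    have m2a: "m2 (va + i) = v i" for i using addr by (simp add: m2 v_def)
    have fr2: "frame ({24..33} \<union> {va..<va + n}) m m2" using j(5) by (simp add: m2)
    let ?Q = "\<lambda>m'. m' 26 = j \<and> m' 25 = n - 1 \<and> m' 4 = 1 \<and>
      ?J (Suc j) (m'(26 := Suc j, 27 := n - 1 - Suc j))"
    have Q: "?Q m'" if "frame ({24..33} \<union> {va..<va + n}) m m'" "m' 26 = j" "m' 25 = n - 1" "m' 4 = 1"
      "extension u L (\<lambda>i. m' (va + i)) (Suc (Suc j)) (m' 24)" for m'
    proof -
      have "(\<lambda>i. (m'(26 := Suc j, 27 := n - 1 - Suc j)) (va + i)) = (\<lambda>i. m' (va + i))"
        using addr by (simp add: fun_eq_iff)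
      then show ?thesis using that by simp
    qed
    have "wp S (Cond 30 (Block ?b2 ;; Cond 32 (Block [Add 24 26 4, Add 24 24 4]) (Block []))
      (Block [Store 28 29])) (8 + 2) ?Q m2"
    proof (rule wp_Cond)
      assume "m2 30 \<noteq> 0"
      then have cL: "Suc j < L" by (simp add: m2 L)
      define m3 where "m3 = blk ?b2 m2"
      have m3: "m3 32 = (v (Suc j) - v (Suc j - p)) + (v (Suc j - p) - v (Suc j))"
        "m3 24 = p" "m3 26 = j" "m3 25 = n - 1" "m3 4 = 1"
        using j m2a[of "Suc j"] addr by (simp_all add: m3_def m2 p_def)
      have m3a: "m3 (va + i) = v i" for i using addr m2a by (simp add: m3_def)
      have fr3: "frame ({24..33} \<union> {va..<va + n}) m m3" using fr2 by (simp add: m3_def)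
      note step = extension_given[OF ext cL u]
      have "wp S (Cond 32 (Block [Add 24 26 4, Add 24 24 4]) (Block [])) (2 + 2) ?Q m3"
      proof (rule wp_Cond)
        assume nz: "m3 32 \<noteq> 0"
        show "wp S (Block [Add 24 26 4, Add 24 24 4]) 2 ?Q m3"
        proof (rule wp_Block)
          let ?m4 = "m3(24 := Suc (Suc j))"
          have blk: "blk [Add 24 26 4, Add 24 24 4] m3 = ?m4" using m3 by simp
          have v4: "(\<lambda>i. ?m4 (va + i)) = v"
            using addr m3a by (simp add: fun_eq_iff)
          have "v (Suc j) \<noteq> v (Suc j - p)" using nz m3(1) by auto
          then have "extension u L v (Suc (Suc j)) (Suc (Suc j))" using step by simp
          then have "extension u L (\<lambda>i. ?m4 (va + i)) (Suc (Suc j)) (?m4 24)"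
            unfolding v4 by simp
          then show "?Q (blk [Add 24 26 4, Add 24 24 4] m3)"
            unfolding blk using m3(3-5) fr3 by (intro Q[of ?m4]) simp_all
        qed (use addr in auto)
      next
        assume z: "m3 32 = 0"
        show "wp S (Block []) 2 ?Q m3"
        proof (rule wp_Block)
          have v3: "(\<lambda>i. m3 (va + i)) = v" using m3a by (simp add: fun_eq_iff)
          have "v (Suc j) = v (Suc j - p)" using z m3(1) by simp
          then have "extension u L v (Suc (Suc j)) p" using step by simp
          then have "extension u L (\<lambda>i. m3 (va + i)) (Suc (Suc j)) (m3 24)"
            unfolding v3 m3(2) .
          then show "?Q (blk [] m3)"
            unfolding blk.simps using m3(3-5) fr3 by (intro Q)
        qed auto
      qed (use addr in auto)
      then have "wp S (Block ?b2 ;; Cond 32 (Block [Add 24 26 4, Add 24 24 4]) (Block [])) (4 + (2 + 2)) ?Q m2"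
        unfolding m3_def
        by (rule wp_Block_Seq[rotated 2]) (use addr j(1) in \<open>auto simp: m2\<close>)
      then show "wp S (Block ?b2 ;; Cond 32 (Block [Add 24 26 4, Add 24 24 4]) (Block [])) 8 ?Q m2"
        by simp
    next
      assume "m2 30 = 0"
      then have cL: "L \<le> Suc j" by (simp add: m2 L)
      have b: "blk [Store 28 29] m2 = m2(va + Suc j := v (Suc j - p))" by (simp add: m2)
      show "wp S (Block [Store 28 29]) 8 ?Q m2"
      proof (rule wp_Block)
        let ?m4 = "m2(va + Suc j := v (Suc j - p))"
        have "extension u L (\<lambda>i. ?m4 (va + i)) (Suc (Suc j)) p"
          by (rule extension_new[OF ext cL]) (auto simp: m2a)
        moreover have m4: "?m4 24 = p" "?m4 26 = j" "?m4 25 = n - 1" "?m4 4 = 1"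
          using addr j(2-4) by (simp_all add: m2 p_def)
        moreover have "frame ({24..33} \<union> {va..<va + n}) m ?m4"
        proof -
          have "va + Suc j \<in> {24..33} \<union> {va..<va + n}" using j(1) by auto
          from frame_upd[OF this] fr2 show ?thesis by blast
        qed
        ultimately show "?Q (blk [Store 28 29] m2)"
          unfolding b by (intro Q[of ?m4]) (simp_all only: m4)
      qed (use addr j(1) in \<open>auto simp: m2\<close>)
    qed (use addr in auto)
    then have "wp S ?c (6 + (8 + 2)) ?Q m1"
      unfolding m2_def
      by (rule wp_Block_Seq[rotated 2]) (use addr j r p in \<open>auto simp: p_def\<close>)
    then show "wp S ?c 16 ?Q m1" by simp
  next
    have "(\<lambda>i. (m0(26 := 0, 27 := n - 1)) (va + i)) = u"
      using addr by (auto simp: u_def m0_def)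
    then show "?J 0 (m0(26 := 0, 27 := n - 1))"
      using extension_1[of L u] L by (simp add: m0_def)
  qed (use regs addr in \<open>auto simp: m0_def\<close>)
  have "wp S extend_prog (2 + ((n - 1) * (16 + 4) + 3))
    (\<lambda>m'. m' 26 = n - 1 \<and> m' 25 = n - 1 \<and> m' 4 = 1 \<and> ?J (n - 1) m') m"
    unfolding extend_prog_def
    by (rule wp_Block_Seq) (use regs addr loop in \<open>auto simp: m0_def\<close>)
  then show ?thesis by (rule wp_mono) (use n in auto)
qed

text \<open>The machine has no division: the remainder is a counter reset on reaching the period.
  The same pass adds up the weight of the extended word.\<close>

definition mod_prog :: com where
  "mod_prog = Block [Const 34 0, Const 35 0] ;; for_loop 36 0 37
     (Block [Add 34 34 4, Sub 38 24 34] ;; Cond 38 (Block []) (Block [Const 34 0]) ;;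
      Block [Add 38 5 36, Load 38 38, Add 35 35 38])"

lemma wp_mod:
  fixes m :: memory and va :: nat
  assumes regs: "m 0 = n" "m 4 = 1" "m 5 = va" "m 24 = p" "1 \<le> p"
    and addr: "60 \<le> va" "va + n \<le> S" "60 \<le> S"
  shows "wp S mod_prog (12 * n + 5)
    (\<lambda>m'. frame {34..38} m m' \<and> m' 34 = n mod p \<and> m' 35 = (\<Sum>i<n. m (va + i))) m"
proof -
  let ?J = "\<lambda>j m'. frame {34..38} m m' \<and> m' 34 = j mod p \<and> m' 35 = (\<Sum>i<j. m (va + i))"
  let ?b1 = "[Add 34 34 4, Sub 38 24 34]" and ?b2 = "[Add 38 5 36, Load 38 38, Add 35 35 38]"
  let ?if = "Cond 38 (Block []) (Block [Const 34 0])"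
  define m0 where "m0 = m(34 := 0, 35 := 0)"
  have loop: "wp S (for_loop 36 0 37 (Block ?b1 ;; ?if ;; Block ?b2)) (n * (8 + 4) + 3)
    (\<lambda>m'. m' 36 = n \<and> m' 0 = n \<and> m' 4 = 1 \<and> ?J n m') m0"
  proof (rule wp_for_loop[where J = ?J])
    fix j m1 assume j: "j < n" "m1 36 = j" "m1 0 = n" "m1 4 = 1" "?J j m1"
    have f: "m1 a = m a" if "a \<notin> {34..38}" for a using j(5) that by (auto dest: frameD)
    have r: "m1 5 = va" "m1 24 = p" using regs by (simp_all add: f)
    define m2 where "m2 = blk ?b1 m1"
    define q where "q = j mod p"
    have q: "q < p" "Suc j mod p = (if Suc q = p then 0 else Suc q)"
      using regs by (simp_all add: q_def mod_Suc)
    have m2: "m2 = m1(34 := Suc q, 38 := p - Suc q)"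
      using j r by (simp add: m2_def q_def)
    let ?Q = "\<lambda>m'. m' 36 = j \<and> m' 0 = n \<and> m' 4 = 1 \<and>
      ?J (Suc j) (m'(36 := Suc j, 37 := n - Suc j))"
    have if_ok: "wp S ?if (1 + 2) (\<lambda>m'. frame {34..38} m m' \<and> m' 34 = Suc j mod p \<and>
        m' 35 = m1 35 \<and> m' 36 = j) m2"
    proof (rule wp_Cond)
      show "wp S (Block []) 1 (\<lambda>m'. frame {34..38} m m' \<and> m' 34 = Suc j mod p \<and>
          m' 35 = m1 35 \<and> m' 36 = j) m2" if "m2 38 \<noteq> 0"
        using that j(2,5) q by (intro wp_Block) (simp_all add: m2)
      show "wp S (Block [Const 34 0]) 1 (\<lambda>m'. frame {34..38} m m' \<and> m' 34 = Suc j mod p \<and>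
          m' 35 = m1 35 \<and> m' 36 = j) m2" if "m2 38 = 0"
        using that j(2,5) q addr by (intro wp_Block) (simp_all add: m2)
    qed (use addr in auto)
    have rest: "wp S (Block ?b2) 3 ?Q m3" if m3: "frame {34..38} m m3 \<and> m3 34 = Suc j mod p \<and>
        m3 35 = m1 35 \<and> m3 36 = j" for m3
    proof (rule wp_Block)
      have g: "m3 a = m a" if "a \<notin> {34..38}" for a using m3 that by (auto dest: frameD)
      have "m3 5 = va" "m3 4 = 1" "m3 0 = n" using regs by (simp_all add: g)
      moreover have "m3 (va + j) = m (va + j)" using addr by (intro g) auto
      ultimately show "?Q (blk ?b2 m3)" using m3 j addr by (auto simp: add.commute)
      show "blk_ok S ?b2 m3" using m3 addr j(1) \<open>m3 5 = va\<close> by auto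
    qed simp
    have "wp S (Block ?b1 ;; ?if ;; Block ?b2) (2 + ((1 + 2) + 3)) ?Q m1"
    proof (rule wp_Block_Seq)
      show "wp S (?if ;; Block ?b2) ((1 + 2) + 3) ?Q (blk ?b1 m1)"
        using wp_Seq[OF if_ok rest] unfolding m2_def .
    qed (use addr in auto)
    then show "wp S (Block ?b1 ;; ?if ;; Block ?b2) 8 ?Q m1" by simp
  next
    show "?J 0 (m0(36 := 0, 37 := n))" using regs by (simp add: m0_def)
  qed (use regs addr in \<open>auto simp: m0_def\<close>)
  have "wp S mod_prog (2 + (n * (8 + 4) + 3))
    (\<lambda>m'. m' 36 = n \<and> m' 0 = n \<and> m' 4 = 1 \<and> ?J n m') m"
    unfolding mod_prog_def by (rule wp_Block_Seq) (use addr loop in \<open>auto simp: m0_def\<close>)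
  then show ?thesis by (rule wp_mono) auto
qed

text \<open>The rotations of the extended word, as many as its period, are added only if the
  remainder in register 34 is 0 and the word is heavy enough, which register 38 tests.\<close>

definition count_prog :: com where
  "count_prog = extend_prog ;; mod_prog ;; table_prog ;;
     Cond 34 (Block []) (Block [Sub 38 2 35] ;; Cond 38 (Block []) (Block [Add 45 45 24]))"

definition count_time :: "nat \<Rightarrow> nat \<Rightarrow> nat \<Rightarrow> nat" where
  "count_time n k w = 32 * n + 20 + (n + 1) * ((w + 1) * (n * (10 * k + 21) + 15) + 7)"

lemma wp_count:
  fixes m :: memory and va :: nat
  defines "u \<equiv> \<lambda>i. m (va + i)"
  assumes regs: "m 0 = n" "m 2 = w" "m 4 = 1" "m 5 = va" "m 6 = ta" "m 7 = w + 1" "m 8 = n + 1" "m 9 = k"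
    and L: "L = max 1 (m 22)" "L \<le> n" and u: "prenecklace L u" "\<And>j. j < L \<Longrightarrow> u j \<in> {1..k}"
    and addr: "60 \<le> va" "va + n \<le> ta" "ta + (n + 1) * (w + 1) \<le> S"
  shows "wp S count_prog (count_time n k w)
    (\<lambda>m'. frame ({24..57} \<union> {va..}) m m' \<and>
       m' 45 = card {y \<in> strings_ge k n w. \<forall>i. not_below u L (cyc y) i}) m"
proof -
  let ?fin = "Cond 34 (Block []) (Block [Sub 38 2 35] ;; Cond 38 (Block []) (Block [Add 45 45 24]))"
  let ?C = "card {y \<in> strings_ge k n w. \<forall>i. not_below u L (cyc y) i}"
  let ?T = "(n + 1) * ((w + 1) * (n * (10 * k + 21) + 15) + 7) + 3"
  let ?Q = "\<lambda>m'. frame ({24..57} \<union> {va..}) m m' \<and> m' 45 = ?C"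
  have S: "60 \<le> S" "va + n \<le> S" "58 < S" using addr by auto
  have rest: "wp S (mod_prog ;; table_prog ;; ?fin)
      ((12 * n + 5) + ((?T) + ((1 + (1 + 2)) + 2)))
      ?Q m1"
    if m1: "frame ({24..33} \<union> {va..<va + n}) m m1 \<and> extension u L (\<lambda>i. m1 (va + i)) n (m1 24)" for m1
  proof -
    define v p where "v = (\<lambda>i. m1 (va + i))" and "p = m1 24"
    have ext: "extension u L v n p" using m1 by (simp add: v_def p_def)
    then have pre: "prenecklace n v" and per: "min_period v n p" by (auto simp: extension_def)
    have vk: "v j \<in> {1..k}" if "j < n" for j
    proof -
      have "v j \<in> u ` {..<L}" using ext that by (simp add: extension_def)
      then show ?thesis using u(2) by auto
    qed
    have C: "?C = weighted v k n w + (if p dvd n \<and> w \<le> sum v {..<n} then p else 0)"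
    proof -
      \<comment> \<open>One direction is part of \<open>extension\<close>; for the other, compare
        only the first \<open>L\<close> letters, where \<open>v\<close> and \<open>u\<close>
        agree.\<close>
      have "(\<forall>i. not_below u L x i) \<longleftrightarrow> (\<forall>i. not_below v n x i)" for x
        using ext not_below_mono[of v n x _ L] not_below_cong[of L v u x] L(2)
        unfolding extension_def by blast
      then show ?thesis using card_not_below[OF pre per vk, of w] by (simp add: weighted_def)
    qed
    have p: "1 \<le> p" using per by (simp add: min_period_def)
    have f: "m1 a = m a" if "a \<notin> {24..33}" "a < va" for a
      using m1 that by (auto dest: frameD)
    have r1: "m1 0 = n" "m1 2 = w" "m1 4 = 1" "m1 5 = va" "m1 6 = ta" "m1 7 = w + 1" "m1 8 = n + 1" "m1 9 = k"
      using regs addr by (simp_all add: f)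
    have rest2: "wp S (table_prog ;; ?fin)
        ((?T) + ((1 + (1 + 2)) + 2))
        ?Q m2"
      if m2: "frame {34..38} m1 m2 \<and> m2 34 = n mod p \<and> m2 35 = (\<Sum>i<n. m1 (va + i))" for m2
    proof -
      have g: "m2 a = m1 a" if "a \<notin> {34..38}" for a using m2 that by (auto dest: frameD)
      have r2: "m2 0 = n" "m2 2 = w" "m2 4 = 1" "m2 5 = va" "m2 6 = ta" "m2 7 = w + 1" "m2 8 = n + 1" "m2 9 = k"
        "m2 24 = p"
        using r1 by (simp_all add: g p_def)
      have v2: "(\<lambda>i. m2 (va + i)) = v" using addr by (auto simp: g v_def)
      have sv: "m2 35 = sum v {..<n}" using m2 by (simp add: v_def)
      have table: "wp S table_prog (?T)
          (\<lambda>m'. frame ({40..57} \<union> {ta..}) m2 m' \<and> m' 45 = weighted v k n w) m2"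
        using wp_table[of m2 va ta w n k S] r2 pre vk addr unfolding v2
        by (simp add: fun_cong[OF v2])
      have fin: "wp S ?fin ((1 + (1 + 2)) + 2)
          ?Q m3"
        if m3: "frame ({40..57} \<union> {ta..}) m2 m3 \<and> m3 45 = weighted v k n w" for m3
      proof -
        have h: "m3 a = m2 a" if "a \<notin> {40..57}" "a < ta" for a using m3 that by (auto dest: frameD)
        have r3: "m3 34 = n mod p" "m3 35 = sum v {..<n}" "m3 2 = w" "m3 24 = p"
          using m2 r2 sv addr by (simp_all add: h)
        have "frame ({24..57} \<union> {va..}) m m2"
          using m1 m2 by (auto intro!: frame_trans[of _ m m1 _ m2])
        then have fr: "frame ({24..57} \<union> {va..}) m m3"
          using m3 addr by (intro frame_trans[of _ m m2 _ m3]) auto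
        have dv: "p dvd n \<longleftrightarrow> n mod p = 0" by (simp add: dvd_eq_mod_eq_0)
        show ?thesis
        proof (rule wp_Cond)
          assume "m3 34 \<noteq> 0"
          then show "wp S (Block []) (1 + (1 + 2)) ?Q m3"
            using fr m3 r3 C dv by (intro wp_Block) auto
        next
          assume z: "m3 34 = 0"
          show "wp S (Block [Sub 38 2 35] ;; Cond 38 (Block []) (Block [Add 45 45 24])) (1 + (1 + 2))
            ?Q m3"
          proof (rule wp_Block_Seq)
            show "wp S (Cond 38 (Block []) (Block [Add 45 45 24])) (1 + 2)
              ?Q (blk [Sub 38 2 35] m3)"
              using fr m3 r3 C dv z S by (intro wp_Cond wp_Block) auto
          qed (use S in auto)
        qed (use S in auto)
      qed
      show ?thesis by (rule wp_Seq[OF table fin])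
    qed
    have "wp S mod_prog (12 * n + 5)
        (\<lambda>m'. frame {34..38} m1 m' \<and> m' 34 = n mod p \<and> m' 35 = (\<Sum>i<n. m1 (va + i))) m1"
      using r1 p addr S by (intro wp_mod) (auto simp: p_def)
    from wp_Seq[OF this rest2] show ?thesis .
  qed
  have "wp S extend_prog (20 * n + 5)
    (\<lambda>m'. frame ({24..33} \<union> {va..<va + n}) m m' \<and> extension u L (\<lambda>i. m' (va + i)) n (m' 24)) m"
    unfolding u_def by (rule wp_extend) (use regs L u S addr in \<open>auto simp: u_def\<close>)
  from wp_Seq[OF this rest] show ?thesis
    unfolding count_prog_def by (rule wp_mono) (auto simp: count_time_def)
qed

subsection \<open>Searching for the least rotation\<close>

fun horner :: "nat \<Rightarrow> (nat \<Rightarrow> nat) \<Rightarrow> nat \<Rightarrow> nat" where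
  "horner B f 0 = 0"
| "horner B f (Suc i) = horner B f i * B + f i"

lemma horner_cong: "(\<And>i. i < m \<Longrightarrow> f i = g i) \<Longrightarrow> horner B f m = horner B g m"
  by (induction m) auto

text \<open>A lead of one, multiplied by \<open>B\<close>, exceeds any later digit of
  \<open>f\<close>, so it is never lost.\<close>

lemma horner_less:
  assumes "q < m" "\<And>j. j < q \<Longrightarrow> f j = g j" "f q < g q" "\<And>j. j < m \<Longrightarrow> f j < B"
  shows "horner B f m < horner B g m"
  using assms(1,4)
proof (induction m)
  case (Suc m)
  show ?case
  proof (cases "q = m")
    case True
    then show ?thesis using horner_cong[of m f g B] assms(2,3) by simp
  next
    case False
    then have "Suc (horner B f m) \<le> horner B g m" using Suc by simp
    then have "Suc (horner B f m) * B \<le> horner B g m * B" by (rule mult_le_mono1)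
    moreover have "f m < B" using Suc.prems by simp
    ultimately show ?thesis by simp
  qed
qed simp

text \<open>The key of a rotation is its value in base \<open>k + 1\<close> with every digit \<open>a\<close> replaced by \<open>k - a\<close>,
  so the least rotation has the largest key and the initial bound 0 is harmless. Among
  equal rotations the last one is kept, which makes \<open>n - J\<close> the offset within the aperiodic prefix.\<close>

definition scan :: "(nat \<Rightarrow> nat) \<Rightarrow> nat \<Rightarrow> nat \<Rightarrow> nat \<Rightarrow> bool" where
  "scan key i b J \<longleftrightarrow> (i = 0 \<longrightarrow> b = 0 \<and> J = 0) \<and> (0 < i \<longrightarrow> 1 \<le> J \<and> J \<le> i \<and> b = key J) \<and>
     (\<forall>j. 1 \<le> j \<and> j \<le> i \<longrightarrow> key j \<le> b) \<and> (\<forall>j. J < j \<and> j \<le> i \<longrightarrow> key j < b)"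

text \<open>For letters at most \<open>k\<close>, the sum \<open>c\<close> is 0 as long as only
  \<open>k\<close> has been read, so it serves as the flag for a still growing run. The key of
  rotation \<open>R\<close> is kept in \<open>y\<close>, to be compared with the best key at the
  end.\<close>

definition run :: "nat \<Rightarrow> (nat \<Rightarrow> nat) \<Rightarrow> (nat \<Rightarrow> nat) \<Rightarrow> nat \<Rightarrow> nat \<Rightarrow> nat \<Rightarrow> nat \<Rightarrow> bool" where
  "run k x key i R y c \<longleftrightarrow> c = (\<Sum>a<i. k - x a) \<and> R \<le> i \<and> (\<forall>a<R. x a = k) \<and>
     (R = i \<or> x R \<noteq> k) \<and> (1 \<le> R \<longrightarrow> y = key R)"

lemma scan_0: "scan key 0 0 0"
  by (auto simp: scan_def)

lemma scan_Suc_ge: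
  "scan key i b J \<Longrightarrow> b \<le> key (Suc i) \<Longrightarrow> scan key (Suc i) (key (Suc i)) (Suc i)"
  unfolding scan_def by (auto simp: le_Suc_eq intro: order_trans)

lemma scan_Suc_less:
  assumes "scan key i b J" "key (Suc i) < b"
  shows "scan key (Suc i) b J"
proof -
  have "0 < i" using assms by (auto simp: scan_def)
  with assms show ?thesis unfolding scan_def by (auto simp: le_Suc_eq)
qed

lemma run_0: "run k x key 0 0 y 0"
  by (simp add: run_def)

lemma run_Suc_zero:
  assumes "run k x key i R y c" "\<And>a. a \<le> i \<Longrightarrow> x a \<le> k" "c + (k - x i) = 0"
  shows "run k x key (Suc i) (Suc i) (key (Suc i)) 0"
proof -
  have "x a = k" if "a < Suc i" for a
  proof -
    have "k - x a = 0"
      using assms(1,3) that unfolding run_def by (auto simp: less_Suc_eq)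
    then show ?thesis using assms(2)[of a] that by simp
  qed
  then show ?thesis by (simp add: run_def)
qed

lemma run_Suc_nonzero:
  assumes "run k x key i R y c" "c + (k - x i) \<noteq> 0"
  shows "run k x key (Suc i) R y (c + (k - x i))"
proof -
  have "x R \<noteq> k"
  proof (cases "R = i")
    case True
    then have "c = 0" using assms(1) by (simp add: run_def)
    then show ?thesis using assms(2) True by auto
  qed (use assms in \<open>auto simp: run_def\<close>)
  with assms(1) show ?thesis by (auto simp: run_def)
qed

definition horner_prog :: com where
  "horner_prog = for_loop 17 0 18 (Block
     [Add 19 20 17, Load 19 19, Sub 19 9 19, Mul 16 16 21, Add 16 16 19])"

lemma wp_horner:
  assumes regs: "m 0 = n" "m 4 = 1" "m 9 = k" "m 16 = 0" "m 20 = p" "m 21 = B"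
    and addr: "60 \<le> p" "p + n \<le> S" "60 \<le> S"
  shows "wp S horner_prog (9 * n + 3)
    (\<lambda>m'. frame {16..19} m m' \<and> m' 16 = horner B (\<lambda>i. k - m (p + i)) n) m"
proof -
  let ?J = "\<lambda>j m'. frame {16..19} m m' \<and> m' 16 = horner B (\<lambda>i. k - m (p + i)) j"
  let ?b = "[Add 19 20 17, Load 19 19, Sub 19 9 19, Mul 16 16 21, Add 16 16 19]"
  have "wp S horner_prog (n * (5 + 4) + 3) (\<lambda>m'. m' 17 = n \<and> m' 0 = n \<and> m' 4 = 1 \<and> ?J n m') m"
    unfolding horner_prog_def
  proof (rule wp_for_loop[where J = ?J])
    fix j m' assume j: "j < n" "m' 17 = j" "m' 0 = n" "m' 4 = 1" "?J j m'"
    have f: "m' a = m a" if "a \<notin> {16..19}" for a using j(5) that by (auto dest: frameD)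
    have r: "m' 9 = k" "m' 20 = p" "m' 21 = B" using regs by (simp_all add: f)
    have ld: "m' (p + j) = m (p + j)" using addr by (intro f) auto
    show "wp S (Block ?b) 5 (\<lambda>m'. m' 17 = j \<and> m' 0 = n \<and> m' 4 = 1 \<and>
        ?J (Suc j) (m'(17 := Suc j, 18 := n - Suc j))) m'"
      using j r ld addr by (intro wp_Block) auto
  qed (use regs addr in auto)
  then show ?thesis by (rule wp_mono) auto
qed

text \<open>Round \<open>j\<close> computes the key of rotation \<open>j + 1\<close> and reads the
  letter \<open>j\<close>. If that letter extends the leading run, the run has length
  \<open>j + 1\<close>, and the key just computed is the one to be kept; thus one loop serves both
  searches. Rotation \<open>n\<close> is the string itself.\<close>

definition search_prog :: com where
  "search_prog = Block [Const 11 0, Const 12 0, Const 13 0, Const 14 0, Const 15 0, Add 21 9 4] ;;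
     for_loop 59 0 10
       (Block [Const 16 0, Add 20 3 59, Add 20 20 4] ;; horner_prog ;;
        Block [Add 19 3 59, Load 19 19, Sub 19 9 19, Add 15 15 19] ;;
        Cond 15 (Block []) (Block [Move 14 16, Add 13 59 4]) ;;
        Block [Sub 19 11 16] ;;
        Cond 19 (Block []) (Block [Move 11 16, Add 12 59 4]))"

lemma wp_search:
  fixes m :: memory and p n k :: nat
  defines "x \<equiv> \<lambda>i. m (p + i)"
  defines "key \<equiv> \<lambda>j. horner (k + 1) (\<lambda>i. k - x (j + i)) n"
  assumes regs: "m 0 = n" "m 3 = p" "m 4 = 1" "m 9 = k"
    and x: "\<And>i. i < n \<Longrightarrow> x i \<le> k"
    and addr: "60 \<le> p" "p + 2 * n \<le> S" "60 \<le> S"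
  shows "wp S search_prog (n * (9 * n + 23) + 9)
    (\<lambda>m'. frame ({10..21} \<union> {59}) m m' \<and> scan key n (m' 11) (m' 12) \<and>
       run k x key n (m' 13) (m' 14) (m' 15)) m"
proof -
  let ?X = "{10..21} \<union> {59::nat}"
  let ?J = "\<lambda>j m'. frame ?X m m' \<and> scan key j (m' 11) (m' 12) \<and>
       run k x key j (m' 13) (m' 14) (m' 15) \<and> m' 21 = k + 1"
  let ?b1 = "[Const 16 0, Add 20 3 59, Add 20 20 4]"
  let ?b2 = "[Add 19 3 59, Load 19 19, Sub 19 9 19, Add 15 15 19]"
  let ?i1 = "Cond 15 (Block []) (Block [Move 14 16, Add 13 59 4])"
  let ?i2 = "Cond 19 (Block []) (Block [Move 11 16, Add 12 59 4])"
  let ?c = "Block ?b1 ;; horner_prog ;; Block ?b2 ;; ?i1 ;; Block [Sub 19 11 16] ;; ?i2"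
  define m0 where "m0 = m(11 := 0, 12 := 0, 13 := 0, 14 := 0, 15 := 0, 21 := k + 1)"
  have loop: "wp S (for_loop 59 0 10 ?c) (n * ((9 * n + 19) + 4) + 3)
      (\<lambda>m'. m' 59 = n \<and> m' 0 = n \<and> m' 4 = 1 \<and> ?J n m') m0"
  proof (rule wp_for_loop[where J = ?J])
    fix j m1 assume j: "j < n" "m1 59 = j" "m1 0 = n" "m1 4 = 1" "?J j m1"
    have f: "m1 a = m a" if "a \<notin> ?X" for a using j(5) that by (auto dest: frameD)
    have r: "m1 3 = p" "m1 9 = k" "m1 21 = k + 1" using regs j(5) by (simp_all add: f)
    have x1: "m1 (p + i) = x i" for i using addr by (simp add: f x_def)
    define b J R y c where "b = m1 11" and "J = m1 12" and "R = m1 13" and "y = m1 14" and "c = m1 15"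
    have scan: "scan key j b J" and run: "run k x key j R y c"
      using j(5) by (simp_all add: b_def J_def R_def y_def c_def)
    let ?Q = "\<lambda>m'. m' 59 = j \<and> m' 0 = n \<and> m' 4 = 1 \<and> ?J (Suc j) (m'(59 := Suc j, 10 := n - Suc j))"
    define m2 where "m2 = m1(16 := 0, 20 := p + j + 1)"
    have m2: "blk ?b1 m1 = m2" using j r by (simp add: m2_def)
    have horner: "wp S horner_prog (9 * n + 3)
      (\<lambda>m'. frame {16..19} m2 m' \<and> m' 16 = key (Suc j)) m2"
    proof (rule wp_mono[OF wp_horner[of m2 n k "p + j + 1" "k + 1"]])
      fix m' assume m': "frame {16..19} m2 m' \<and> m' 16 = horner (k + 1) (\<lambda>i. k - m2 (p + j + 1 + i)) n"
      have "m2 (p + j + 1 + i) = x (Suc j + i)" for i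
        using addr x1[of "Suc j + i"] by (simp add: m2_def add.assoc)
      with m' show "frame {16..19} m2 m' \<and> m' 16 = key (Suc j)" by (simp add: key_def)
    qed (use j r addr in \<open>auto simp: m2_def\<close>)
    have rest: "wp S (Block ?b2 ;; ?i1 ;; Block [Sub 19 11 16] ;; ?i2) (4 + ((2 + 2) + (1 + (2 + 2)))) ?Q m3"
      if m3: "frame {16..19} m2 m3 \<and> m3 16 = key (Suc j)" for m3
    proof -
      have g: "m3 a = m1 a" if "a \<notin> {16..20}" for a
        using m3 that by (auto simp: m2_def dest!: frameD[of _ _ _ a])
      have r3: "m3 0 = n" "m3 3 = p" "m3 4 = 1" "m3 9 = k" "m3 59 = j" "m3 21 = k + 1"
        "m3 11 = b" "m3 12 = J" "m3 13 = R" "m3 14 = y" "m3 15 = c"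
        using j r by (simp_all add: g b_def J_def R_def y_def c_def)
      have x3: "m3 (p + j) = x j" using addr x1[of j] by (simp add: g)
      have fr3: "frame ?X m m3"
      proof (rule frame_trans[of ?X m m2 "{16..19}" m3])
        show "frame ?X m m2" using j(5) by (simp add: m2_def)
      qed (use m3 in auto)
      define m4 where "m4 = m3(19 := k - x j, 15 := c + (k - x j))"
      have m4: "blk ?b2 m3 = m4" using r3 x3 addr by (simp add: m4_def add.commute)
      let ?R = "\<lambda>m'. frame ?X m m' \<and> run k x key (Suc j) (m' 13) (m' 14) (m' 15) \<and> m' 21 = k + 1 \<and>
        m' 16 = key (Suc j) \<and> m' 11 = b \<and> m' 12 = J \<and> m' 0 = n \<and> m' 4 = 1 \<and> m' 59 = j"
      have i1: "wp S ?i1 (2 + 2) ?R m4"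
      proof (rule wp_Cond)
        assume "m4 15 \<noteq> 0"
        then have "run k x key (Suc j) R y (c + (k - x j))"
          using run_Suc_nonzero[OF run] by (simp add: m4_def)
        then show "wp S (Block []) 2 ?R m4"
          using r3 m3 fr3 by (intro wp_Block) (simp_all add: m4_def)
      next
        assume z: "m4 15 = 0"
        then have "c + (k - x j) = 0" by (simp add: m4_def)
        then have "run k x key (Suc j) (Suc j) (key (Suc j)) 0"
          by (rule run_Suc_zero[OF run, rotated]) (use x j(1) in auto)
        then show "wp S (Block [Move 14 16, Add 13 59 4]) 2 ?R m4"
          using r3 m3 fr3 z addr by (intro wp_Block) (simp_all add: m4_def)
      qed (use addr in auto)
      have i2: "wp S (Block [Sub 19 11 16] ;; ?i2) (1 + (2 + 2)) ?Q m5" if m5: "?R m5" for m5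
      proof (rule wp_Block_Seq)
        show "wp S ?i2 (2 + 2) ?Q (blk [Sub 19 11 16] m5)"
        proof (rule wp_Cond)
          assume "blk [Sub 19 11 16] m5 19 \<noteq> 0"
          then have "scan key (Suc j) b J"
            using m5 scan_Suc_less[OF scan] by simp
          then show "wp S (Block []) 2 ?Q (blk [Sub 19 11 16] m5)"
            using m5 by (intro wp_Block) simp_all
        next
          assume "blk [Sub 19 11 16] m5 19 = 0"
          then have "scan key (Suc j) (key (Suc j)) (Suc j)"
            using m5 scan_Suc_ge[OF scan] by simp
          then show "wp S (Block [Move 11 16, Add 12 59 4]) 2 ?Q (blk [Sub 19 11 16] m5)"
            using m5 addr by (intro wp_Block) simp_all
        qed (use addr in auto)
      qed (use addr in auto)
      show ?thesis
      proof (rule wp_Block_Seq)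
        show "wp S (?i1 ;; Block [Sub 19 11 16] ;; ?i2) ((2 + 2) + (1 + (2 + 2))) ?Q (blk ?b2 m3)"
          unfolding m4 by (rule wp_Seq[OF i1 i2])
      qed (use r3 addr j(1) in auto)
    qed
    have "wp S ?c (3 + ((9 * n + 3) + (4 + ((2 + 2) + (1 + (2 + 2)))))) ?Q m1"
    proof (rule wp_Block_Seq)
      show "wp S (horner_prog ;; Block ?b2 ;; ?i1 ;; Block [Sub 19 11 16] ;; ?i2)
        ((9 * n + 3) + (4 + ((2 + 2) + (1 + (2 + 2))))) ?Q (blk ?b1 m1)"
        unfolding m2 by (rule wp_Seq[OF horner rest])
    qed (use addr in auto)
    then show "wp S ?c (9 * n + 19) ?Q m1" by (rule wp_mono) auto
  next
    show "?J 0 (m0(59 := 0, 10 := n))" by (simp add: m0_def scan_0 run_0)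
  qed (use regs addr in \<open>auto simp: m0_def\<close>)
  have "wp S search_prog (6 + (n * ((9 * n + 19) + 4) + 3))
      (\<lambda>m'. m' 59 = n \<and> m' 0 = n \<and> m' 4 = 1 \<and> ?J n m') m"
    unfolding search_prog_def
    by (rule wp_Block_Seq) (use regs addr loop in \<open>auto simp: m0_def\<close>)
  then show ?thesis by (rule wp_mono) auto
qed

subsection \<open>Relocating the input\<close>

text \<open>Initially no register of fixed address is known to be free. The address \<open>n + k + w\<close> is free,
  and moving the first symbol there frees register 3.\<close>

definition free_prog :: com where
  "free_prog = Block [Add 0 0 1, Add 0 0 2, Store 0 3, Const 3 60, Add 3 3 0, Load 0 0, Store 3 0,
     Const 0 1,
     Add 3 3 0, Store 3 4, Add 3 3 0, Store 3 5, Add 3 3 0, Store 3 6, Add 3 3 0, Store 3 7,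
     Add 3 3 0, Store 3 8, Add 3 3 0, Store 3 9, Add 3 3 0, Store 3 10, Add 3 3 0, Store 3 11,
     Add 3 3 0, Store 3 12,
     Const 4 69, Sub 0 3 4, Sub 0 0 1, Sub 0 0 2, Const 4 9, Sub 3 3 4, Const 4 1, Move 9 1,
     Const 5 10, Sub 6 0 5, Const 12 3]"

text \<open>The first ten symbols, from registers 3 to 12, are already in place. Register 12 holds
  3, the address of the first symbol in the input.\<close>

definition copy_prog :: com where
  "copy_prog = for_loop 7 6 8 (Block [Add 10 5 7, Add 11 10 3, Add 10 10 12, Load 10 10, Store 11 10])"

text \<open>With a second copy behind the first, every rotation is a contiguous stretch of
  memory.\<close>

definition double_prog :: com where
  "double_prog = for_loop 7 0 8 (Block [Add 10 3 7, Load 11 10, Add 10 10 0, Store 10 11])"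

definition init_prog :: com where
  "init_prog = free_prog ;; copy_prog ;; double_prog ;;
     Block [Add 5 3 0, Add 5 5 0, Add 6 5 0, Add 7 2 4, Add 8 0 4]"

definition base :: "nat \<Rightarrow> nat \<Rightarrow> nat \<Rightarrow> nat list \<Rightarrow> memory \<Rightarrow> bool" where
  "base n k w s m \<longleftrightarrow> m 0 = n \<and> m 2 = w \<and> m 3 = n + k + w + 60 \<and> m 4 = 1 \<and>
     m 5 = 3 * n + k + w + 60 \<and> m 6 = 4 * n + k + w + 60 \<and> m 7 = w + 1 \<and> m 8 = n + 1 \<and> m 9 = k \<and>
     (\<forall>i<2 * n. m (n + k + w + 60 + i) = cyc s i)"

lemma wp_free:
  assumes regs: "m 0 = n" "m 1 = k" "m 2 = w" and s: "\<And>i. i < n \<Longrightarrow> m (3 + i) = s ! i"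
    and p: "p = n + k + w + 60" "3 \<le> k + w" "p + 10 \<le> S" "1 \<le> n"
  shows "wp S free_prog 37 (\<lambda>m'. m' 0 = n \<and> m' 2 = w \<and> m' 3 = p \<and> m' 4 = 1 \<and> m' 9 = k \<and>
    m' 5 = 10 \<and> m' 6 = n - 10 \<and> m' 12 = 3 \<and> (\<forall>i<n. i < 10 \<longrightarrow> m' (p + i) = s ! i) \<and>
    (\<forall>i<n. 10 \<le> i \<longrightarrow> m' (3 + i) = s ! i)) m"
    (is "wp _ _ _ ?P _")
proof -
  define q where "q = n + k + w"
  \<comment> \<open>\<open>q\<close> lies behind the last symbol, which is stored at
    \<open>n + 2\<close>, and differs from register 3, which becomes the write pointer.\<close>
  have pq: "p = 60 + q" "n + 3 \<le> q" "4 \<le> q" using p by (auto simp: q_def)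
  have sub: "q - k - w = n" by (simp add: q_def)
  define m1 where "m1 = m(0 := q, q := m 3)"
  have m1: "m1 0 = q" "m1 1 = k" "m1 2 = w" "m1 q = m 3"
    using pq regs by (simp_all add: m1_def)
  have m1s: "m1 (3 + i) = s ! i" if "i < n" for i
    using s[OF that] that pq by (simp add: m1_def)
  have m1q: "m1 q = s ! 0" if "0 < n"
    using s[of 0] that m1 by simp
  define m2 where "m2 = m1(0 := 1, 3 := p + 9, p := m1 q, p + 1 := m1 4, p + 2 := m1 5, p + 3 := m1 6,
    p + 4 := m1 7, p + 5 := m1 8, p + 6 := m1 9, p + 7 := m1 10, p + 8 := m1 11, p + 9 := m1 12)"
  let ?b1 = "[Add 0 0 1, Add 0 0 2, Store 0 3]"
  let ?b2 = "[Const 3 60, Add 3 3 0, Load 0 0, Store 3 0, Const 0 1,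
     Add 3 3 0, Store 3 4, Add 3 3 0, Store 3 5, Add 3 3 0, Store 3 6, Add 3 3 0, Store 3 7,
     Add 3 3 0, Store 3 8, Add 3 3 0, Store 3 9, Add 3 3 0, Store 3 10, Add 3 3 0, Store 3 11,
     Add 3 3 0, Store 3 12]"
  let ?b3 = "[Const 4 69, Sub 0 3 4, Sub 0 0 1, Sub 0 0 2, Const 4 9, Sub 3 3 4, Const 4 1, Move 9 1,
     Const 5 10, Sub 6 0 5, Const 12 3]"
  have b1: "blk ?b1 m = m1" "blk_ok S ?b1 m"
    using regs pq p(3) by (simp_all add: m1_def q_def fun_upd_twist)
  have b2: "blk ?b2 m1 = m2" "blk_ok S ?b2 m1"
    using m1 pq p(3) by (simp_all add: m2_def fun_upd_twist)
  \<comment> \<open>Register 3 holds p + 9 = n + k + w + 69 at this point: subtracting 69,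
    \<open>k\<close> and \<open>w\<close> restores \<open>n\<close>, and subtracting 9 restores
    \<open>p\<close>.\<close>
  define m3 where "m3 = m2(0 := n, 3 := p, 4 := 1, 9 := k, 5 := 10, 6 := n - 10, 12 := 3)"
  have b3: "blk ?b3 m2 = m3" "blk_ok S ?b3 m2"
    using m1 pq p(3) sub by (simp_all add: m2_def m3_def fun_upd_twist)
  have app: "blk (xs @ ys) m' = blk ys (blk xs m')"
    "blk_ok S (xs @ ys) m' \<longleftrightarrow> blk_ok S xs m' \<and> blk_ok S ys (blk xs m')" for xs ys m'
    by (induction xs arbitrary: m') auto
  have prog: "free_prog = Block (?b1 @ ?b2 @ ?b3)" by (simp add: free_prog_def)
  have A: "m3 (p + i) = s ! i" if "i < n" "i < 10" for i
  proof -
    have "i \<in> {0, 1, 2, 3, 4, 5, 6, 7, 8, 9}" using that(2) by auto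
    moreover have "m3 (p + i) = m2 (p + i)" using pq by (simp add: m3_def)
    moreover have "m2 p = m1 q" "m2 (p + 1) = m1 4" "m2 (p + 2) = m1 5" "m2 (p + 3) = m1 6"
      "m2 (p + 4) = m1 7" "m2 (p + 5) = m1 8" "m2 (p + 6) = m1 9" "m2 (p + 7) = m1 10"
      "m2 (p + 8) = m1 11" "m2 (p + 9) = m1 12"
      by (simp_all add: m2_def)
    ultimately show ?thesis
      using m1s[OF that(1)] m1q that(1) by auto
  qed
  have B: "m3 (3 + i) = s ! i" if "i < n" "10 \<le> i" for i
    using m1s[OF that(1)] that pq by (simp add: m3_def m2_def)
  show ?thesis
    unfolding prog
  proof (rule wp_Block)
    show "blk_ok S (?b1 @ ?b2 @ ?b3) m" unfolding app b1(1) b2(1) using b1(2) b2(2) b3(2) by blast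
    have "m3 2 = w" using m1 pq by (simp add: m3_def m2_def)
    then show "?P (blk (?b1 @ ?b2 @ ?b3) m)"
      unfolding app b1(1) b2(1) b3(1) using A B by (simp add: m3_def)
  qed simp
qed

lemma wp_init:
  assumes m: "m = ram_input n k w s" and len: "length s = n"
    and n: "1 \<le> n" "3 \<le> k + w" and S: "4 * n + k + w + 70 \<le> S"
  shows "wp S init_prog (18 * n + 60) (\<lambda>m'. base n k w s m') m"
proof -
  define p where "p = n + k + w + 60"
  let ?b = "[Add 10 5 7, Add 11 10 3, Add 10 10 12, Load 10 10, Store 11 10]"
  let ?d = "[Add 10 3 7, Load 11 10, Add 10 10 0, Store 10 11]"
  let ?e = "[Add 5 3 0, Add 5 5 0, Add 6 5 0, Add 7 2 4, Add 8 0 4]"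
  have regs: "m 0 = n" "m 1 = k" "m 2 = w"
    by (simp_all add: m ram_input_def memory_of_def)
  have ms: "m (3 + i) = s ! i" if "i < n" for i
    using that len by (simp add: m ram_input_def memory_of_def)
  let ?P = "\<lambda>m'. m' 0 = n \<and> m' 2 = w \<and> m' 3 = p \<and> m' 4 = 1 \<and> m' 9 = k \<and>
    m' 5 = 10 \<and> m' 6 = n - 10 \<and> m' 12 = 3 \<and> (\<forall>i<n. i < 10 \<longrightarrow> m' (p + i) = s ! i) \<and>
    (\<forall>i<n. 10 \<le> i \<longrightarrow> m' (3 + i) = s ! i)"
  have free: "wp S free_prog 37 ?P m"
    using wp_free[OF regs ms p_def n(2) _ n(1)] S by (simp add: p_def)
  have copy: "wp S copy_prog (9 * n + 3)
    (\<lambda>m'. m' 0 = n \<and> m' 2 = w \<and> m' 3 = p \<and> m' 4 = 1 \<and> m' 9 = k \<and> (\<forall>i<n. m' (p + i) = s ! i)) m1"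
    if m1: "?P m1" for m1
  proof -
    let ?J = "\<lambda>j m'. frame ({7, 8, 10, 11} \<union> {p + 10..}) m1 m' \<and> (\<forall>i<j. m' (p + (10 + i)) = s ! (10 + i))"
    have "wp S copy_prog ((n - 10) * (5 + 4) + 3)
        (\<lambda>m'. m' 7 = n - 10 \<and> m' 6 = n - 10 \<and> m' 4 = 1 \<and> ?J (n - 10) m') m1"
      unfolding copy_prog_def
    proof (rule wp_for_loop[where J = ?J])
      fix j m2 assume j: "j < n - 10" "m2 7 = j" "m2 6 = n - 10" "m2 4 = 1" "?J j m2"
      have f: "m2 a = m1 a" if "a \<notin> {7, 8, 10, 11}" "a < p + 10" for a
        using j(5) that by (auto dest: frameD)
      have r: "m2 3 = p" "m2 5 = 10" "m2 12 = 3" using m1 by (simp_all add: f p_def)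
      have "m2 (3 + (10 + j)) = m1 (3 + (10 + j))" using j(1) by (intro f) (auto simp: p_def)
      moreover have "10 + j < n" "10 \<le> 10 + j" using j(1) by auto
      with m1 have "m1 (3 + (10 + j)) = s ! (10 + j)" by blast
      ultimately have ld: "m2 (13 + j) = s ! (10 + j)" by simp
      define m3 where "m3 = m2(10 := s ! (10 + j), 11 := 10 + j + p, 10 + j + p := s ! (10 + j))"
      have "13 + j \<noteq> 10" "13 + j \<noteq> 11" "10 + j + p \<noteq> 10" "10 + j + p \<noteq> 11" by (auto simp: p_def)
      then have m3: "blk ?b m2 = m3"
        using j(2) r ld by (simp add: m3_def add.commute fun_upd_twist)
      have "m3 (p + (10 + i)) = s ! (10 + i)" if "i < Suc j" for i
        using j(5) that by (cases "i = j") (auto simp: m3_def p_def add.commute)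
      moreover have "frame ({7, 8, 10, 11} \<union> {p + 10..}) m1 m3"
        using j(5) by (simp add: m3_def)
      ultimately have Q: "m3 7 = j \<and> m3 6 = n - 10 \<and> m3 4 = 1 \<and> ?J (Suc j) (m3(7 := Suc j, 8 := n - 10 - Suc j))"
        using j(2-4) by (simp add: m3_def p_def)
      show "wp S (Block ?b) 5 (\<lambda>m'. m' 7 = j \<and> m' 6 = n - 10 \<and> m' 4 = 1 \<and>
          ?J (Suc j) (m'(7 := Suc j, 8 := n - 10 - Suc j))) m2"
      proof (rule wp_Block)
        have "13 + j < S" "10 + j + p < S" using S j(1) by (auto simp: p_def)
        then show "blk_ok S ?b m2" using S j(2) r by (simp add: p_def add.commute)
      qed (use Q m3 in simp_all)
    qed (use m1 S in auto)
    then show ?thesis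
    proof (rule wp_mono)
      fix m' assume m': "m' 7 = n - 10 \<and> m' 6 = n - 10 \<and> m' 4 = 1 \<and> ?J (n - 10) m'"
      have f: "m' a = m1 a" if "a \<notin> {7, 8, 10, 11}" "a < p + 10" for a
        using m' that by (auto dest: frameD)
      have "m' (p + i) = s ! i" if "i < n" for i
      proof (cases "i < 10")
        case True
        then have "m' (p + i) = m1 (p + i)" by (intro f) (auto simp: p_def)
        then show ?thesis using m1 True that by simp
      next
        case False
        then have "i - 10 < n - 10" using that by simp
        with m' have "m' (p + (10 + (i - 10))) = s ! (10 + (i - 10))" by blast
        then show ?thesis using False by simp
      qed
      then show "m' 0 = n \<and> m' 2 = w \<and> m' 3 = p \<and> m' 4 = 1 \<and> m' 9 = k \<and> (\<forall>i<n. m' (p + i) = s ! i)"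
        using m1 by (simp add: f p_def)
    qed simp
  qed
  have double: "wp S (double_prog ;; Block ?e) ((8 * n + 3) + 5) (\<lambda>m'. base n k w s m') m1"
    if m1: "m1 0 = n \<and> m1 2 = w \<and> m1 3 = p \<and> m1 4 = 1 \<and> m1 9 = k \<and> (\<forall>i<n. m1 (p + i) = s ! i)" for m1
  proof -
    let ?J = "\<lambda>j m'. frame ({7, 8, 10, 11} \<union> {p + n..}) m1 m' \<and> (\<forall>i<j. m' (p + (n + i)) = s ! i)"
    have loop: "wp S double_prog (n * (4 + 4) + 3)
        (\<lambda>m'. m' 7 = n \<and> m' 0 = n \<and> m' 4 = 1 \<and> ?J n m') m1"
      unfolding double_prog_def
    proof (rule wp_for_loop[where J = ?J])
      fix j m2 assume j: "j < n" "m2 7 = j" "m2 0 = n" "m2 4 = 1" "?J j m2"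
      have f: "m2 a = m1 a" if "a \<notin> {7, 8, 10, 11}" "a < p + n" for a
        using j(5) that by (auto dest: frameD)
      have r: "m2 3 = p" using m1 by (simp add: f p_def)
      have "m2 (p + j) = m1 (p + j)" using j(1) by (intro f) (auto simp: p_def)
      then have ld: "m2 (p + j) = s ! j" using m1 j(1) by simp
      define m3 where "m3 = m2(10 := p + j + n, 11 := s ! j, p + j + n := s ! j)"
      have "p + j \<noteq> 10" "p + j \<noteq> 11" "p + j + n \<noteq> 10" "p + j + n \<noteq> 11" by (auto simp: p_def)
      then have m3: "blk ?d m2 = m3"
        using j(2,3) r ld by (simp add: m3_def fun_upd_twist)
      have "m3 (p + (n + i)) = s ! i" if "i < Suc j" for i
        using j(5) that by (cases "i = j") (auto simp: m3_def p_def add.commute add.left_commute)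
      moreover have "frame ({7, 8, 10, 11} \<union> {p + n..}) m1 m3"
        using j(5) by (simp add: m3_def)
      ultimately have Q: "m3 7 = j \<and> m3 0 = n \<and> m3 4 = 1 \<and> ?J (Suc j) (m3(7 := Suc j, 8 := n - Suc j))"
        using j(2-4) by (simp add: m3_def p_def)
      show "wp S (Block ?d) 4 (\<lambda>m'. m' 7 = j \<and> m' 0 = n \<and> m' 4 = 1 \<and>
          ?J (Suc j) (m'(7 := Suc j, 8 := n - Suc j))) m2"
      proof (rule wp_Block)
        show "blk_ok S ?d m2" using S j(1,2,3) r by (simp add: p_def)
      qed (use Q m3 in simp_all)
    qed (use m1 S in auto)
    have fin: "wp S (Block ?e) 5 (\<lambda>m'. base n k w s m') m2"
      if m2: "m2 7 = n \<and> m2 0 = n \<and> m2 4 = 1 \<and> ?J n m2" for m2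
    proof -
      have f: "m2 a = m1 a" if "a \<notin> {7, 8, 10, 11}" "a < p + n" for a
        using m2 that by (auto dest: frameD)
      have r: "m2 2 = w" "m2 3 = p" "m2 9 = k" using m1 by (simp_all add: f p_def)
      have sy: "m2 (p + i) = cyc s i" if "i < 2 * n" for i
      proof (cases "i < n")
        case True
        then have "m2 (p + i) = m1 (p + i)" by (intro f) (auto simp: p_def)
        then show ?thesis using m1 True len by (simp add: cyc_nth)
      next
        case False
        then have "i - n < n" using that by simp
        with m2 have "m2 (p + (n + (i - n))) = s ! (i - n)" by blast
        moreover have "cyc s i = s ! (i - n)"
          using False that len by (simp add: cyc_def le_mod_geq)
        ultimately show ?thesis using False by simp
      qed
      show ?thesis
      proof (rule wp_Block)
        show "base n k w s (blk ?e m2)"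
          using m2 r sy by (simp add: base_def p_def)
      qed (use S in simp_all)
    qed
    have "wp S (double_prog ;; Block ?e) ((n * (4 + 4) + 3) + 5) (\<lambda>m'. base n k w s m') m1"
      by (rule wp_Seq[OF loop fin])
    then show ?thesis by (rule wp_mono) auto
  qed
  have "wp S init_prog (37 + ((9 * n + 3) + ((8 * n + 3) + 5))) (\<lambda>m'. base n k w s m') m"
    unfolding init_prog_def by (rule wp_Seq[OF free wp_Seq[OF copy double]])
  then show ?thesis by (rule wp_mono) auto
qed

subsection \<open>The ranking program\<close>

text \<open>Registers 11, 12 hold the best key and its rotation \<open>J\<close>, registers 13, 14 the length \<open>R\<close> of the
  leading run of \<open>k\<close> and the key of rotation \<open>R\<close>. Register 21 is 0 iff rotation \<open>R\<close> is the least one,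
  so that the string occurs across the boundary before the first necklace with prefix \<open>drop R s\<close>.\<close>

definition select_prog :: com where
  "select_prog = Block [Sub 19 11 14, Store 5 4] ;;
     Cond 13 (Cond 19 (Block [Move 20 12, Move 22 0, Const 21 1]) (Block [Move 20 13, Sub 22 0 13, Const 21 0]))
       (Block [Move 20 12, Move 22 0, Const 21 1])"

definition fetch_prog :: com where
  "fetch_prog = for_loop 17 22 18 (Block
     [Add 19 3 20, Add 19 19 17, Load 19 19, Add 16 5 17, Store 16 19])"

text \<open>Register 15 first receives \<open>below u\<close>, the difference of the two counts.
  \<open>n\<close> is added before \<open>J\<close> is subtracted, lest the truncation spoil the
  offset \<open>n - J\<close>.\<close>

definition output_prog :: com where
  "output_prog = Block [Sub 15 58 45] ;;
     Cond 21 (Block [Add 15 15 0, Sub 15 15 12, Add 0 15 4])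
       (Cond 15 (Block [Sub 15 15 13, Add 0 15 4]) (Block [Sub 58 58 13, Add 0 58 4]))"

text \<open>The first call of \<open>count_prog\<close> gets an empty prefix, represented by the
  letter 1, and so counts all strings; register 58 then holds the length of the cycle.\<close>

definition rank_prog :: com where
  "rank_prog = init_prog ;; (Block [Const 22 0, Store 5 4] ;; count_prog ;; Block [Move 58 45]) ;;
     search_prog ;; select_prog ;; fetch_prog ;; count_prog ;; output_prog"

definition rank_time :: "nat \<Rightarrow> nat \<Rightarrow> nat \<Rightarrow> nat" where
  "rank_time n k w = 2 * count_time n k w + n * (9 * n + 23) + 27 * n + 100"

definition rank_space :: "nat \<Rightarrow> nat \<Rightarrow> nat \<Rightarrow> nat" where
  "rank_space n k w = 4 * n + k + w + 70 + (n + 1) * (w + 1)"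

lemma base_frame:
  assumes "base n k w s m" "frame X m m'"
    and X: "\<And>a. a < 10 \<or> 60 \<le> a \<and> a < 3 * n + k + w + 60 \<Longrightarrow> a \<notin> X"
  shows "base n k w s m'"
proof -
  have f: "m' a = m a" if "a < 10 \<or> 60 \<le> a \<and> a < 3 * n + k + w + 60" for a
    using frameD[OF assms(2)] X that by blast
  show ?thesis using assms(1) unfolding base_def by (auto simp: f)
qed

lemma wp_fetch:
  fixes m :: memory
  defines "va \<equiv> m 5"
  assumes base: "base n k w s m" and m: "m 20 = d" "m 22 = l" "d \<le> n" "l \<le> n"
    and S: "rank_space n k w \<le> S"
  shows "wp S fetch_prog (9 * n + 3)
    (\<lambda>m'. frame ({16..19} \<union> {va..<va + l}) m m' \<and> (\<forall>i<l. m' (va + i) = cyc s (d + i))) m"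
proof -
  define p where "p = n + k + w + 60"
  have va: "va = p + 2 * n" using base by (simp add: base_def va_def p_def)
  have S: "60 \<le> S" "va + n \<le> S" using S by (simp_all add: rank_space_def va p_def)
  let ?J = "\<lambda>j m'. frame ({16..19} \<union> {va..<va + l}) m m' \<and> (\<forall>i<j. m' (va + i) = cyc s (d + i))"
  let ?b = "[Add 19 3 20, Add 19 19 17, Load 19 19, Add 16 5 17, Store 16 19]"
  have "wp S fetch_prog (l * (5 + 4) + 3) (\<lambda>m'. m' 17 = l \<and> m' 22 = l \<and> m' 4 = 1 \<and> ?J l m') m"
    unfolding fetch_prog_def
  proof (rule wp_for_loop[where J = ?J])
    fix j m1 assume j: "j < l" "m1 17 = j" "m1 22 = l" "m1 4 = 1" "?J j m1"
    have f: "m1 a = m a" if "a \<notin> {16..19}" "a < va" for a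
      using j(5) that by (auto dest: frameD)
    have r: "m1 3 = p" "m1 5 = va" "m1 20 = d" using base m va by (simp_all add: f base_def p_def)
    have "d + j < 2 * n" using j(1) m(3,4) by simp
    moreover have "m1 (p + (d + j)) = m (p + (d + j))"
      using calculation by (intro f) (auto simp: va p_def)
    ultimately have ld: "m1 (p + d + j) = cyc s (d + j)"
      using base by (simp add: base_def p_def add.assoc)
    define m2 where "m2 = m1(19 := cyc s (d + j), 16 := va + j, va + j := cyc s (d + j))"
    have m2: "blk ?b m1 = m2" using j(2) r ld va by (simp add: m2_def p_def fun_upd_twist)
    have J: "\<forall>i<Suc j. m2 (va + i) = cyc s (d + i)"
      using j(5) va by (auto simp: m2_def p_def less_Suc_eq)
    have "va + j \<in> {16..19} \<union> {va..<va + l}" using j(1) by auto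
    have fr: "frame ({16..19} \<union> {va..<va + l}) m m2"
    proof -
      have "frame ({16..19} \<union> {va..<va + l}) m (m1(19 := cyc s (d + j), 16 := va + j))"
        using j(5) by simp
      with frame_upd[OF \<open>va + j \<in> {16..19} \<union> {va..<va + l}\<close>] show ?thesis
        unfolding m2_def by blast
    qed
    show "wp S (Block ?b) 5 (\<lambda>m'. m' 17 = j \<and> m' 22 = l \<and> m' 4 = 1 \<and>
        ?J (Suc j) (m'(17 := Suc j, 18 := l - Suc j))) m1"
    proof (rule wp_Block)
      have "p + d + j < S" "va + j < S" using S va m(3,4) j(1) by auto
      then show "blk_ok S ?b m1" using S j(2) r by simp
      have "m2 17 = j" "m2 22 = l" "m2 4 = 1" using j(2-4) va by (simp_all add: m2_def p_def)
      then show "blk ?b m1 17 = j \<and> blk ?b m1 22 = l \<and> blk ?b m1 4 = 1 \<and>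
        ?J (Suc j) ((blk ?b m1)(17 := Suc j, 18 := l - Suc j))"
        unfolding m2 using J fr va by (simp add: p_def)
    qed simp
  qed (use m base S in \<open>auto simp: base_def\<close>)
  then show ?thesis by (rule wp_mono) (use m in auto)
qed

section \<open>Correctness of the ranking program\<close>

context necklace_cycle
begin

lemma horner_less_rotation:
  assumes "length y = n" "length z = n" "set z \<subseteq> {..k}" "y < z"
  shows "horner (k + 1) (\<lambda>i. k - z ! i) n < horner (k + 1) (\<lambda>i. k - y ! i) n"
proof -
  obtain q where q: "q < n" "\<forall>j<q. y ! j = z ! j" "y ! q < z ! q"
    using assms list_less_iff_nth[of y z] by auto
  have "z ! q \<le> k" using assms(2,3) q(1) by (auto simp: subset_iff)
  with q show ?thesis by (intro horner_less[of q]) auto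
qed

definition key :: "nat list \<Rightarrow> nat \<Rightarrow> nat" where
  "key s j = horner (k + 1) (\<lambda>i. k - cyc s (j + i)) n"

lemma key_eq: "length s = n \<Longrightarrow> key s a = horner (k + 1) (\<lambda>i. k - rotate a s ! i) n"
  unfolding key_def by (rule horner_cong) (simp add: nth_rotate_cyc)

lemma key_less:
  assumes s: "s \<in> strings_ge k n w" and "rotate i s < rotate j s"
  shows "key s j < key s i"
proof -
  note s' = strings_geD[OF s]
  show ?thesis
    using horner_less_rotation[OF _ _ _ assms(2)] s' by (simp add: key_eq)
qed

lemma scan_rotation:
  assumes s: "s \<in> strings_ge k n w" and scan: "scan (key s) n b J"
  shows "1 \<le> J" "J \<le> n" "b = key s J" "rotate J s \<in> set A"
    and "\<And>j. J < j \<Longrightarrow> j \<le> n \<Longrightarrow> rotate j s \<noteq> rotate J s"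
    and "\<And>j. key s j = key s J \<Longrightarrow> rotate j s = rotate J s"
proof -
  note s' = strings_geD[OF s]
  show J: "1 \<le> J" "J \<le> n" and b: "b = key s J" using scan n by (auto simp: scan_def)
  have le: "rotate J s \<le> rotate j s" if "1 \<le> j" "j \<le> n" for j
  proof (rule ccontr)
    assume "\<not> rotate J s \<le> rotate j s"
    then have "key s J < key s j" by (intro key_less[OF s]) simp
    then show False using scan that b by (auto simp: scan_def)
  qed
  \<comment> \<open>The search numbers rotations from 1 to \<open>n\<close>; rotation 0 is covered
    by rotation \<open>n\<close>.\<close>
  have le': "rotate J s \<le> rotate j s" for j
  proof -
    have "rotate j s = rotate (j mod n) s" using s'(1) rotate_conv_mod by metis
    moreover have "rotate 0 s = rotate n s" using s'(1) by simp
    ultimately show ?thesis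
      using le[of "j mod n"] le[of n] n by (cases "j mod n = 0") (auto simp: Suc_le_eq less_imp_le)
  qed
  then have "necklace (rotate J s)" by (simp add: necklace_def rotate_rotate)
  then show "rotate J s \<in> set A" using s by (simp add: set_A)
  show eq: "rotate j s = rotate J s" if "key s j = key s J" for j
    using le'[of j] key_less[OF s, of J j] that by (metis less_irrefl order_le_imp_less_or_eq)
  show "rotate j s \<noteq> rotate J s" if "J < j" "j \<le> n" for j
  proof
    assume "rotate j s = rotate J s"
    then have "key s j = key s J" by (simp add: key_eq s'(1))
    then show False using scan that b by (auto simp: scan_def)
  qed
qed

lemma necklace_prenecklace:
  assumes "y \<in> set A"
  shows "prenecklace n ((!) y)"
  unfolding prenecklace_def
proof (intro allI impI, rule ccontr)
  note y = strings_geD[OF in_A(1)[OF assms]]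
  fix a l assume al: "a + l < n" "\<forall>j<l. y ! (a + j) = y ! j" "\<not> y ! l \<le> y ! (a + l)"
  have "rotate a y ! j = y ! (a + j)" if "j \<le> l" for j
    using that al(1) y(1) by (simp add: nth_rotate)
  then have "rotate a y < y"
    using al y(1) by (subst list_less_iff_nth) (auto intro!: exI[of _ l])
  then show False using in_A(2)[OF assms] unfolding necklace_def by (meson leD)
qed

lemma count_all:
  assumes "u 0 = 1"
  shows "{y \<in> strings_ge k n w. \<forall>i. not_below u 1 (cyc y) i} = strings_ge k n w"
proof -
  have "1 \<le> cyc y i" if "y \<in> strings_ge k n w" for y i
  proof -
    have "cyc y i \<in> set y" using strings_geD(1)[OF that] n by (simp add: cyc_def)
    then show ?thesis using strings_geD(2)[OF that] by auto
  qed
  then show ?thesis using assms by (auto simp: not_below_def)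
qed

lemma wp_rank:
  assumes s: "s \<in> strings_ge k n w" and w2: "3 \<le> k + w" and m: "m = ram_input n k w s"
  shows "wp (rank_space n k w) rank_prog (rank_time n k w)
    (\<lambda>m'. m' 0 = cyclic_rank (ucycle_ge k n w) s) m"
proof -
  define S where "S = rank_space n k w"
  define va where "va = 3 * n + k + w + 60"
  note s' = strings_geD[OF s]
  let ?N = "card (strings_ge k n w)"
  let ?rank = "\<lambda>m'. m' 0 = cyclic_rank (ucycle_ge k n w) s"
  let ?C = "\<lambda>u L. card {y \<in> strings_ge k n w. \<forall>i. not_below u L (cyc y) i}"
  have S60: "60 \<le> S" "va + n + (n + 1) * (w + 1) \<le> S" "4 * n + k + w + 70 \<le> S"
    by (simp_all add: S_def rank_space_def va_def)
  have base_regs: "m' 0 = n" "m' 2 = w" "m' 4 = 1" "m' 5 = va" "m' 6 = va + n" "m' 7 = w + 1"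
    "m' 8 = n + 1" "m' 9 = k" if "base n k w s m'" for m'
    using that by (simp_all add: base_def va_def)
  have count: "wp S count_prog (count_time n k w)
      (\<lambda>m'. frame ({24..57} \<union> {va..}) m1 m' \<and> m' 45 = ?C u L) m1"
    if "base n k w s m1" "L = max 1 (m1 22)" "L \<le> n" "prenecklace L u" "\<And>j. j < L \<Longrightarrow> u j \<in> {1..k}"
      "u = (\<lambda>i. m1 (va + i))" for m1 u L
    unfolding that(6)
    by (rule wp_count[OF base_regs[OF that(1)] that(2,3) that(4,5)[unfolded that(6)]])
      (use S60 in \<open>auto simp: va_def\<close>)
  have init: "wp S init_prog (18 * n + 60) (\<lambda>m'. base n k w s m') m"
    using wp_init[OF m s'(1) _ w2 S60(3)] n by simp
  have total: "wp S (Block [Const 22 0, Store 5 4] ;; count_prog ;; Block [Move 58 45])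
      (2 + (count_time n k w + 1)) (\<lambda>m'. base n k w s m' \<and> m' 58 = ?N) m1"
    if b: "base n k w s m1" for m1
  proof -
    define m2 where "m2 = m1(22 := 0, va := 1)"
    have m2: "blk [Const 22 0, Store 5 4] m1 = m2"
      using base_regs[OF b] by (simp add: m2_def)
    have b2: "base n k w s m2"
      using b by (rule base_frame[of _ _ _ _ _ "{22, va}"]) (auto simp: m2_def va_def)
    have c: "wp S count_prog (count_time n k w)
        (\<lambda>m'. frame ({24..57} \<union> {va..}) m2 m' \<and> m' 45 = ?N) m2"
      using count[OF b2, of 1 "\<lambda>i. m2 (va + i)"] count_all[of "\<lambda>i. m2 (va + i)"] n k
      by (simp add: m2_def va_def prenecklace_1[simplified])
    have e: "wp S (Block [Move 58 45]) 1 (\<lambda>m'. base n k w s m' \<and> m' 58 = ?N) m3"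
      if m3: "frame ({24..57} \<union> {va..}) m2 m3 \<and> m3 45 = ?N" for m3
    proof (rule wp_Block)
      have "frame ({24..58} \<union> {va..}) m2 (m3(58 := m3 45))"
        using m3 by (auto intro: frame_mono)
      then have "base n k w s (m3(58 := m3 45))"
        by (rule base_frame[OF b2]) (auto simp: va_def)
      then show "base n k w s (blk [Move 58 45] m3) \<and> blk [Move 58 45] m3 58 = ?N"
        using m3 by simp
    qed (use S60 in auto)
    show ?thesis
    proof (rule wp_Block_Seq)
      show "wp S (count_prog ;; Block [Move 58 45]) (count_time n k w + 1)
        (\<lambda>m'. base n k w s m' \<and> m' 58 = ?N) (blk [Const 22 0, Store 5 4] m1)"
        unfolding m2 by (rule wp_Seq[OF c e])
    qed (use base_regs[OF b] S60 in auto)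
  qed
  let ?P2 = "\<lambda>m'. base n k w s m' \<and> m' 58 = ?N \<and> scan (key s) n (m' 11) (m' 12) \<and>
    run k ((!) s) (key s) n (m' 13) (m' 14) (m' 15)"
  have search: "wp S search_prog (n * (9 * n + 23) + 9) ?P2 m1"
    if b: "base n k w s m1 \<and> m1 58 = ?N" for m1
  proof -
    define p where "p = n + k + w + 60"
    have x: "m1 (p + i) = cyc s i" if "i < 2 * n" for i
      using b that by (simp add: base_def p_def)
    \<comment> \<open>The keys as read from memory. They agree with \<open>key s\<close> only up to
      \<open>j = n\<close>, where the window ends with the doubled input.\<close>
    define key' where "key' = (\<lambda>j. horner (k + 1) (\<lambda>i. k - m1 (p + (j + i))) n)"
    have key': "key' j = key s j" if "j \<le> n" for j
      unfolding key'_def key_def by (rule horner_cong) (use that x in simp)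
    have le: "m1 (p + i) \<le> k" if "i < n" for i
      using x[of i] that s' cyc_nth[of i s] by (auto simp: subset_iff)
    have b': "base n k w s m1" using b by blast
    have p3: "m1 3 = p" using b' by (simp add: base_def p_def)
    have pS: "60 \<le> p" "p + 2 * n \<le> S" using S60(2) by (simp_all add: p_def va_def)
    have "wp S search_prog (n * (9 * n + 23) + 9)
      (\<lambda>m'. frame ({10..21} \<union> {59}) m1 m' \<and> scan key' n (m' 11) (m' 12) \<and>
         run k (\<lambda>i. m1 (p + i)) key' n (m' 13) (m' 14) (m' 15)) m1"
      unfolding key'_def
      by (rule wp_search[of m1 n p k S, OF base_regs(1)[OF b'] p3 base_regs(3)[OF b'] base_regs(8)[OF b']
            le pS S60(1)])
    then show ?thesis
    proof (rule wp_mono)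
      fix m' assume m': "frame ({10..21} \<union> {59}) m1 m' \<and> scan key' n (m' 11) (m' 12) \<and>
         run k (\<lambda>i. m1 (p + i)) key' n (m' 13) (m' 14) (m' 15)"
      have "base n k w s m'"
        by (rule base_frame[OF b' conjunct1[OF m']]) auto
      moreover have "m' 58 = ?N" using b frameD[OF conjunct1[OF m'], of 58] by simp
      moreover have "scan (key s) n (m' 11) (m' 12)"
      proof -
        have "scan key' n (m' 11) (m' 12)" using m' by blast
        then show ?thesis using n key' unfolding scan_def by (metis gr0I not_numeral_le_zero)
      qed
      moreover have "run k ((!) s) (key s) n (m' 13) (m' 14) (m' 15)"
      proof -
        have xs: "m1 (p + a) = s ! a" if "a < n" for a
          using x[of a] that cyc_nth[of a s] s'(1) by simp
        have "(\<Sum>a<n. k - m1 (p + a)) = (\<Sum>a<n. k - s ! a)"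
          by (intro sum.cong refl) (simp add: xs)
        moreover have R: "m' 13 \<le> n" using m' by (simp add: run_def)
        moreover have "s ! a = k" if "a < m' 13" for a
          using m' R that xs[of a] by (simp add: run_def)
        moreover have "m' 13 = n \<or> s ! (m' 13) \<noteq> k"
          using m' R xs[of "m' 13"] unfolding run_def by (metis le_neq_implies_less)
        moreover have "m' 14 = key s (m' 13)" if "1 \<le> m' 13"
          using m' R that key'[of "m' 13"] by (simp add: run_def)
        ultimately show ?thesis using m' by (simp add: run_def)
      qed
      ultimately show "?P2 m'" by blast
    qed simp
  qed
  let ?P3 = "\<lambda>J R m'. base n k w s m' \<and> m' va = 1 \<and> m' 58 = ?N \<and> m' 12 = J \<and> m' 13 = R \<and>
    (if 1 \<le> R \<and> rotate R s = rotate J s then m' 21 = 0 \<and> m' 20 = R \<and> m' 22 = n - R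
     else m' 21 = 1 \<and> m' 20 = J \<and> m' 22 = n)"
  have rest: "wp S (select_prog ;; fetch_prog ;; count_prog ;; output_prog)
      ((2 + ((3 + 2) + 2)) + ((9 * n + 3) + (count_time n k w + (1 + ((2 + 2) + 2))))) ?rank m1"
    if m1: "?P2 m1" for m1
  proof -
    define J R where "J = m1 12" and "R = m1 13"
    have scan: "scan (key s) n (m1 11) J" and run: "run k ((!) s) (key s) n R (m1 14) (m1 15)"
      using m1 by (simp_all add: J_def R_def)
    note J = scan_rotation[OF s scan]
    have R: "R \<le> n" "\<And>j. j < R \<Longrightarrow> s ! j = k" "R = n \<or> s ! R \<noteq> k" "1 \<le> R \<Longrightarrow> m1 14 = key s R"
      using run by (auto simp: run_def)
    \<comment> \<open>The best key is at least that of rotation \<open>R\<close>, so here a single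
      truncated difference does test equality; and rotations with equal keys are equal.\<close>
    have caseB: "rotate R s = rotate J s \<longleftrightarrow> m1 11 - m1 14 = 0" if R1: "1 \<le> R"
    proof
      assume eq: "rotate R s = rotate J s"
      then have "key s R = key s J" by (simp add: key_eq s'(1))
      then show "m1 11 - m1 14 = 0" using J(3) R(4)[OF R1] by simp
    next
      assume "m1 11 - m1 14 = 0"
      moreover have "key s R \<le> m1 11" using scan R(1) R1 unfolding scan_def by blast
      ultimately have "key s R = key s J" using J(3) R(4)[OF R1] by simp
      then show "rotate R s = rotate J s" by (rule J(6))
    qed
    define m2 where "m2 = m1(19 := m1 11 - m1 14, va := 1)"
    have b1: "base n k w s m1" using m1 by blast
    have m2: "blk [Sub 19 11 14, Store 5 4] m1 = m2"
      using base_regs[OF b1] by (simp add: m2_def va_def)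
    have m2r: "m2 va = 1" "m2 58 = ?N" "m2 12 = J" "m2 13 = R" "m2 19 = m1 11 - m1 14"
      using m1 by (simp_all add: m2_def J_def R_def va_def)
    have b2: "base n k w s m2"
      using b1 by (rule base_frame[of _ _ _ _ _ "{19, va}"]) (auto simp: m2_def va_def)
    have b2': "base n k w s (m2(20 := x, 22 := y, 21 := z))" for x y z
      using b2 by (rule base_frame[of _ _ _ _ _ "{20, 21, 22}"]) auto
    have A: "wp S (Block [Move 20 12, Move 22 0, Const 21 1]) T (?P3 J R) m2"
      if "\<not> (1 \<le> R \<and> rotate R s = rotate J s)" "3 \<le> T" for T
    proof (rule wp_Block)
      have "blk [Move 20 12, Move 22 0, Const 21 1] m2 = m2(20 := J, 22 := n, 21 := 1)"
        using m2r base_regs[OF b2] by simp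
      then show "?P3 J R (blk [Move 20 12, Move 22 0, Const 21 1] m2)"
        using that b2' m2r by (simp add: va_def)
    qed (use S60 that in auto)
    have B: "wp S (Block [Move 20 13, Sub 22 0 13, Const 21 0]) T (?P3 J R) m2"
      if "1 \<le> R \<and> rotate R s = rotate J s" "3 \<le> T" for T
    proof (rule wp_Block)
      have "blk [Move 20 13, Sub 22 0 13, Const 21 0] m2 = m2(20 := R, 22 := n - R, 21 := 0)"
        using m2r base_regs[OF b2] by simp
      then show "?P3 J R (blk [Move 20 13, Sub 22 0 13, Const 21 0] m2)"
        using that b2' m2r by (simp add: va_def)
    qed (use S60 that in auto)
    have select: "wp S select_prog (2 + ((3 + 2) + 2)) (?P3 J R) m1"
      unfolding select_prog_def
    proof (rule wp_Block_Seq)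
      show "wp S (Cond 13 (Cond 19 (Block [Move 20 12, Move 22 0, Const 21 1])
          (Block [Move 20 13, Sub 22 0 13, Const 21 0])) (Block [Move 20 12, Move 22 0, Const 21 1]))
        ((3 + 2) + 2) (?P3 J R) (blk [Sub 19 11 14, Store 5 4] m1)"
        unfolding m2
        by (intro wp_Cond A B) (use S60 m2r caseB in \<open>auto simp: Suc_le_eq\<close>)
    qed (use base_regs[OF b1] S60 in auto)
    define flag where "flag \<longleftrightarrow> 1 \<le> R \<and> rotate R s = rotate J s"
    define d l where "d = (if flag then R else J)" and "l = (if flag then n - R else n)"
    define u where "u = (if flag then drop R s else rotate J s)"
    have dl: "d \<le> n" "l \<le> n" "length u = l" using R(1) J(2) s'(1) by (auto simp: d_def l_def u_def)
    have ui: "u ! i = cyc s (d + i)" if "i < l" for i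
      using that R(1) s'(1) by (auto simp: u_def d_def l_def nth_rotate_cyc cyc_nth split: if_splits)
    \<comment> \<open>In both cases \<open>u\<close> is a prefix of the necklace
      \<open>rotate J s\<close>, which provides the prenecklace condition and the range of the
      letters.\<close>
    have u_rot: "u ! i = rotate J s ! i" if "i < l" for i
    proof (cases flag)
      case True
      then have "rotate J s ! i = rotate R s ! i" by (simp add: flag_def)
      also have "\<dots> = cyc s (R + i)" using that dl s'(1) by (simp add: nth_rotate_cyc)
      finally show ?thesis using ui[OF that] True by (simp add: d_def)
    qed (simp add: u_def)
    have cont: "wp S (fetch_prog ;; count_prog ;; output_prog)
        ((9 * n + 3) + (count_time n k w + (1 + ((2 + 2) + 2)))) ?rank m3"
      if m3: "?P3 J R m3" for m3
    proof -
      have b3: "base n k w s m3" using m3 by blast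
      have m3r: "m3 20 = d" "m3 22 = l" "m3 21 = (if flag then 0 else 1)" "m3 12 = J" "m3 13 = R" "m3 58 = ?N"
        using m3 by (auto simp: flag_def d_def l_def)
      have fetch: "wp S fetch_prog (9 * n + 3)
          (\<lambda>m'. frame ({16..19} \<union> {va..<va + l}) m3 m' \<and> (\<forall>i<l. m' (va + i) = cyc s (d + i))) m3"
        using wp_fetch[OF b3 m3r(1,2) dl(1,2), of S] base_regs(4)[OF b3] by (simp add: S_def)
      have cont2: "wp S (count_prog ;; output_prog) (count_time n k w + (1 + ((2 + 2) + 2))) ?rank m4"
        if m4: "frame ({16..19} \<union> {va..<va + l}) m3 m4 \<and> (\<forall>i<l. m4 (va + i) = cyc s (d + i))" for m4
      proof -
        have f: "m4 a = m3 a" if "a \<notin> {16..19}" "a < va" for a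
          using m4 that by (auto dest: frameD)
        have b4: "base n k w s m4"
          by (rule base_frame[OF b3 conjunct1[OF m4]]) (auto simp: va_def)
        have m4r: "m4 22 = l" "m4 21 = (if flag then 0 else 1)" "m4 12 = J" "m4 13 = R" "m4 58 = ?N"
          using m3r by (simp_all add: f va_def)
        define v L where "v = (\<lambda>i. m4 (va + i))" and "L = max 1 l"
        have vu: "v i = u ! i" if "i < l" for i
          using m4 ui that by (simp add: v_def)
        \<comment> \<open>For \<open>s = replicate n k\<close> the prefix is empty and nothing is
          fetched; the 1 stored by \<open>select_prog\<close> is still there and excludes no
          string.\<close>
        have v0: "v 0 = 1" if "l = 0"
          using m3 m4 that by (auto simp: v_def dest!: frameD[of _ _ _ va])  (auto simp: va_def)
        have Ln: "L \<le> n" using dl n by (simp add: L_def)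
        have preL: "prenecklace L v"
        proof (cases "l = 0")
          case True
          then show ?thesis using prenecklace_1 by (simp add: L_def)
        next
          case False
          have "prenecklace l ((!) (rotate J s))"
            using necklace_prenecklace[OF J(4)] dl(2) by (rule prenecklace_mono)
          then show ?thesis
            using prenecklace_cong[of l v "(!) (rotate J s)"] vu u_rot False by (simp add: L_def)
        qed
        have vk: "v j \<in> {1..k}" if "j < L" for j
        proof (cases "l = 0")
          case True
          then show ?thesis using that v0 k by (simp add: L_def)
        next
          case False
          then have "j < l" using that by (simp add: L_def)
          then have "v j = rotate J s ! j" "j < length (rotate J s)" using vu u_rot dl s'(1) by auto
          then have "v j \<in> set (rotate J s)" by (metis nth_mem)
          then show ?thesis using s'(2) by auto
        qed
        have below_u: "below u = ?N - ?C v L"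
        proof (cases "l = 0")
          case True
          then have "u = []" using dl(3) by simp
          then have "below u = 0" by (simp add: below_def)
          moreover have "?C v L = ?N" using count_all[of v] v0 True by (simp add: L_def)
          ultimately show ?thesis by simp
        next
          case False
          have "u = map v [0..<l]" using dl(3) vu by (intro nth_equalityI) auto
          from below_eq[OF dl(2) this] False show ?thesis by (simp add: L_def)
        qed
        have c: "wp S count_prog (count_time n k w)
            (\<lambda>m'. frame ({24..57} \<union> {va..}) m4 m' \<and> m' 45 = ?C v L) m4"
          using count[OF b4 _ Ln preL vk v_def] m4r(1) by (simp add: L_def)
        have out: "wp S output_prog (1 + ((2 + 2) + 2)) ?rank m5"
          if m5: "frame ({24..57} \<union> {va..}) m4 m5 \<and> m5 45 = ?C v L" for m5
        proof -
          have g: "m5 a = m4 a" if "a \<notin> {24..57}" "a < va" for a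
            using m5 that by (auto dest: frameD)
          have r5: "m5 21 = (if flag then 0 else 1)" "m5 12 = J" "m5 13 = R" "m5 58 = ?N" "m5 0 = n" "m5 4 = 1"
            using m4r base_regs[OF b4] by (simp_all add: g va_def)
          define m6 where "m6 = m5(15 := below u)"
          have m6: "blk [Sub 15 58 45] m5 = m6" using r5 m5 by (simp add: m6_def below_u)
          have r6: "m6 21 = (if flag then 0 else 1)" "m6 12 = J" "m6 13 = R" "m6 58 = ?N" "m6 0 = n" "m6 4 = 1"
            "m6 15 = below u"
            using r5 by (simp_all add: m6_def)
          have rank: "cyclic_rank (ucycle_ge k n w) s =
            (if flag then (if below u = 0 then ?N - R else below u - R) + 1 else below u + n - J + 1)"
          proof (cases flag)
            case True
            then show ?thesis
              using rank_run[OF s R(1-3)] J(4) by (simp add: flag_def u_def)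
          next
            case False
            then have "\<not> (1 \<le> R \<and> rotate R s = rotate J s)" by (simp only: flag_def not_False_eq_True)
            moreover have "u = rotate J s" using False by (simp add: u_def)
            ultimately show ?thesis
              using rank_no_run[OF s R(1-3) J(1,2,4,5)] J(2) False by simp
          qed
          show ?thesis
            unfolding output_prog_def
          proof (rule wp_Block_Seq)
            show "wp S (Cond 21 (Block [Add 15 15 0, Sub 15 15 12, Add 0 15 4])
              (Cond 15 (Block [Sub 15 15 13, Add 0 15 4]) (Block [Sub 58 58 13, Add 0 58 4])))
              ((2 + 2) + 2) ?rank (blk [Sub 15 58 45] m5)"
              unfolding m6 rank
              by (intro wp_Cond wp_Block) (use S60 r6 in \<open>auto split: if_splits\<close>)
          qed (use S60 in auto)
        qed
        show ?thesis by (rule wp_Seq[OF c out])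
      qed
      show ?thesis by (rule wp_Seq[OF fetch cont2])
    qed
    show ?thesis by (rule wp_Seq[OF select cont])
  qed
  have "wp S rank_prog ((18 * n + 60) + ((2 + (count_time n k w + 1)) + ((n * (9 * n + 23) + 9) +
    ((2 + ((3 + 2) + 2)) + ((9 * n + 3) + (count_time n k w + (1 + ((2 + 2) + 2)))))))) ?rank m"
    unfolding rank_prog_def
    by (rule wp_Seq[OF init wp_Seq[OF total wp_Seq[OF search rest]]])
  then show ?thesis
    unfolding S_def by (rule wp_mono) (auto simp: rank_time_def)
qed

end

section \<open>Asymptotic bounds\<close>

lemma count_time_le:
  assumes "1 \<le> n" "1 \<le> k" "w < k * n"
  shows "count_time n k w \<le> 160 * (n ^ 3 * k ^ 2)"
proof -
  have 1: "1 \<le> n * k" "n \<le> n * k" using assms by auto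
  have "n * (10 * k + 21) + 15 = 10 * (n * k) + 21 * n + 15" by (simp add: algebra_simps)
  \<comment> \<open>Lower-order terms are charged to n k >= 1: 46 = 10 + 21 + 15, and 53 = 46 + 7
    below. Doubling for n + 1 <= 2 n gives 106, and the part 32 n + 20 of the running time adds at
    most 52.\<close>
  then have "n * (10 * k + 21) + 15 \<le> 46 * (n * k)" using 1 by linarith
  moreover have "w + 1 \<le> n * k" using assms(3) by (simp add: mult.commute)
  ultimately have "(w + 1) * (n * (10 * k + 21) + 15) \<le> (n * k) * (46 * (n * k))"
    by (rule mult_le_mono[rotated])
  moreover have "1 \<le> (n * k) * (n * k)" using 1 by (metis mult_le_mono nat_mult_1)
  ultimately have "(w + 1) * (n * (10 * k + 21) + 15) + 7 \<le> 53 * ((n * k) * (n * k))" by linarith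
  moreover have "n + 1 \<le> 2 * n" using assms(1) by simp
  ultimately have "(n + 1) * ((w + 1) * (n * (10 * k + 21) + 15) + 7) \<le> 2 * n * (53 * ((n * k) * (n * k)))"
    by (intro mult_le_mono)
  also have "\<dots> = 106 * (n ^ 3 * k ^ 2)" by (simp add: power2_eq_square power3_eq_cube)
  finally have "(n + 1) * ((w + 1) * (n * (10 * k + 21) + 15) + 7) \<le> 106 * (n ^ 3 * k ^ 2)" .
  moreover have "n * 1 \<le> n * (n ^ 2 * k ^ 2)" using assms by (intro mult_le_mono2) (simp add: Suc_le_eq)
  then have "n \<le> n ^ 3 * k ^ 2" by (simp add: power2_eq_square power3_eq_cube mult.assoc)
  ultimately show ?thesis using assms(1) unfolding count_time_def by simp
qed

lemma rank_time_le:
  assumes "1 \<le> n" "1 \<le> k" "w < k * n"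
  shows "rank_time n k w \<le> 500 * (n ^ 3 * k ^ 2)"
proof -
  have "n * 1 \<le> n * (n ^ 2 * k ^ 2)" "(n * n) * 1 \<le> (n * n) * (n * k ^ 2)"
    using assms by (intro mult_le_mono2; simp add: Suc_le_eq)+
  then have "n \<le> n ^ 3 * k ^ 2" "n * n \<le> n ^ 3 * k ^ 2"
    by (simp_all add: power2_eq_square power3_eq_cube mult.assoc)
  moreover have "n * (9 * n + 23) = 9 * (n * n) + 23 * n" by (simp add: algebra_simps)
  \<comment> \<open>The two counts take 2 * 160, and the remaining terms 9 + 23 + 27 + 100, which
    500 covers.\<close>
  ultimately show ?thesis
    using count_time_le[OF assms] assms(1) unfolding rank_time_def by simp
qed

lemma rank_space_le:
  assumes "1 \<le> n" "1 \<le> k" "w < k * n"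
  shows "rank_space n k w \<le> 80 * (n ^ 3 * k)"
proof -
  have "n * 1 \<le> n * (n ^ 2 * k)" "k * 1 \<le> k * n ^ 3" "(k * n) * 1 \<le> (k * n) * n ^ 2"
    "(n * (n * k)) * 1 \<le> (n * (n * k)) * n"
    using assms by (intro mult_le_mono2; simp add: Suc_le_eq)+
  then have "n \<le> n ^ 3 * k" "k \<le> n ^ 3 * k" "k * n \<le> n ^ 3 * k" "n * (n * k) \<le> n ^ 3 * k"
    by (simp_all add: power2_eq_square power3_eq_cube mult_ac)
  moreover have "(n + 1) * (w + 1) \<le> (2 * n) * (n * k)"
    using assms by (intro mult_le_mono) (auto simp: mult.commute)
  then have "(n + 1) * (w + 1) \<le> 2 * (n * (n * k))" by simp
  moreover define c where "c = (n + 1) * (w + 1)"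
  \<comment> \<open>The coefficients add up to 4 + 1 + 1 + 70 + 2, where \<open>w\<close> is bounded
    by \<open>k * n\<close>.\<close>
  ultimately have "4 * n + k + w + 70 + c \<le> 80 * (n ^ 3 * k)" using assms by linarith
  then show ?thesis unfolding rank_space_def c_def .
qed

theorem theorem1:
  "\<exists>(P :: instr list) (T :: nat \<times> nat \<times> nat \<Rightarrow> nat) (S :: nat \<times> nat \<times> nat \<Rightarrow> nat).
     (\<lambda>x. real (T x)) \<in> O[principal {(n, k, w). k < w \<and> w < k * n}](\<lambda>(n, k, w). real (n ^ 3 * k ^ 2)) \<and>
     (\<lambda>x. real (S x)) \<in> O[principal {(n, k, w). k < w \<and> w < k * n}](\<lambda>(n, k, w). real (n ^ 3 * k)) \<and>
     (\<forall>n k w s. k < w \<longrightarrow> w < k * n \<longrightarrow> s \<in> strings_ge k n w \<longrightarrow>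
        computes_within P (ram_input n k w s) (T (n, k, w)) (S (n, k, w))
          (cyclic_rank (ucycle_ge k n w) s))"
proof (intro exI conjI allI impI)
  have nk: "2 \<le> n" "1 \<le> k" if "k < w" "w < k * n" for n k w :: nat
  proof -
    show "2 \<le> n"
    proof (rule ccontr)
      assume "\<not> 2 \<le> n"
      then have "k * n \<le> k * 1" by (intro mult_le_mono2) simp
      with that show False by simp
    qed
    show "1 \<le> k" using that by (cases k) auto
  qed
  \<comment> \<open>On a principal filter, eventually means at every point of the set, hence the
    explicit constants.\<close>
  show "(\<lambda>x. real (case x of (n, k, w) \<Rightarrow> rank_time n k w)) \<in>
      O[principal {(n, k, w). k < w \<and> w < k * n}](\<lambda>(n, k, w). real (n ^ 3 * k ^ 2))"
  proof (rule bigoI[where c = 500], unfold eventually_principal, clarify)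
    fix n k w :: nat assume "k < w" "w < k * n"
    with nk[OF this] rank_time_le[of n k w] have "rank_time n k w \<le> 500 * (n ^ 3 * k ^ 2)" by simp
    then have "real (rank_time n k w) \<le> real (500 * (n ^ 3 * k ^ 2))" by (simp only: of_nat_le_iff)
    then show "norm (real (rank_time n k w)) \<le> 500 * norm (real (n ^ 3 * k ^ 2))" by simp
  qed
  show "(\<lambda>x. real (case x of (n, k, w) \<Rightarrow> rank_space n k w)) \<in>
      O[principal {(n, k, w). k < w \<and> w < k * n}](\<lambda>(n, k, w). real (n ^ 3 * k))"
  proof (rule bigoI[where c = 80], unfold eventually_principal, clarify)
    fix n k w :: nat assume "k < w" "w < k * n"
    with nk[OF this] rank_space_le[of n k w] have "rank_space n k w \<le> 80 * (n ^ 3 * k)" by simp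
    then have "real (rank_space n k w) \<le> real (80 * (n ^ 3 * k))" by (simp only: of_nat_le_iff)
    then show "norm (real (rank_space n k w)) \<le> 80 * norm (real (n ^ 3 * k))" by simp
  qed
  fix n k w s assume kw: "k < w" "w < k * n" and s: "s \<in> strings_ge k n w"
  interpret necklace_cycle n k w using nk[OF kw] kw by unfold_locales auto
  have "3 \<le> k + w" using nk[OF kw] kw by simp
  from wp_rank[OF s this refl] obtain t m' where
    "t \<le> rank_time n k w" "runs (rank_space n k w) rank_prog (ram_input n k w s) t m'"
    "m' 0 = cyclic_rank (ucycle_ge k n w) s"
    unfolding wp_def by blast
  then show "computes_within (compile 0 rank_prog) (ram_input n k w s)
      (case (n, k, w) of (n, k, w) \<Rightarrow> rank_time n k w) (case (n, k, w) of (n, k, w) \<Rightarrow> rank_space n k w)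
      (cyclic_rank (ucycle_ge k n w) s)"
    using computes_within_compile by fastforce
qed

end
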